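(* For every $n\ge0$, $$\widehat{\mathrm{Lie}}_n=\sum_{Q}\chi^{\mathrm{shape}(Q)}\ \ (Q \text{ ranging over desarrangement tableaux of size } n),\qquad \widehat W_n=\sum_Q\chi^{\mathrm{shape}(Q)}\ \ (Q\text{ ranging over Whitney-generating tableaux of size } n).$$
   Context: Definitions of $\widehat{\mathrm{Lie}}_n,\widehat W_n$: Let $C_n\subset S_n$ be generated by an $n$-cycle $c$, $\chi_\zeta$ a linear character of $C_n$ sending $c$ to a primitive $n$-th root of unity, $\mathrm{Lie}_{(n)}=\chi_\zeta\uparrow_{C_n}^{S_n}$, $\ell_n=\mathrm{ch}(\mathrm{Lie}_{(n)})$ (Frobenius characteristic), $\pi_n=\omega(\ell_n)$. For $\lambda=1^{m_1}2^{m_2}\cdots$ define $\mathrm{ch}(\mathrm{Lie}_\lambda)=\prod_j h_{m_j}[\ell_j]$ and $\mathrm{ch}(W_\lambda)=\prod_{j\text{ odd}}h_{m_j}[\pi_j]\prod_{j\text{ even}}e_{m_j}[\pi_j]$ (plethysm). $\mathrm{rank}(\lambda)=|\lambda|-\ell(\lambda)$. $\widehat{\mathrm{Lie}}_n=\bigoplus_\lambda\mathrm{Lie}_\lambda$ and $\widehat W_n=\bigoplus_\lambda W_\lambda$ over all partitions $\lambda$ of $n$ with no part equal to $1$ (including $\lambda=\emptyset$ when $n=0$, giving $\mathbf 1_{S_0}$). Tableaux: a standard Young tableau $Q$ of size $n$ (rows increasing left to right, columns increasing top to bottom, entries $1,\dots,n$). An entry $i$ is an ascent of $Q$ if $i=n$,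 or $i+1$ lies in a row weakly above (same or higher row than) the row of $i$. A desarrangement tableau is a standard tableau whose smallest ascent is even. A Whitney-generating tableau is a standard tableau $Q$ that either is one of $\emptyset$, the one-row tableau with rows $(1,2)$, or the tableau with rows $(1,2),(3)$; or has size $\ge4$ and its restriction to entries $\{1,2,3,4\}$ is one of: $T_1$ with rows $(1,2),(3),(4)$; $T_2$ with rows $(1,2,4),(3)$; $T_3$ with rows $(1,2),(3,4)$; $T_4$ with rows $(1,2,3),(4)$; subject to: if the restriction is $T_3$, the smallest ascent of $Q$ that is $\ge4$ is odd; if the restriction is $T_4$, the smallest ascent of $Q$ that is $\ge4$ is even. *)

theory Defs
  imports Complex_Main "HOL-Library.Poly_Mapping" "HOL-Combinatorics.Permutations"
    "HOL-Combinatorics.Orbits"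
begin

text \<open>Polynomials with complex coefficients in countably many variables indexed by nat.
  The same type is used (a) for C[p_1,p_2,...], where variable k stands for the power sum p_k
  (this is the ring of symmetric functions over C), and (b) for ordinary polynomials in
  variables x_0, x_1, ... .\<close>

type_synonym cpoly = "(nat \<Rightarrow>\<^sub>0 nat) \<Rightarrow>\<^sub>0 complex"

definition var :: "nat \<Rightarrow> cpoly" where
  "var k = Poly_Mapping.single (Poly_Mapping.single k 1) 1"

definition const :: "complex \<Rightarrow> cpoly" where
  "const c = Poly_Mapping.single 0 c"

definition subst :: "(nat \<Rightarrow> cpoly) \<Rightarrow> cpoly \<Rightarrow> cpoly" where
  "subst \<sigma> f = (\<Sum>m\<in>Poly_Mapping.keys f.
      const (Poly_Mapping.lookup f m) * (\<Prod>k\<in>Poly_Mapping.keys m. \<sigma> k ^ Poly_Mapping.lookup m k))"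

definition adams :: "nat \<Rightarrow> cpoly \<Rightarrow> cpoly" where
  "adams k g = subst (\<lambda>i. var (i * k)) g"

definition plethysm :: "cpoly \<Rightarrow> cpoly \<Rightarrow> cpoly" where
  "plethysm f g = subst (\<lambda>k. adams k g) f"

definition omega :: "cpoly \<Rightarrow> cpoly" where
  "omega f = subst (\<lambda>k. (- 1) ^ (k + 1) * var k) f"

definition cyc_mono :: "nat \<Rightarrow> (nat \<Rightarrow> nat) \<Rightarrow> cpoly" where
  "cyc_mono n \<sigma> = (\<Prod>B\<in>{orbit \<sigma> x | x. x < n}. var (card B))"

definition frob :: "nat \<Rightarrow> ((nat \<Rightarrow> nat) \<Rightarrow> complex) \<Rightarrow> cpoly" where
  "frob n \<chi> = const (1 / of_nat (fact n)) *
     (\<Sum>\<sigma>\<in>{\<sigma>. \<sigma> permutes {0..<n}}. const (\<chi> \<sigma>) * cyc_mono n \<sigma>)"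

definition h_sym :: "nat \<Rightarrow> cpoly" where
  "h_sym m = frob m (\<lambda>_. 1)"

definition e_sym :: "nat \<Rightarrow> cpoly" where
  "e_sym m = frob m (\<lambda>\<sigma>. of_int (sign \<sigma>))"

text \<open>The n-cycle c = (0 1 ... n-1), the primitive root zeta = exp(2 pi i / n), and the
  induced character chi_zeta from C_n = <c> to S_n.\<close>
definition ncycle :: "nat \<Rightarrow> nat \<Rightarrow> nat" where
  "ncycle n i = (if i < n then Suc i mod n else i)"

definition zeta :: "nat \<Rightarrow> complex" where
  "zeta n = cis (2 * pi / real n)"

definition lie_char :: "nat \<Rightarrow> (nat \<Rightarrow> nat) \<Rightarrow> complex" where
  "lie_char n \<sigma> = (1 / of_nat n) *
     (\<Sum>\<tau>\<in>{\<tau>. \<tau> permutes {0..<n}}.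
        \<Sum>k<n. if \<tau> \<circ> \<sigma> \<circ> inv \<tau> = (ncycle n ^^ k) then zeta n ^ k else 0)"

definition ell :: "nat \<Rightarrow> cpoly" where
  "ell n = frob n (lie_char n)"

definition pi_sym :: "nat \<Rightarrow> cpoly" where
  "pi_sym n = omega (ell n)"

text \<open>Partitions of n with no part equal to 1, encoded by multiplicities m j (j = 2..n).\<close>
definition parts_no1 :: "nat \<Rightarrow> (nat \<Rightarrow> nat) set" where
  "parts_no1 n = {m. (\<forall>j. m j \<noteq> 0 \<longrightarrow> 2 \<le> j \<and> j \<le> n) \<and> (\<Sum>j\<in>{2..n}. j * m j) = n}"

definition ch_lie_hat :: "nat \<Rightarrow> cpoly" where
  "ch_lie_hat n = (\<Sum>m\<in>parts_no1 n. \<Prod>j\<in>{2..n}. plethysm (h_sym (m j)) (ell j))"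

definition ch_W_hat :: "nat \<Rightarrow> cpoly" where
  "ch_W_hat n = (\<Sum>m\<in>parts_no1 n. \<Prod>j\<in>{2..n}.
      if odd j then plethysm (h_sym (m j)) (pi_sym j) else plethysm (e_sym (m j)) (pi_sym j))"

definition spec :: "nat \<Rightarrow> cpoly \<Rightarrow> cpoly" where
  "spec N f = subst (\<lambda>k. \<Sum>i<N. var i ^ k) f"

definition diagram :: "nat list \<Rightarrow> (nat \<times> nat) set" where
  "diagram lam = {(i, j). i < length lam \<and> j < lam ! i}"

definition ssyt :: "nat list \<Rightarrow> nat \<Rightarrow> ((nat \<times> nat) \<Rightarrow> nat) set" where
  "ssyt lam N = {T. (\<forall>c. c \<notin> diagram lam \<longrightarrow> T c = 0)
      \<and> (\<forall>c\<in>diagram lam. T c < N)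
      \<and> (\<forall>i j. (i, Suc j) \<in> diagram lam \<longrightarrow> T (i, j) \<le> T (i, Suc j))
      \<and> (\<forall>i j. (Suc i, j) \<in> diagram lam \<longrightarrow> T (i, j) < T (Suc i, j))}"

definition schur :: "nat \<Rightarrow> nat list \<Rightarrow> cpoly" where
  "schur N lam = (\<Sum>T\<in>ssyt lam N. \<Prod>c\<in>diagram lam. var (T c))"

definition std_tableau :: "nat \<Rightarrow> nat list list \<Rightarrow> bool" where
  "std_tableau n Q \<longleftrightarrow>
     (\<forall>r\<in>set Q. r \<noteq> []) \<and>
     (\<forall>i. Suc i < length Q \<longrightarrow> length (Q ! Suc i) \<le> length (Q ! i)) \<and>
     (\<forall>r\<in>set Q. sorted_wrt (<) r) \<and>
     (\<forall>i j. Suc i < length Q \<and> j < length (Q ! Suc i) \<longrightarrow> Q ! i ! j < Q ! Suc i ! j) \<and>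
     mset (concat Q) = mset [1..<Suc n]"

definition shape :: "nat list list \<Rightarrow> nat list" where
  "shape Q = map length Q"

definition row_of :: "nat list list \<Rightarrow> nat \<Rightarrow> nat" where
  "row_of Q i = (LEAST r. r < length Q \<and> i \<in> set (Q ! r))"

definition is_ascent :: "nat \<Rightarrow> nat list list \<Rightarrow> nat \<Rightarrow> bool" where
  "is_ascent n Q i \<longleftrightarrow> 1 \<le> i \<and> i \<le> n \<and> (i = n \<or> row_of Q (Suc i) \<le> row_of Q i)"

definition desarr_tableau :: "nat \<Rightarrow> nat list list \<Rightarrow> bool" where
  "desarr_tableau n Q \<longleftrightarrow> std_tableau n Q \<and>
     (n = 0 \<or> even (LEAST i. is_ascent n Q i))"

definition restrict4 :: "nat list list \<Rightarrow> nat list list" where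
  "restrict4 Q = filter (\<lambda>r. r \<noteq> []) (map (filter (\<lambda>x. x \<le> 4)) Q)"

definition whitney_tableau :: "nat \<Rightarrow> nat list list \<Rightarrow> bool" where
  "whitney_tableau n Q \<longleftrightarrow> std_tableau n Q \<and>
     (Q = [] \<or> Q = [[1, 2]] \<or> Q = [[1, 2], [3]] \<or>
      (4 \<le> n \<and>
        (restrict4 Q = [[1, 2], [3], [4]] \<or>
         restrict4 Q = [[1, 2, 4], [3]] \<or>
         (restrict4 Q = [[1, 2], [3, 4]] \<and> odd (LEAST i. 4 \<le> i \<and> is_ascent n Q i)) \<or>
         (restrict4 Q = [[1, 2, 3], [4]] \<and> even (LEAST i. 4 \<le> i \<and> is_ascent n Q i)))))"

end

theory Submission
  imports Defs "HOL-Number_Theory.Cong" "HOL-Computational_Algebra.Formal_Power_Series"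
begin

text \<open>Both sides satisfy the same recurrence in \<open>n\<close>. On the symmetric function side, logarithmic
  differentiation of \<open>\<Prod>\<^sub>j H[\<ell>\<^sub>j]\<close>, with \<open>\<ell>\<^sub>j = 1/j \<Sum>\<^bsub>d|j\<^esub> \<mu>(d) p\<^sub>d^(j/d)\<close>, gives \<open>1 / (1 - p\<^sub>1)\<close>, and the
  analogous product for the \<open>\<pi>\<^sub>j\<close> is \<open>(1 + p\<^sub>2) / (1 - p\<^sub>1)\<close>. Dividing by the factor \<open>j = 1\<close>, which is
  \<open>H = 1 / (\<Sum>(-1)^n e\<^sub>n)\<close>, yields \<open>L\<^sub>n = p\<^sub>1 L\<^sub>n\<^sub>-\<^sub>1 + (-1)^n e\<^sub>n\<close> and
  \<open>W\<^sub>n = p\<^sub>1 W\<^sub>n\<^sub>-\<^sub>1 + (-1)^n (e\<^sub>n + p\<^sub>2 e\<^sub>n\<^sub>-\<^sub>2)\<close>, where \<open>e\<^sub>n + p\<^sub>2 e\<^sub>n\<^sub>-\<^sub>2 = s(3,1\<dots>) - s(2,2,1\<dots>)\<close> for \<open>n \<ge> 4\<close>.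
  On the tableau side, appending the entry \<open>n\<close> multiplies by \<open>p\<^sub>1\<close> (Pieri), except that the
  smallest ascent moves from \<open>n - 1\<close> to \<open>n\<close> when the tableau descends all the way to \<open>n\<close>. There is
  exactly one such tableau for each seed; its shape is a column, a hook or \<open>(2,2,1\<dots>)\<close>.\<close>

section \<open>Substitution homomorphisms\<close>

text \<open>Both sides are compared after p_k has become x_0^k + ... + x_(N-1)^k, because Schur
  functions are given here only as sums over semistandard tableaux in \<open>N\<close> letters.
  Substitution suits plethysm, which is itself a nested substitution, but h_m, e_m and ell_n are
  given as averages over permutations. The bridge is Newton's recursion, which has to be extracted
  from the cycle structure: it says that the series of the h_m has the power sums as logarithmic
  derivative. Infinite products never occur, since only parts up to \<open>n\<close> affect the
  coefficient of t^n and logarithmic derivatives need to agree only up to that degree. On the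
  tableau side the entries of the seed are frozen. A condition on frozen entries alone is carried
  along by multiplication with p_1, which is why \<open>T1\<close> and \<open>T2\<close> bear no
  parity condition; the opposite parities at \<open>T3\<close> and \<open>T4\<close> produce the two
  signs in s(3,1...) - s(2,2,1...).\<close>

lemma const_add: "const (a + b) = const a + const b"
  by (simp add: const_def single_add)

lemma const_mult: "const (a * b) = const a * const b"
  by (simp add: const_def mult_single)

lemma const_0 [simp]: "const 0 = 0"
  by (simp add: const_def)

lemma const_1 [simp]: "const 1 = 1"
  by (simp add: const_def)

lemma const_of_nat: "const (of_nat n) = of_nat n"
  by (simp add: const_def)

lemma const_sum: "const (sum f A) = (\<Sum>x\<in>A. const (f x))"
  by (induction A rule: infinite_finite_induct) (simp_all add: const_add)

definition meval :: "(nat \<Rightarrow> cpoly) \<Rightarrow> (nat \<Rightarrow>\<^sub>0 nat) \<Rightarrow> cpoly" where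
  "meval \<sigma> m = (\<Prod>k\<in>Poly_Mapping.keys m. \<sigma> k ^ Poly_Mapping.lookup m k)"

text \<open>Padding with zero exponents puts monomials of different support on one index set, where
  they multiply factor by factor.\<close>

lemma meval_superset:
  assumes "finite S" "Poly_Mapping.keys m \<subseteq> S"
  shows "meval \<sigma> m = (\<Prod>k\<in>S. \<sigma> k ^ Poly_Mapping.lookup m k)"
  unfolding meval_def using assms
  by (intro prod.mono_neutral_left) (auto simp: in_keys_iff)

lemma meval_add: "meval \<sigma> (a + b) = meval \<sigma> a * meval \<sigma> b"
proof -
  let ?S = "Poly_Mapping.keys a \<union> Poly_Mapping.keys b"
  have "meval \<sigma> (a + b) = (\<Prod>k\<in>?S. \<sigma> k ^ Poly_Mapping.lookup (a + b) k)"
    by (rule meval_superset) (use keys_add[of a b] in auto)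
  moreover have "meval \<sigma> a = (\<Prod>k\<in>?S. \<sigma> k ^ Poly_Mapping.lookup a k)"
    "meval \<sigma> b = (\<Prod>k\<in>?S. \<sigma> k ^ Poly_Mapping.lookup b k)"
    by (rule meval_superset; auto)+
  ultimately show ?thesis
    by (simp add: lookup_add power_add prod.distrib)
qed

lemma subst_superset:
  assumes "finite S" "Poly_Mapping.keys f \<subseteq> S"
  shows "subst \<sigma> f = (\<Sum>m\<in>S. const (Poly_Mapping.lookup f m) * meval \<sigma> m)"
  unfolding subst_def meval_def[symmetric] using assms
  by (intro sum.mono_neutral_left) (auto simp: in_keys_iff)

lemma subst_0 [simp]: "subst \<sigma> 0 = 0"
  by (simp add: subst_def)

lemma subst_add: "subst \<sigma> (f + g) = subst \<sigma> f + subst \<sigma> g"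
proof -
  let ?S = "Poly_Mapping.keys f \<union> Poly_Mapping.keys g"
  have "subst \<sigma> (f + g) = (\<Sum>m\<in>?S. const (Poly_Mapping.lookup (f + g) m) * meval \<sigma> m)"
    by (rule subst_superset) (use keys_add[of f g] in auto)
  moreover have "subst \<sigma> f = (\<Sum>m\<in>?S. const (Poly_Mapping.lookup f m) * meval \<sigma> m)"
    "subst \<sigma> g = (\<Sum>m\<in>?S. const (Poly_Mapping.lookup g m) * meval \<sigma> m)"
    by (rule subst_superset; auto)+
  ultimately show ?thesis
    by (simp add: lookup_add const_add distrib_right sum.distrib)
qed

lemma subst_single: "subst \<sigma> (Poly_Mapping.single m c) = const c * meval \<sigma> m"
  using subst_superset[of "{m}" "Poly_Mapping.single m c" \<sigma>] by (auto split: if_splits)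

lemma subst_sum: "subst \<sigma> (sum f A) = (\<Sum>x\<in>A. subst \<sigma> (f x))"
  by (induction A rule: infinite_finite_induct) (simp_all add: subst_add)

lemma cpoly_as_sum:
  "(f::cpoly) = (\<Sum>m\<in>Poly_Mapping.keys f. Poly_Mapping.single m (Poly_Mapping.lookup f m))"
  by (rule poly_mapping_eqI)
     (simp add: lookup_sum lookup_single when_def sum.delta in_keys_iff)

text \<open>Expanding both factors into monomials reduces the claim to \<open>meval_add\<close>; the
  support of \<open>f * g\<close>, where terms may have cancelled, is never examined.\<close>

lemma subst_mult: "subst \<sigma> (f * g) = subst \<sigma> f * subst \<sigma> g"
proof -
  have *: "subst \<sigma> (Poly_Mapping.single a c * Poly_Mapping.single b d) =
      subst \<sigma> (Poly_Mapping.single a c) * subst \<sigma> (Poly_Mapping.single b d)" for a b c d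
    by (simp add: mult_single subst_single meval_add const_mult)
  show ?thesis
    apply (subst (1 2) cpoly_as_sum[of f], subst (1 2) cpoly_as_sum[of g])
    apply (simp only: sum_product subst_sum *)
    done
qed

lemma subst_const [simp]: "subst \<sigma> (const c) = const c"
  by (simp add: const_def subst_single meval_def)

lemma subst_1 [simp]: "subst \<sigma> 1 = 1"
  using subst_const[of \<sigma> 1] by simp

lemma subst_var [simp]: "subst \<sigma> (var k) = \<sigma> k"
  by (simp add: var_def subst_single meval_def)

lemma subst_prod: "subst \<sigma> (prod f A) = (\<Prod>x\<in>A. subst \<sigma> (f x))"
  by (induction A rule: infinite_finite_induct) (simp_all add: subst_mult)

lemma subst_power: "subst \<sigma> (f ^ n) = subst \<sigma> f ^ n"
  by (induction n) (simp_all add: subst_mult)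

lemma subst_uminus: "subst \<sigma> (- f) = - subst \<sigma> f"
  using subst_add[of \<sigma> f "- f"] by (simp add: eq_neg_iff_add_eq_0 add.commute)

text \<open>This is what makes plethysm tractable: a substitution applied to a plethysm moves into
  the inner argument.\<close>

lemma subst_subst: "subst \<sigma> (subst \<tau> f) = subst (\<lambda>k. subst \<sigma> (\<tau> k)) f"
  by (simp add: subst_def[of \<tau> f] subst_def[of "\<lambda>k. subst \<sigma> (\<tau> k)" f]
      subst_sum subst_mult subst_prod subst_power)

section \<open>Cycle index recursion\<close>

lemma orbit_eq_iff:
  assumes "permutation f"
  shows "orbit f x = orbit f y \<longleftrightarrow> x \<in> orbit f y"
  using orbit_cyclic_eq3[OF cyclic_on_orbit'[OF assms], of x y]
    permutation_self_in_orbit[OF assms, of x] by auto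

lemma prod_orbits_split:
  assumes "permutation f" "finite S" "a \<in> S"
  shows "(\<Prod>B\<in>orbit f ` S. w B) = w (orbit f a) * (\<Prod>B\<in>orbit f ` (S - orbit f a). w B)"
proof -
  have "orbit f ` S - {orbit f a} = orbit f ` (S - orbit f a)"
    using orbit_eq_iff[OF assms(1)] by blast
  then show ?thesis
    using assms prod.remove[of "orbit f ` S" "orbit f a" w] by simp
qed

section \<open>Cutting one point out of a cycle\<close>

context
  fixes \<sigma> :: "'a \<Rightarrow> 'a" and a :: 'a and A :: "'a set"
  assumes perm: "\<sigma> permutes insert a A" and fin: "finite A" and a: "a \<notin> A" and b: "\<sigma> a \<in> A"
begin

text \<open>This permutation sends \<open>a\<close> straight to \<open>\<sigma> (\<sigma> a)\<close>
  and fixes \<open>\<sigma> a\<close>; the cycle of \<open>a\<close> loses that one point and all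
  other cycles stay.\<close>

private abbreviation "\<sigma>' \<equiv> \<sigma> \<circ> transpose a (\<sigma> a)"

lemma splice_permutes: "\<sigma>' permutes insert a (A - {\<sigma> a})"
proof -
  have "\<sigma>' permutes insert a A"
    using b by (intro permutes_compose[OF _ perm] permutes_swap_id) auto
  then have "\<sigma>' permutes (insert a A - {\<sigma> a})"
    by (rule permutes_superset) (use a b in auto)
  moreover have "insert a A - {\<sigma> a} = insert a (A - {\<sigma> a})" using a b by auto
  ultimately show ?thesis by (simp only:)
qed

lemma splice_orbit: "orbit \<sigma>' a = orbit \<sigma> a - {\<sigma> a}"
proof -
  have ab: "a \<noteq> \<sigma> a" using a b by auto
  have inj: "\<sigma> x = \<sigma> y \<Longrightarrow> x = y" for x y
    using permutes_inj[OF perm] by (auto dest: injD)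
  have "y \<in> orbit \<sigma> a - {\<sigma> a}" if "y \<in> orbit \<sigma>' a" for y
    using that
  proof induction
    case base
    then show ?case using inj[of "\<sigma> a" a] ab by (auto intro: orbit.intros)
  next
    case (step y)
    then have "y \<noteq> \<sigma> a" "y \<in> orbit \<sigma> a" by auto
    then show ?case
      using inj[of "\<sigma> a" a] inj[of y a] ab
      by (cases "y = a") (auto intro: orbit.intros simp: transpose_def)
  qed
  moreover have "y = \<sigma> a \<or> y \<in> orbit \<sigma>' a" if "y \<in> orbit \<sigma> a" for y
  proof -
    \<comment> \<open>\<open>X\<close> together with \<open>\<sigma> a\<close> is closed under
      \<open>\<sigma>\<close>, which gives the remaining inclusion by induction along the
      orbit.\<close>
    define X where "X = orbit \<sigma>' a"
    have 1: "\<sigma> (\<sigma> a) \<in> X"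
      using orbit.base[of \<sigma>' a] unfolding X_def comp_apply by simp
    have 2: "\<sigma> y \<in> X" if "y \<in> X" "y \<noteq> a" "y \<noteq> \<sigma> a" for y
      using orbit.step[of y \<sigma>' a] that unfolding X_def[symmetric] comp_apply by simp
    show ?thesis
      using that unfolding X_def[symmetric] by induction (use 1 2 in auto)
  qed
  moreover have "\<sigma> a \<notin> orbit \<sigma>' a" using calculation(1) by blast
  ultimately show ?thesis by blast
qed

lemma splice_orbit_other:
  assumes "x \<notin> orbit \<sigma> a"
  shows "orbit \<sigma>' x = orbit \<sigma> x"
proof -
  have pm: "permutation \<sigma>"
    using perm fin by (auto simp: permutation_permutes)
  have "orbit \<sigma> x = orbit \<sigma>' x"
  proof (rule orbit_cong0)
    show "x \<in> orbit \<sigma> x" by (rule permutation_self_in_orbit[OF pm])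
    show "\<sigma> \<in> orbit \<sigma> x \<rightarrow> orbit \<sigma> x" by (auto intro: orbit.intros)
    fix y assume y: "y \<in> orbit \<sigma> x"
    have "orbit \<sigma> y = orbit \<sigma> x" using y by (simp add: orbit_eq_iff[OF pm])
    moreover have "orbit \<sigma> (\<sigma> a) = orbit \<sigma> a" by (rule permutation_orbit_step[OF pm])
    moreover have "orbit \<sigma> x \<noteq> orbit \<sigma> a" using assms by (simp add: orbit_eq_iff[OF pm])
    ultimately have "y \<noteq> a" "y \<noteq> \<sigma> a" by auto
    then show "\<sigma> y = \<sigma>' y" by (simp add: transpose_def)
  qed
  then show ?thesis by simp
qed

lemma splice_card: "card (orbit \<sigma> a) = Suc (card (orbit \<sigma>' a))"
proof -
  have "permutation \<sigma>"
    using perm fin by (auto simp: permutation_permutes)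
  then have "finite (orbit \<sigma> a)" by (intro finite_orbit permutation_self_in_orbit)
  then show ?thesis
    unfolding splice_orbit using card_Suc_Diff1[of "orbit \<sigma> a" "\<sigma> a"] by (simp add: orbit.base)
qed

lemma splice_rest:
  "orbit \<sigma>' ` (insert a (A - {\<sigma> a}) - orbit \<sigma>' a) = orbit \<sigma> ` (insert a A - orbit \<sigma> a)"
proof (rule image_cong)
  have "permutation \<sigma>"
    using perm fin by (auto simp: permutation_permutes)
  then have "a \<in> orbit \<sigma> a" by (rule permutation_self_in_orbit)
  then show "insert a (A - {\<sigma> a}) - orbit \<sigma>' a = insert a A - orbit \<sigma> a"
    unfolding splice_orbit using a b orbit.base[of \<sigma> a] by auto
qed (auto simp: splice_orbit_other)

end

lemma permutes_insert_fixed: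
  assumes "a \<notin> A"
  shows "\<sigma> permutes insert a A \<and> \<sigma> a = a \<longleftrightarrow> \<sigma> permutes A"
proof
  assume "\<sigma> permutes insert a A \<and> \<sigma> a = a"
  then show "\<sigma> permutes A" by (auto intro!: permutes_superset[of \<sigma> "insert a A" A])
next
  assume "\<sigma> permutes A"
  then show "\<sigma> permutes insert a A \<and> \<sigma> a = a"
    using assms permutes_subset[of \<sigma> A "insert a A"] permutes_not_in[of \<sigma> A a] by blast
qed

lemma sign_eq_prod_orbits:
  assumes "finite S" "\<sigma> permutes S"
  shows "sign \<sigma> = (\<Prod>B\<in>orbit \<sigma> ` S. (-1) ^ (card B + 1))"
  using assms
proof (induction "card S" arbitrary: S \<sigma>)
  case 0
  then show ?case by (simp add: sign_id)
next
  case (Suc n)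
  then obtain a A where S: "S = insert a A" "a \<notin> A" "card A = n" "finite A"
    by (metis card_Suc_eq finite_insert)
  have pm: "permutation \<sigma>" using Suc by (auto simp: permutation_permutes)
  have split: "(\<Prod>B\<in>orbit \<sigma> ` S. (-1) ^ (card B + 1)) =
      (-1 :: int) ^ (card (orbit \<sigma> a) + 1) * (\<Prod>B\<in>orbit \<sigma> ` (S - orbit \<sigma> a). (-1) ^ (card B + 1))"
    by (rule prod_orbits_split[OF pm]) (use S in auto)
  show ?case
  proof (cases "\<sigma> a = a")
    case True
    then have "\<sigma> permutes A" using Suc S permutes_insert_fixed by metis
    then have IH: "sign \<sigma> = (\<Prod>B\<in>orbit \<sigma> ` A. (-1) ^ (card B + 1))"
      using Suc.hyps(1) S by blast
    have o: "orbit \<sigma> a = {a}" using True by (simp add: orbit_eq_singleton_iff)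
    have "insert a A - {a} = A" using S by auto
    moreover have "{a} \<notin> orbit \<sigma> ` A" using S permutes_orbit_subset[OF \<open>\<sigma> permutes A\<close>] by blast
    ultimately show ?thesis using split S IH o by simp
  next
    case False
    then have b: "\<sigma> a \<in> A" using Suc.prems S permutes_in_image[of \<sigma> S a] by auto
    let ?\<sigma> = "\<sigma> \<circ> transpose a (\<sigma> a)" and ?S = "insert a (A - {\<sigma> a})"
    note ctx = Suc.prems(2)[unfolded S(1)] S(4,2) b
    have p': "?\<sigma> permutes ?S" using splice_permutes[OF ctx] .
    have "finite ?S" using S by simp
    then have pm': "permutation ?\<sigma>" using p' permutation_permutes by blast
    have "card ?S = n" using S b card_Suc_Diff1[of A "\<sigma> a"] by simp
    then have "sign ?\<sigma> = (\<Prod>B\<in>orbit ?\<sigma> ` ?S. (-1) ^ (card B + 1))"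
      using p' S by (intro Suc.hyps(1)) auto
    also have "\<dots> = (-1) ^ (card (orbit ?\<sigma> a) + 1) * (\<Prod>B\<in>orbit ?\<sigma> ` (?S - orbit ?\<sigma> a). (-1) ^ (card B + 1))"
      by (rule prod_orbits_split[OF pm']) (use S in auto)
    also have "\<dots> = - (\<Prod>B\<in>orbit \<sigma> ` S. (-1) ^ (card B + 1))"
      unfolding splice_rest[OF ctx] split splice_card[OF ctx] S(1)[symmetric] by simp
    finally have "sign ?\<sigma> = - (\<Prod>B\<in>orbit \<sigma> ` S. (-1) ^ (card B + 1))" .
    moreover have "sign ?\<sigma> = - sign \<sigma>"
      using False pm by (simp add: sign_compose permutation_swap_id sign_swap_id)
    ultimately show ?thesis by simp
  qed
qed

section \<open>Newton's recursion from cycles\<close>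

text \<open>The unnormalised cycle index, with \<open>P k\<close> in the role of p_k. The ground set
  is arbitrary because the recursion deletes arbitrary points.\<close>

definition cyc_sum :: "(nat \<Rightarrow> cpoly) \<Rightarrow> 'a set \<Rightarrow> cpoly" where
  "cyc_sum P A = (\<Sum>\<sigma>\<in>{\<sigma>. \<sigma> permutes A}. \<Prod>B\<in>orbit \<sigma> ` A. P (card B))"

text \<open>The cycle through the marked point \<open>a\<close> is weighted as if it were longer by \<open>k\<close>: this is
  what remains after \<open>k\<close> points have been cut out of it.\<close>

definition marked_cyc_sum :: "(nat \<Rightarrow> cpoly) \<Rightarrow> 'a set \<Rightarrow> 'a \<Rightarrow> nat \<Rightarrow> cpoly" where
  "marked_cyc_sum P A a k = (\<Sum>\<sigma>\<in>{\<sigma>. \<sigma> permutes insert a A}.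
     P (card (orbit \<sigma> a) + k) * (\<Prod>B\<in>orbit \<sigma> ` (insert a A - orbit \<sigma> a). P (card B)))"

lemma cyc_sum_insert:
  assumes "finite A"
  shows "cyc_sum P (insert a A) = marked_cyc_sum P A a 0"
  unfolding cyc_sum_def marked_cyc_sum_def
proof (intro sum.cong refl)
  fix \<sigma> assume "\<sigma> \<in> {\<sigma>. \<sigma> permutes insert a A}"
  then have "permutation \<sigma>" using assms by (auto simp: permutation_permutes)
  from prod_orbits_split[OF this, of "insert a A" a "\<lambda>B. P (card B)"]
  show "(\<Prod>B\<in>orbit \<sigma> ` insert a A. P (card B)) = P (card (orbit \<sigma> a) + 0) *
    (\<Prod>B\<in>orbit \<sigma> ` (insert a A - orbit \<sigma> a). P (card B))"
    using assms by simp
qed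

text \<open>Permutations are sorted by the image of \<open>a\<close>. If \<open>a\<close> is fixed,
  the rest is a free permutation of \<open>A\<close>. If \<open>a\<close> goes to \<open>b\<close>,
  cutting out \<open>b\<close> shortens the marked cycle by one, and raising \<open>k\<close>
  compensates for this.\<close>

lemma marked_cyc_sum_rec:
  assumes fin: "finite A" and a: "a \<notin> A"
  shows "marked_cyc_sum P A a k =
    P (Suc k) * cyc_sum P A + (\<Sum>b\<in>A. marked_cyc_sum P (A - {b}) a (Suc k))"
proof -
  define w where "w A \<sigma> k = P (card (orbit \<sigma> a) + k) *
    (\<Prod>B\<in>orbit \<sigma> ` (insert a A - orbit \<sigma> a). P (card B))" for \<sigma> A k
  let ?S = "{\<sigma>. \<sigma> permutes insert a A}"
  have fS: "finite ?S" using fin by (simp add: finite_permutations)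
  have "marked_cyc_sum P A a k = (\<Sum>\<sigma>\<in>?S. w A \<sigma> k)"
    by (simp add: marked_cyc_sum_def w_def)
  also have "\<dots> = (\<Sum>b\<in>insert a A. \<Sum>\<sigma>\<in>{\<sigma>\<in>?S. \<sigma> a = b}. w A \<sigma> k)"
  proof (rule sum.group[symmetric])
    show "(\<lambda>\<sigma>. \<sigma> a) ` ?S \<subseteq> insert a A" using permutes_in_image[of _ "insert a A" a] by auto
  qed (use fS fin in auto)
  also have "\<dots> = (\<Sum>\<sigma>\<in>{\<sigma>\<in>?S. \<sigma> a = a}. w A \<sigma> k) + (\<Sum>b\<in>A. \<Sum>\<sigma>\<in>{\<sigma>\<in>?S. \<sigma> a = b}. w A \<sigma> k)"
    using a fin by simp
  also have "(\<Sum>\<sigma>\<in>{\<sigma>\<in>?S. \<sigma> a = a}. w A \<sigma> k) = P (Suc k) * cyc_sum P A"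
  proof -
    have "{\<sigma>\<in>?S. \<sigma> a = a} = {\<sigma>. \<sigma> permutes A}"
      using permutes_insert_fixed[OF a] by blast
    moreover have "w A \<sigma> k = P (Suc k) * (\<Prod>B\<in>orbit \<sigma> ` A. P (card B))" if "\<sigma> permutes A" for \<sigma>
    proof -
      have "orbit \<sigma> a = {a}"
        using that a by (simp add: orbit_eq_singleton_iff permutes_def)
      moreover have "insert a A - {a} = A" using a by auto
      ultimately show ?thesis by (simp add: w_def)
    qed
    ultimately show ?thesis by (simp add: cyc_sum_def sum_distrib_left)
  qed
  also have "(\<Sum>b\<in>A. \<Sum>\<sigma>\<in>{\<sigma>\<in>?S. \<sigma> a = b}. w A \<sigma> k) = (\<Sum>b\<in>A. marked_cyc_sum P (A - {b}) a (Suc k))"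
  proof (rule sum.cong[OF refl])
    fix b assume b: "b \<in> A"
    have "(\<Sum>\<sigma>\<in>{\<sigma>\<in>?S. \<sigma> a = b}. w A \<sigma> k) =
      (\<Sum>\<sigma>\<in>{\<sigma>. \<sigma> permutes insert a (A - {b})}. w (A - {b}) \<sigma> (Suc k))"
    \<comment> \<open>Composing with the same transposition again splices \<open>b\<close> back in
      after \<open>a\<close>, so the map is its own inverse.\<close>
    proof (rule sum.reindex_bij_witness[of _ "\<lambda>\<sigma>. \<sigma> \<circ> transpose a b" "\<lambda>\<sigma>. \<sigma> \<circ> transpose a b"])
      fix \<sigma> assume "\<sigma> \<in> {\<sigma>\<in>?S. \<sigma> a = b}"
      then have s: "\<sigma> permutes insert a A" "\<sigma> a = b" by auto
      note ctx = s(1) fin a b[folded s(2)]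
      show "\<sigma> \<circ> transpose a b \<circ> transpose a b = \<sigma>" by (simp add: comp_assoc)
      show "\<sigma> \<circ> transpose a b \<in> {\<sigma>. \<sigma> permutes insert a (A - {b})}"
        using splice_permutes[OF ctx] s by simp
      show "w (A - {b}) (\<sigma> \<circ> transpose a b) (Suc k) = w A \<sigma> k"
        using splice_card[OF ctx] splice_rest[OF ctx] s by (simp add: w_def)
    next
      fix \<sigma> assume s: "\<sigma> \<in> {\<sigma>. \<sigma> permutes insert a (A - {b})}"
      show "\<sigma> \<circ> transpose a b \<circ> transpose a b = \<sigma>" by (simp add: comp_assoc)
      have "\<sigma> permutes insert a A" using s by (auto intro: permutes_subset)
      then have "\<sigma> \<circ> transpose a b permutes insert a A"
        using b by (intro permutes_compose[of "transpose a b"] permutes_swap_id) auto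
      moreover have "\<sigma> b = b" using s a b by (auto simp: permutes_def)
      ultimately show "\<sigma> \<circ> transpose a b \<in> {\<sigma>\<in>?S. \<sigma> a = b}" by simp
    qed
    then show "(\<Sum>\<sigma>\<in>{\<sigma>\<in>?S. \<sigma> a = b}. w A \<sigma> k) = marked_cyc_sum P (A - {b}) a (Suc k)"
      by (simp add: marked_cyc_sum_def w_def)
  qed
  finally show ?thesis .
qed

text \<open>The complete homogeneous symmetric functions in terms of the power sums
  \<open>P k\<close>, by n h_n = p_1 h_(n-1) + ... + p_n h_0.\<close>

fun hpol :: "(nat \<Rightarrow> cpoly) \<Rightarrow> nat \<Rightarrow> cpoly" where
  "hpol P 0 = 1"
| "hpol P (Suc n) = const (1 / of_nat (Suc n)) * (\<Sum>i\<le>n. P (Suc i) * hpol P (n - i))"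

lemma hpol_Newton: "of_nat (Suc n) * hpol P (Suc n) = (\<Sum>i\<le>n. P (Suc i) * hpol P (n - i))"
proof -
  have "of_nat (Suc n) * const (1 / of_nat (Suc n)) = const (of_nat (Suc n) * (1 / of_nat (Suc n)))"
    by (simp only: const_mult const_of_nat)
  also have "\<dots> = 1" by (simp del: of_nat_Suc)
  finally show ?thesis
    by (simp only: hpol.simps mult.assoc[symmetric] mult_1_left)
qed

text \<open>The two claims need each other: the full sum on \<open>Suc n\<close> points is a marked
  sum over \<open>n\<close> points, and the marked sum over \<open>Suc n\<close> points uses the
  full sum on as many points together with smaller marked sums.\<close>

lemma cyc_sum_and_marked_eq_hpol:
  assumes "finite A"
  shows "cyc_sum P A = fact (card A) * hpol P (card A) \<and>
    (\<forall>a k. a \<notin> A \<longrightarrow> marked_cyc_sum P A a k =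
      fact (card A) * (\<Sum>i\<le>card A. P (Suc k + i) * hpol P (card A - i)))"
  using assms
proof (induction "card A" arbitrary: A)
  case 0
  then have "A = {}" by simp
  moreover have "marked_cyc_sum P {} a k = P (Suc k) * cyc_sum P ({} :: 'a set)" for a :: 'a and k
    by (subst marked_cyc_sum_rec) auto
  ultimately show ?case by (simp add: cyc_sum_def)
next
  case (Suc n)
  note IH = Suc.hyps(1)
  obtain a B where S: "A = insert a B" "a \<notin> B" "card B = n" "finite B"
    using Suc by (metis card_Suc_eq finite_insert)
  have "cyc_sum P A = fact n * (\<Sum>i\<le>n. P (Suc i) * hpol P (n - i))"
    using IH[of B] S by (simp add: cyc_sum_insert)
  also have "\<dots> = fact (Suc n) * hpol P (Suc n)"
    unfolding hpol_Newton[symmetric] by (simp del: hpol.simps add: algebra_simps)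
  finally have 1: "cyc_sum P A = fact (Suc n) * hpol P (Suc n)" .
  have 2: "marked_cyc_sum P A a k =
      fact (Suc n) * (\<Sum>i\<le>Suc n. P (Suc k + i) * hpol P (Suc n - i))" if a: "a \<notin> A" for a k
  proof -
    have *: "marked_cyc_sum P (A - {b}) a (Suc k) =
        fact n * (\<Sum>i\<le>n. P (Suc (Suc k) + i) * hpol P (n - i))" if "b \<in> A" for b
    proof -
      have "n = card (A - {b})" using Suc.hyps(2) Suc.prems that by simp
      with IH[OF this] Suc.prems a show ?thesis by simp
    qed
    have "marked_cyc_sum P A a k = P (Suc k) * cyc_sum P A +
       (\<Sum>b\<in>A. fact n * (\<Sum>i\<le>n. P (Suc (Suc k) + i) * hpol P (n - i)))"
      unfolding marked_cyc_sum_rec[OF Suc.prems a]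
      by (rule arg_cong[where f = "\<lambda>x. _ + x"], rule sum.cong[OF refl]) (rule *)
    also have "\<dots> = P (Suc k) * (fact (Suc n) * hpol P (Suc n)) +
       of_nat (Suc n) * (fact n * (\<Sum>i\<le>n. P (Suc (Suc k) + i) * hpol P (n - i)))"
      by (simp only: 1 sum_constant Suc.hyps(2)[symmetric])
    also have "\<dots> = fact (Suc n) * (\<Sum>i\<le>Suc n. P (Suc k + i) * hpol P (Suc n - i))"
      by (subst sum.atMost_Suc_shift) (simp del: hpol.simps add: algebra_simps)
    finally show ?thesis .
  qed
  show ?case
    unfolding Suc.hyps(2)[symmetric] using 1 2 by blast
qed

lemma cyc_sum_eq_hpol:
  "finite A \<Longrightarrow> cyc_sum P A = fact (card A) * hpol P (card A)"
  by (rule cyc_sum_and_marked_eq_hpol[THEN conjunct1])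

section \<open>The characters induced from cyclic groups\<close>

lemma subst_cyc_mono: "subst R (cyc_mono n \<sigma>) = (\<Prod>B\<in>orbit \<sigma> ` {0..<n}. R (card B))"
proof -
  have "{orbit \<sigma> x |x. x < n} = orbit \<sigma> ` {0..<n}" by auto
  then show ?thesis by (simp add: cyc_mono_def subst_prod)
qed

lemma const_inverse_fact: "const (1 / of_nat (fact n)) * fact n = 1"
proof -
  have "(fact n :: cpoly) = const (of_nat (fact n))"
    by (subst const_of_nat) (rule of_nat_fact[symmetric])
  then have "const (1 / of_nat (fact n)) * fact n = const (1 / of_nat (fact n) * of_nat (fact n))"
    by (simp only: const_mult)
  then show ?thesis by simp
qed

lemma subst_h_sym: "subst R (h_sym m) = hpol R m"
proof -
  have "subst R (h_sym m) = const (1 / of_nat (fact m)) * cyc_sum R {0..<m}"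
    by (simp add: h_sym_def frob_def subst_mult subst_sum subst_cyc_mono cyc_sum_def)
  then show ?thesis
    by (simp only: cyc_sum_eq_hpol finite_atLeastLessThan card_atLeastLessThan minus_nat.diff_0
        mult.assoc[symmetric] const_inverse_fact mult_1_left)
qed

lemma const_of_int: "const (of_int n) = of_int n"
  unfolding const_def by (rule single_of_int)

text \<open>The sign is a product over cycles, so it can be absorbed into the weight of each cycle;
  this is omega exchanging h_m and e_m.\<close>

lemma subst_e_sym: "subst R (e_sym m) = hpol (\<lambda>k. (-1) ^ (k + 1) * R k) m"
proof -
  have "subst R (e_sym m) = const (1 / of_nat (fact m)) * cyc_sum (\<lambda>k. (-1) ^ (k + 1) * R k) {0..<m}"
  proof -
    have "const (of_int (sign \<sigma>)) * (\<Prod>B\<in>orbit \<sigma> ` {0..<m}. R (card B)) =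
        (\<Prod>B\<in>orbit \<sigma> ` {0..<m}. (-1) ^ (card B + 1) * R (card B))" if "\<sigma> permutes {0..<m}" for \<sigma>
      by (subst sign_eq_prod_orbits[OF _ that], simp, subst const_of_int)
         (simp add: prod.distrib[symmetric])
    then show ?thesis
      by (simp add: e_sym_def frob_def subst_mult subst_sum subst_cyc_mono cyc_sum_def)
  qed
  then show ?thesis
    by (simp only: cyc_sum_eq_hpol finite_atLeastLessThan card_atLeastLessThan minus_nat.diff_0
        mult.assoc[symmetric] const_inverse_fact mult_1_left)
qed

section \<open>Cycle type of the powers of the long cycle\<close>

lemma funpow_ncycle: "(ncycle n ^^ k) x = (if x < n then (x + k) mod n else x)"
proof (induction k)
  case (Suc k)
  then show ?case by (auto simp: ncycle_def mod_Suc_eq)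
qed simp

lemma ncycle_permutes: "ncycle n permutes {0..<n}"
proof (rule bij_imp_permutes)
  have "inj_on (ncycle n) {0..<n}"
    by (rule inj_onI) (auto simp: ncycle_def mod_Suc split: if_splits)
  moreover have "ncycle n ` {0..<n} \<subseteq> {0..<n}" by (auto simp: ncycle_def)
  ultimately show "bij_betw (ncycle n) {0..<n} {0..<n}"
    by (simp add: bij_betw_def endo_inj_surj)
qed (auto simp: ncycle_def)

lemma funpow_permutes: "f permutes S \<Longrightarrow> f ^^ k permutes S"
proof (induction k)
  case 0
  then show ?case by (simp add: permutes_id[unfolded id_def] id_def)
next
  case (Suc k)
  then show ?case using permutes_compose[of "f ^^ k" S f] by (simp only: funpow.simps)
qed

lemma orbit_funpow_ncycle:
  assumes "x < n"
  shows "orbit (ncycle n ^^ k) x = {y. y < n \<and> [y = x] (mod gcd n k)}"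
proof -
  let ?g = "gcd n k"
  have p: "permutation (ncycle n ^^ k)"
    using funpow_permutes[OF ncycle_permutes] permutation_permutes by blast
  have fp: "((ncycle n ^^ k) ^^ m) x = (x + m * k) mod n" for m
    using assms by (simp add: funpow_mult funpow_ncycle mult.commute)
  have "orbit (ncycle n ^^ k) x = {(x + m * k) mod n | m. True}"
    by (simp add: orbit_altdef_permutation[OF p] fp)
  also have "\<dots> = {y. y < n \<and> [y = x] (mod ?g)}"
  proof safe
    fix m
    show "(x + m * k) mod n < n" using assms by simp
    have "[(x + m * k) mod n = x + m * k] (mod ?g)"
      by (rule cong_dvd_modulus_nat[of _ _ n]) (simp_all add: cong_def)
    also have "[x + m * k = x] (mod ?g)" by (simp add: cong_def mod_add_right_eq[symmetric])
    finally show "[(x + m * k) mod n = x] (mod ?g)" .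
  next
    fix y assume y: "y < n" "[y = x] (mod ?g)"
    \<comment> \<open>A Bezout coefficient: some multiple of the step \<open>k\<close> moves by
      exactly the gcd modulo \<open>n\<close>.\<close>
    obtain s where s: "[k * s = ?g] (mod n)"
      using cong_solve_nat[of k n] by (cases "k = 0") (auto simp: gcd.commute cong_def)
    \<comment> \<open>Adding the multiple \<open>n * x\<close> of the modulus keeps the difference
      with \<open>x\<close> a natural number even when \<open>y < x\<close>.\<close>
    have "[y + n * x = x] (mod ?g)" 
      using cong_add[OF y(2), of "n * x" 0] by (simp add: cong_0_iff)
    moreover have xy: "x \<le> y + n * x" using assms by (cases n) auto
    ultimately have "?g dvd y + n * x - x" by (simp add: cong_altdef_nat)
    then obtain t where "y + n * x - x = ?g * t" by (rule dvdE)
    then have t: "y + n * x = x + t * ?g" using xy by (simp add: mult.commute)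
    have "[x + t * s * k = x + t * ?g] (mod n)"
      using cong_add[OF cong_refl[of x] cong_scalar_left[OF s, of t]] by (simp add: ac_simps)
    then have "[x + t * s * k = y] (mod n)" by (simp add: t[symmetric] cong_def)
    then have "y = (x + (t * s) * k) mod n" using y by (simp add: cong_def)
    then show "\<exists>m. y = (x + m * k) mod n \<and> True" by blast
  qed
  finally show ?thesis .
qed

lemma card_residue_class:
  assumes "g dvd n" "r < g"
  shows "card {y. y < n \<and> y mod g = r} = n div g"
proof -
  have "bij_betw (\<lambda>i. r + i * g) {..<n div g} {y. y < n \<and> y mod g = r}"
  proof (rule bij_betw_byWitness[where f' = "\<lambda>y. y div g"])
    show "(\<lambda>i. r + i * g) ` {..<n div g} \<subseteq> {y. y < n \<and> y mod g = r}"
    proof safe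
      fix i assume "i < n div g"
      then have "(Suc i) * g \<le> n div g * g" by (intro mult_le_mono1) simp
      then show "r + i * g < n" using assms by simp
      show "(r + i * g) mod g = r" using assms by simp
    qed
    show "(\<lambda>y. y div g) ` {y. y < n \<and> y mod g = r} \<subseteq> {..<n div g}"
      using assms by (auto simp: dvd_def) (metis less_mult_imp_div_less mult.commute)
  qed (use assms in auto)
  then show ?thesis by (metis bij_betw_same_card card_lessThan)
qed

text \<open>The orbits are the residue classes modulo \<open>gcd n k\<close>, which all have the
  same size.\<close>

lemma subst_cyc_mono_ncycle:
  assumes "0 < n"
  shows "subst R (cyc_mono n (ncycle n ^^ k)) = R (n div gcd n k) ^ gcd n k"
proof -
  let ?g = "gcd n k" and ?C = "\<lambda>r. {y. y < n \<and> y mod gcd n k = r}"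
  have g: "?g > 0" "?g dvd n" using assms by auto
  have gn: "?g \<le> n" using g assms by (simp add: dvd_imp_le)
  have "orbit (ncycle n ^^ k) ` {0..<n} = ?C ` (\<lambda>x. x mod ?g) ` {0..<n}"
    by (auto simp: orbit_funpow_ncycle cong_def image_image)
  also have "(\<lambda>x. x mod ?g) ` {0..<n} = {..<?g}"
  proof
    show "{..<?g} \<subseteq> (\<lambda>x. x mod ?g) ` {0..<n}"
    proof
      fix x assume "x \<in> {..<?g}"
      then have "x = x mod ?g" "x \<in> {0..<n}" using gn by auto
      then show "x \<in> (\<lambda>x. x mod ?g) ` {0..<n}" by blast
    qed
  qed (use g in auto)
  finally have "subst R (cyc_mono n (ncycle n ^^ k)) = (\<Prod>B\<in>?C ` {..<?g}. R (card B))"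
    by (simp add: subst_cyc_mono)
  also have "\<dots> = (\<Prod>r<?g. R (card (?C r)))"
  proof (subst prod.reindex)
    show "inj_on ?C {..<?g}"
    proof (rule inj_onI)
      fix r s assume r: "r \<in> {..<?g}" and eq: "?C r = ?C s"
      have "r \<in> ?C r" using r gn by simp
      then have "r \<in> ?C s" by (simp only: eq)
      then show "r = s" using r by simp
    qed
  qed simp
  also have "\<dots> = (\<Prod>r<?g. R (n div ?g))"
    by (intro prod.cong refl arg_cong[of _ _ R] card_residue_class) (use g in auto)
  finally show ?thesis by simp
qed

lemma cyc_mono_conj:
  assumes "\<tau> permutes {0..<n}"
  shows "cyc_mono n (inv \<tau> \<circ> f \<circ> \<tau>) = cyc_mono n f"
proof -
  have bij: "bij \<tau>" using assms by (rule permutes_bij)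
  have inj: "inj (inv \<tau>)" using bij by (simp add: bij_imp_bij_inv bij_is_inj)
  have "orbit (inv \<tau> \<circ> f \<circ> \<tau>) x = inv \<tau> ` orbit f (\<tau> x)" for x
  proof -
    have "((inv \<tau> \<circ> f \<circ> \<tau>) ^^ m) x = inv \<tau> ((f ^^ m) (\<tau> x))" for m
      by (induction m) (use bij in \<open>auto simp: bij_is_inj bij_is_surj surj_f_inv_f\<close>)
    then show ?thesis by (auto simp: orbit_altdef)
  qed
  then have "{orbit (inv \<tau> \<circ> f \<circ> \<tau>) x |x. x < n} = (`) (inv \<tau>) ` orbit f ` \<tau> ` {0..<n}"
    by auto
  also have "\<tau> ` {0..<n} = {0..<n}" using assms by (rule permutes_image)
  also have "orbit f ` {0..<n} = {orbit f x |x. x < n}" by auto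
  finally have "{orbit (inv \<tau> \<circ> f \<circ> \<tau>) x |x. x < n} = (`) (inv \<tau>) ` {orbit f x |x. x < n}" .
  then have "cyc_mono n (inv \<tau> \<circ> f \<circ> \<tau>) = (\<Prod>B\<in>(`) (inv \<tau>) ` {orbit f x |x. x < n}. var (card B))"
    by (simp add: cyc_mono_def)
  also have "\<dots> = (\<Prod>B\<in>{orbit f x |x. x < n}. var (card (inv \<tau> ` B)))"
    by (subst prod.reindex) (auto simp: inj_image_eq_iff[OF inj] intro!: inj_onI)
  also have "\<dots> = cyc_mono n f"
    by (simp add: cyc_mono_def card_image inj_on_subset[OF inj])
  finally show ?thesis .
qed

text \<open>For each conjugator and each exponent \<open>k\<close> exactly one permutation passes
  the test in \<open>lie_char\<close>, a conjugate of the \<open>k\<close>-th power of the cycle and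
  hence of the same cycle type. The sum over conjugators therefore only yields n!, which cancels the
  normalisation of \<open>frob\<close>.\<close>

lemma ell_eq:
  assumes "0 < n"
  shows "ell n = const (1 / of_nat n) * (\<Sum>k<n. const (zeta n ^ k) * cyc_mono n (ncycle n ^^ k))"
proof -
  let ?S = "{\<sigma>. \<sigma> permutes {0..<n}}"
  let ?c = "\<lambda>k. ncycle n ^^ k"
  have fin: "finite ?S" by (simp add: finite_permutations)
  have *: "(\<Sum>\<sigma>\<in>?S. const (if \<tau> \<circ> \<sigma> \<circ> inv \<tau> = ?c k then zeta n ^ k else 0) * cyc_mono n \<sigma>)
    = const (zeta n ^ k) * cyc_mono n (?c k)" if \<tau>: "\<tau> permutes {0..<n}" for \<tau> k
  proof -
    have iff: "\<tau> \<circ> \<sigma> \<circ> inv \<tau> = ?c k \<longleftrightarrow> \<sigma> = inv \<tau> \<circ> ?c k \<circ> \<tau>" for \<sigma>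
    proof -
      have 1: "inv \<tau> \<circ> \<tau> = id" "\<tau> \<circ> inv \<tau> = id" using \<tau> by (simp_all add: permutes_inv_o)
      have "inv \<tau> \<circ> (\<tau> \<circ> \<sigma> \<circ> inv \<tau>) \<circ> \<tau> = (inv \<tau> \<circ> \<tau>) \<circ> \<sigma> \<circ> (inv \<tau> \<circ> \<tau>)"
        "\<tau> \<circ> (inv \<tau> \<circ> ?c k \<circ> \<tau>) \<circ> inv \<tau> = (\<tau> \<circ> inv \<tau>) \<circ> ?c k \<circ> (\<tau> \<circ> inv \<tau>)"
        by (simp_all only: comp_assoc)
      then have "inv \<tau> \<circ> (\<tau> \<circ> \<sigma> \<circ> inv \<tau>) \<circ> \<tau> = \<sigma>" "\<tau> \<circ> (inv \<tau> \<circ> ?c k \<circ> \<tau>) \<circ> inv \<tau> = ?c k"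
        by (simp_all only: 1 id_comp comp_id)
      then show ?thesis by (auto simp del: o_apply)
    qed
    have "inv \<tau> \<circ> ?c k \<circ> \<tau> \<in> ?S"
      using permutes_compose[OF \<tau> permutes_compose[OF funpow_permutes[OF ncycle_permutes] permutes_inv[OF \<tau>]]]
      by (simp add: comp_assoc)
    then show ?thesis
      unfolding iff using cyc_mono_conj[OF \<tau>]
      by (simp add: if_distrib[of const] if_distrib[of "\<lambda>x. x * _"] sum.delta[OF fin] cong: if_cong)
  qed
  have "(\<Sum>\<sigma>\<in>?S. const (lie_char n \<sigma>) * cyc_mono n \<sigma>) =
     (\<Sum>\<sigma>\<in>?S. \<Sum>\<tau>\<in>?S. \<Sum>k<n. const (1 / of_nat n) *
        (const (if \<tau> \<circ> \<sigma> \<circ> inv \<tau> = ?c k then zeta n ^ k else 0) * cyc_mono n \<sigma>))"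
    by (simp only: lie_char_def const_mult const_sum sum_distrib_left sum_distrib_right mult.assoc)
  also have "\<dots> = (\<Sum>\<tau>\<in>?S. \<Sum>k<n. \<Sum>\<sigma>\<in>?S. const (1 / of_nat n) *
        (const (if \<tau> \<circ> \<sigma> \<circ> inv \<tau> = ?c k then zeta n ^ k else 0) * cyc_mono n \<sigma>))"
    by (subst sum.swap, rule sum.cong[OF refl], rule sum.swap)
  also have "\<dots> = (\<Sum>\<tau>\<in>?S. const (1 / of_nat n) * (\<Sum>k<n. const (zeta n ^ k) * cyc_mono n (?c k)))"
    by (simp only: sum_distrib_left[symmetric]) (simp add: *)
  also have "\<dots> = fact n * (const (1 / of_nat n) * (\<Sum>k<n. const (zeta n ^ k) * cyc_mono n (?c k)))"
    by (simp add: card_permutations[of _ n] sum_constant)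
  finally show ?thesis
    by (simp only: ell_def frob_def mult.assoc[symmetric] const_inverse_fact mult_1_left)
qed

section \<open>Roots of unity and divisor sums\<close>

text \<open>This is the Moebius function, but only its summation property is needed.\<close>

definition prim_root_sum :: "nat \<Rightarrow> complex" where
  "prim_root_sum d = (\<Sum>k | k < d \<and> coprime k d. zeta d ^ k)"

text \<open>Exponents \<open>k\<close> with gcd \<open>e\<close> to \<open>n = d * e\<close> are the
  multiples \<open>e * l\<close> with \<open>l < d\<close> coprime to \<open>d\<close>, and the
  \<open>e\<close>-th power of \<open>zeta n\<close> is \<open>zeta d\<close>. The exponent 0
  belongs to \<open>d = 1\<close>, as \<open>gcd n 0 = n\<close>.\<close>

lemma sum_by_gcd:
  fixes w :: "nat \<Rightarrow> cpoly"
  assumes "0 < n"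
  shows "(\<Sum>k<n. const (zeta n ^ k) * w (n div gcd n k)) =
    (\<Sum>d | d dvd n. const (prim_root_sum d) * w d)"
proof -
  have "(\<Sum>k<n. const (zeta n ^ k) * w (n div gcd n k)) =
    (\<Sum>d | d dvd n. \<Sum>k\<in>{k\<in>{..<n}. n div gcd n k = d}. const (zeta n ^ k) * w (n div gcd n k))"
    using assms by (intro sum.group[symmetric]) (auto intro: div_dvd_iff_mult[THEN iffD2])
  also have "\<dots> = (\<Sum>d | d dvd n. const (prim_root_sum d) * w d)"
  proof (rule sum.cong[OF refl])
    fix d assume "d \<in> {d. d dvd n}"
    then obtain e where n: "n = d * e" by auto
    with assms have de: "0 < d" "0 < e" by auto
    have z: "zeta n ^ (e * k) = zeta d ^ k" for k
      using de by (simp add: zeta_def DeMoivre n power_mult)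
    have "(\<Sum>k\<in>{k\<in>{..<n}. n div gcd n k = d}. const (zeta n ^ k) * w (n div gcd n k)) =
        (\<Sum>k\<in>{k. k < d \<and> coprime k d}. const (zeta d ^ k) * w d)"
    proof (rule sum.reindex_bij_witness[of _ "\<lambda>k. e * k" "\<lambda>k. k div e"])
      fix k assume "k \<in> {k\<in>{..<n}. n div gcd n k = d}"
      then have k: "k < n" "n div gcd n k = d" by auto
      then have "n = d * gcd n k" by (metis dvd_div_mult_self gcd_dvd1)
      then have g: "gcd n k = e" using n de by simp
      then have "e dvd k" by (metis gcd_dvd2)
      then obtain l where l: "k = e * l" by auto
      then have "gcd n k = e * gcd d l" by (simp add: n mult.commute[of d] gcd_mult_distrib_nat)
      then have "coprime l d" using g de by (simp add: coprime_iff_gcd_eq_1 gcd.commute)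
      moreover have "l < d" using k l n de by simp
      ultimately show "k div e \<in> {k. k < d \<and> coprime k d}" "e * (k div e) = k"
        "const (zeta d ^ (k div e)) * w d = const (zeta n ^ k) * w (n div gcd n k)"
        using l de k z by auto
    next
      fix l assume l: "l \<in> {k. k < d \<and> coprime k d}"
      show "e * l div e = l" using de by simp
      have "gcd n (e * l) = e * gcd d l" by (simp add: n mult.commute[of d] gcd_mult_distrib_nat)
      then have "gcd n (e * l) = e" using l by (simp add: coprime_iff_gcd_eq_1 gcd.commute)
      then show "e * l \<in> {k\<in>{..<n}. n div gcd n k = d}" using l n de by simp
    qed
    then show "(\<Sum>k\<in>{k\<in>{..<n}. n div gcd n k = d}. const (zeta n ^ k) * w (n div gcd n k)) =
        const (prim_root_sum d) * w d"
      by (simp add: prim_root_sum_def const_sum sum_distrib_right)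
  qed
  finally show ?thesis .
qed

lemma sum_zeta_powers:
  assumes "0 < n"
  shows "(\<Sum>k<n. zeta n ^ k) = (if n = 1 then 1 else 0)"
proof (cases "n = 1")
  case False
  have "inj_on (\<lambda>k. cis (2 * pi * real k / real n)) {..<n}"
    using bij_betw_roots_unity[OF assms] by (simp add: bij_betw_def)
  then have "zeta n \<noteq> 1"
    using assms False 
      inj_onD[of "\<lambda>k. cis (2 * pi * real k / real n)" "{..<n}" 1 0] by (auto simp: zeta_def)
  moreover have "zeta n ^ n = 1" using assms by (simp add: zeta_def DeMoivre)
  ultimately show ?thesis using False by (simp add: geometric_sum)
qed simp

lemma sum_prim_root_sum:
  assumes "0 < n"
  shows "(\<Sum>d | d dvd n. const (prim_root_sum d)) = (if n = 1 then 1 else 0)"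
proof -
  have "(\<Sum>d | d dvd n. const (prim_root_sum d)) = (\<Sum>k<n. const (zeta n ^ k))"
    using sum_by_gcd[OF assms, of "\<lambda>_. 1"] by simp
  also have "\<dots> = const (if n = 1 then 1 else 0)"
    by (simp only: const_sum[symmetric] sum_zeta_powers[OF assms])
  finally show ?thesis by simp
qed

text \<open>Multiplied through by \<open>j\<close>, which is the form in which \<open>ell j\<close>
  enters a logarithmic derivative.\<close>

lemma subst_ell:
  assumes "0 < j"
  shows "of_nat j * subst R (ell j) = (\<Sum>d | d dvd j. const (prim_root_sum d) * R d ^ (j div d))"
proof -
  have "of_nat j * const (1 / of_nat j) = const (of_nat j * (1 / of_nat j))"
    by (simp only: const_mult const_of_nat)
  then have 1: "of_nat j * const (1 / of_nat j) = 1" using assms by simp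
  have "of_nat j * subst R (ell j) =
      of_nat j * const (1 / of_nat j) * (\<Sum>k<j. const (zeta j ^ k) * R (j div gcd j k) ^ gcd j k)"
    by (simp only: ell_eq[OF assms] subst_mult subst_sum subst_const mult.assoc
        subst_cyc_mono_ncycle[OF assms])
  also have "\<dots> = (\<Sum>k<j. const (zeta j ^ k) * (\<lambda>d. R d ^ (j div d)) (j div gcd j k))"
    using assms by (simp only: 1 mult_1_left) (intro sum.cong refl, auto simp: div_div_eq_right)
  also have "\<dots> = (\<Sum>d | d dvd j. const (prim_root_sum d) * R d ^ (j div d))"
    by (rule sum_by_gcd[OF assms])
  finally show ?thesis .
qed

text \<open>Chains d | j | i are described by the cofactor r = j/d instead of j. The inner sum then
  runs over all divisors of i/r, where the Moebius summation property applies.\<close>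

lemma sum_divisor_pairs:
  fixes f :: "nat \<Rightarrow> nat \<Rightarrow> 'b::comm_monoid_add"
  assumes "0 < i"
  shows "(\<Sum>j | j dvd i. \<Sum>d | d dvd j. f j d) = (\<Sum>r | r dvd i. \<Sum>d | d dvd i div r. f (r * d) d)"
proof -
  have fin: "finite {d. d dvd j}" if "j dvd i" for j :: nat
    using that assms by (intro finite_divisors_nat) (auto intro: Nat.gr0I)
  have "(\<Sum>j | j dvd i. \<Sum>d | d dvd j. f j d) = (\<Sum>(j, d)\<in>(SIGMA j:{j. j dvd i}. {d. d dvd j}). f j d)"
    using fin by (intro sum.Sigma) auto
  also have "\<dots> = (\<Sum>(r, d)\<in>(SIGMA r:{r. r dvd i}. {d. d dvd i div r}). f (r * d) d)"
    by (rule sum.reindex_bij_witness[of _ "\<lambda>(r, d). (r * d, d)" "\<lambda>(j, d). (j div d, d)"])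
       (use assms in \<open>auto elim!: dvdE simp: mult.commute\<close>)
  also have "\<dots> = (\<Sum>r | r dvd i. \<Sum>d | d dvd i div r. f (r * d) d)"
    using assms by (intro sum.Sigma[symmetric]) (auto intro!: finite_divisors_nat elim!: dvdE)
  finally show ?thesis .
qed

text \<open>The left side is the coefficient of t^i in the logarithmic derivative of the product of
  all H[ell_j], the right side that of 1/(1 - p_1 t). After the change to cofactors the power
  \<open>P (i div r) ^ r\<close> no longer depends on \<open>d\<close>, and only
  \<open>r = i\<close> survives.\<close>

lemma sum_ell:
  assumes "0 < i"
  shows "(\<Sum>j | j dvd i. of_nat j * subst (\<lambda>k. P (k * (i div j))) (ell j)) = P 1 ^ i"
proof -
  have pos: "0 < j" if "j dvd i" for j using that assms by (auto intro: Nat.gr0I)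
  have "(\<Sum>j | j dvd i. of_nat j * subst (\<lambda>k. P (k * (i div j))) (ell j)) =
    (\<Sum>j | j dvd i. \<Sum>d | d dvd j. const (prim_root_sum d) * P (d * (i div j)) ^ (j div d))"
    by (intro sum.cong refl subst_ell) (use pos in auto)
  also have "\<dots> = (\<Sum>r | r dvd i. \<Sum>d | d dvd i div r.
      const (prim_root_sum d) * P (d * (i div (r * d))) ^ (r * d div d))"
    by (rule sum_divisor_pairs[OF assms])
  also have "\<dots> = (\<Sum>r | r dvd i. \<Sum>d | d dvd i div r. const (prim_root_sum d) * P (i div r) ^ r)"
    by (intro sum.cong refl) (use assms in \<open>auto elim!: dvdE\<close>)
  also have "\<dots> = (\<Sum>r | r dvd i. (if r = i then P 1 ^ i else 0))"
  proof (intro sum.cong refl)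
    fix r assume "r \<in> {r. r dvd i}"
    then have r: "r dvd i" by simp
    then have "0 < i div r" "i div r = 1 \<longleftrightarrow> r = i" using assms by (auto elim!: dvdE)
    then show "(\<Sum>d | d dvd i div r. const (prim_root_sum d) * P (i div r) ^ r) =
        (if r = i then P 1 ^ i else 0)"
      using sum_prim_root_sum[of "i div r"] assms
      by (cases "r = i") (simp_all add: sum_distrib_right[symmetric])
  qed
  also have "\<dots> = P 1 ^ i" using assms by (simp add: sum.delta finite_divisors_nat)
  finally show ?thesis .
qed

text \<open>Here \<open>r * d\<close> is a part size j and \<open>m div d\<close> is i/j. The first
  sign records e in place of h for even j, the second is omega acting on the \<open>r\<close>-th
  power of p_d. Together they give -1 exactly when m/d is even (for even \<open>r\<close>), or when
  d is even and m/d is odd (for odd \<open>r\<close>). Divisors with even cofactor are the divisors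
  of m/2, so the deviation from the untwisted sum is concentrated at \<open>m = 2\<close>.\<close>

lemma sum_prim_root_sum_sign:
  assumes m: "0 < m"
  shows "(\<Sum>d | d dvd m. const (prim_root_sum d) *
      ((if even (r * d) then (-1) ^ (m div d + 1) else 1) * ((-1) ^ (d + 1)) ^ r)) =
    (if m = 1 then 1 else if m = 2 then 2 * (-1) ^ (r + 1) else 0)"
proof -
  let ?p = "\<lambda>d. const (prim_root_sum d)"
  let ?D = "\<lambda>m. {d. d dvd (m::nat)}"
  have fin: "finite (?D m)" using m by (simp add: finite_divisors_nat)
  have half: "{d. d dvd m \<and> even (m div d)} = (if even m then ?D (m div 2) else {})"
  proof -
    have "d dvd m \<and> even (m div d) \<longleftrightarrow> even m \<and> d dvd m div 2" for d
      using m by (auto elim!: dvdE)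
    then show ?thesis by auto
  qed
  have sum_half: "(\<Sum>d | d dvd m \<and> even (m div d). ?p d) = (if m = 2 then 1 else 0)"
    using m sum_prim_root_sum[of "m div 2"] unfolding half by (auto elim!: evenE)
  show ?thesis
  proof (cases "even r")
    case True
    have "(\<Sum>d | d dvd m. ?p d * ((if even (r * d) then (-1) ^ (m div d + 1) else 1) * ((-1) ^ (d + 1)) ^ r))
      = (\<Sum>d | d dvd m. ?p d - 2 * (if even (m div d) then ?p d else 0))"
      using True by (intro sum.cong refl) (auto simp: power_mult[symmetric])
    also have "\<dots> = (\<Sum>d | d dvd m. ?p d) - 2 * (\<Sum>d | d dvd m \<and> even (m div d). ?p d)"
      by (simp add: sum_subtractf sum_distrib_left[symmetric] sum.inter_filter[OF fin, symmetric])
    finally show ?thesis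
      using m True by (simp add: sum_half sum_prim_root_sum)
  next
    case False
    have "(\<Sum>d | d dvd m. ?p d * ((if even (r * d) then (-1) ^ (m div d + 1) else 1) * ((-1) ^ (d + 1)) ^ r))
      = (\<Sum>d | d dvd m. ?p d - 2 * (if even d \<and> odd (m div d) then ?p d else 0))"
      using False by (intro sum.cong refl) (auto simp: uminus_power_if)
    also have "\<dots> = (\<Sum>d | d dvd m. ?p d) - 2 * (\<Sum>d | d dvd m \<and> even d \<and> odd (m div d). ?p d)"
      by (simp add: sum_subtractf sum_distrib_left[symmetric] sum.inter_filter[OF fin, symmetric])
    also have "(\<Sum>d | d dvd m \<and> even d \<and> odd (m div d). ?p d) = (if m = 2 then - 1 else 0)"
    proof (cases "even m")
      case True
      then have "even d" if "d dvd m" "odd (m div d)" for d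
        using that by (metis dvd_mult_div_cancel even_mult_iff)
      \<comment> \<open>For even \<open>m\<close> an odd cofactor forces \<open>d\<close> to be
        even, so these divisors are the complement of those counted in \<open>half\<close>.\<close>
      then have "{d. d dvd m \<and> even d \<and> odd (m div d)} = ?D m - {d. d dvd m \<and> even (m div d)}"
        by auto
      then have "(\<Sum>d | d dvd m \<and> even d \<and> odd (m div d). ?p d) =
          (\<Sum>d | d dvd m. ?p d) - (\<Sum>d | d dvd m \<and> even (m div d). ?p d)"
        using fin by (simp add: sum_diff Collect_mono)
      then show ?thesis using m True by (auto simp: sum_half sum_prim_root_sum)
    next
      case False
      then have none: "{d. d dvd m \<and> even d \<and> odd (m div d)} = {}" by auto
      show ?thesis using False unfolding none by auto
    qed
    finally show ?thesis
      using m False by (simp add: sum_prim_root_sum)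
  qed
qed

text \<open>The right side is the coefficient of t^i in the logarithmic derivative of (1 + p_2
  t^2)/(1 - p_1 t). The p_2 term is the contribution of the cofactor i/2, where the twisted Moebius
  sum does not vanish.\<close>

lemma sum_pi:
  assumes "0 < i"
  shows "(\<Sum>j | j dvd i. (if even j then (-1) ^ (i div j + 1) else 1) *
      (of_nat j * subst (\<lambda>k. (-1) ^ (k + 1) * P (k * (i div j))) (ell j))) =
    P 1 ^ i + (if even i then 2 * (-1) ^ (i div 2 + 1) * P 2 ^ (i div 2) else 0)"
proof -
  let ?s = "\<lambda>j k. (if even j then (-1) ^ (k + 1) else 1) :: cpoly"
  have pos: "0 < j" if "j dvd i" for j using that assms by (auto intro: Nat.gr0I)
  have "(\<Sum>j | j dvd i. ?s j (i div j) * (of_nat j * subst (\<lambda>k. (-1) ^ (k + 1) * P (k * (i div j))) (ell j))) =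
    (\<Sum>j | j dvd i. \<Sum>d | d dvd j. ?s j (i div j) *
      (const (prim_root_sum d) * ((-1) ^ (d + 1) * P (d * (i div j))) ^ (j div d)))"
  proof (rule sum.cong[OF refl])
    fix j assume "j \<in> {j. j dvd i}"
    then have "0 < j" using pos by simp
    from subst_ell[OF this] show "?s j (i div j) * (of_nat j * subst (\<lambda>k. (-1) ^ (k + 1) * P (k * (i div j))) (ell j))
      = (\<Sum>d | d dvd j. ?s j (i div j) * (const (prim_root_sum d) * ((-1) ^ (d + 1) * P (d * (i div j))) ^ (j div d)))"
      by (simp only: sum_distrib_left)
  qed
  also have "\<dots> = (\<Sum>r | r dvd i. \<Sum>d | d dvd i div r. ?s (r * d) (i div (r * d)) *
      (const (prim_root_sum d) * ((-1) ^ (d + 1) * P (d * (i div (r * d)))) ^ (r * d div d)))"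
    by (rule sum_divisor_pairs[OF assms])
  also have "\<dots> = (\<Sum>r | r dvd i. (\<Sum>d | d dvd i div r. const (prim_root_sum d) *
      (?s (r * d) (i div r div d) * ((-1) ^ (d + 1)) ^ r)) * P (i div r) ^ r)"
    unfolding sum_distrib_right
  proof (intro sum.cong refl)
    fix r d assume "r \<in> {r. r dvd i}" "d \<in> {d. d dvd i div r}"
    then obtain k where "i = r * (d * k)" "0 < r" "0 < d" "0 < k"
      using assms by (auto elim!: dvdE)
    then have "i div (r * d) = k" "i div r div d = k" "d * k = i div r" "r * d div d = r"
      by (auto simp: mult.assoc[symmetric])
    then show "?s (r * d) (i div (r * d)) *
        (const (prim_root_sum d) * ((-1) ^ (d + 1) * P (d * (i div (r * d)))) ^ (r * d div d)) =
      const (prim_root_sum d) * (?s (r * d) (i div r div d) * ((-1) ^ (d + 1)) ^ r) * P (i div r) ^ r"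
      by (simp only: power_mult_distrib mult.assoc mult.left_commute)
  qed
  also have "\<dots> = (\<Sum>r | r dvd i. (if r = i then P 1 ^ i else 0) +
      (if r = i div 2 \<and> even i then 2 * (-1) ^ (i div 2 + 1) * P 2 ^ (i div 2) else 0))"
  proof (intro sum.cong refl)
    fix r assume "r \<in> {r. r dvd i}"
    then obtain m where m: "i = r * m" "0 < m" "0 < r" using assms by (auto elim!: dvdE)
    then have im: "i div r = m" by simp
    have "m = 1 \<longleftrightarrow> r = i" "m = 2 \<longleftrightarrow> r = i div 2 \<and> even i"
      using m by auto
    then show "(\<Sum>d | d dvd i div r. const (prim_root_sum d) *
        (?s (r * d) (i div r div d) * ((-1) ^ (d + 1)) ^ r)) * P (i div r) ^ r =
      (if r = i then P 1 ^ i else 0) +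
      (if r = i div 2 \<and> even i then 2 * (-1) ^ (i div 2 + 1) * P 2 ^ (i div 2) else 0)"
      unfolding im sum_prim_root_sum_sign[OF m(2)]
      by (cases "m = 1"; cases "m = 2") auto
  qed
  also have "\<dots> = P 1 ^ i + (if even i then 2 * (-1) ^ (i div 2 + 1) * P 2 ^ (i div 2) else 0)"
    using assms by (cases "even i") (auto simp: sum.distrib sum.delta finite_divisors_nat elim!: evenE)
  finally show ?thesis .
qed

section \<open>Logarithmic derivatives of generating functions\<close>

unbundle fps_syntax

text \<open>States that \<open>G\<close> is t F'/F without dividing. Such relations add up under
  products of the series.\<close>

definition logder :: "'a::comm_ring_1 fps \<Rightarrow> 'a fps \<Rightarrow> bool" where
  "logder F G \<longleftrightarrow> fps_X * fps_deriv F = F * G"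

lemma fps_X_deriv_nth: "(fps_X * fps_deriv F) $ n = of_nat n * F $ n"
  by (cases n) simp_all

lemma logder_iff: "logder F G \<longleftrightarrow> (\<forall>n. of_nat n * F $ n = (F * G) $ n)"
  by (simp only: logder_def fps_eq_iff fps_X_deriv_nth)

lemma logder_mult:
  assumes "logder F1 G1" "logder F2 G2"
  shows "logder (F1 * F2) (G1 + G2)"
proof -
  have "fps_X * fps_deriv (F1 * F2) = F1 * (fps_X * fps_deriv F2) + (fps_X * fps_deriv F1) * F2"
    by (simp add: algebra_simps)
  then show ?thesis using assms by (simp add: logder_def algebra_simps)
qed

lemma logder_prod:
  "(\<And>j. j \<in> A \<Longrightarrow> logder (F j) (G j)) \<Longrightarrow> logder (\<Prod>j\<in>A. F j) (\<Sum>j\<in>A. G j)"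
proof (induction A rule: infinite_finite_induct)
  case (insert j A)
  then show ?case by (simp add: logder_mult)
qed (simp_all add: logder_def)

text \<open>As \<open>G\<close> has no constant term, comparing coefficients expresses n F_n through
  F_0, ..., F_(n-1), and n can be cancelled. The bound \<open>M\<close> lets a product over finitely
  many part sizes be compared with a series that accounts for all of them.\<close>

lemma logder_unique:
  fixes F F' :: "'a::{idom,ring_char_0} fps"
  assumes "logder F G" "logder F' G'" "F $ 0 = F' $ 0"
    and G: "G $ 0 = 0" "\<And>i. i \<le> M \<Longrightarrow> G $ i = G' $ i"
  shows "n \<le> M \<Longrightarrow> F $ n = F' $ n"
proof (induction n rule: less_induct)
  case (less n)
  show ?case
  proof (cases "n = 0")
    case False
    have "of_nat n * F $ n = (\<Sum>i=0..n. F $ i * G $ (n - i))"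
      using assms(1) by (simp add: logder_iff fps_mult_nth)
    also have "\<dots> = (\<Sum>i=0..n. F' $ i * G' $ (n - i))"
    proof (rule sum.cong[OF refl])
      fix i assume "i \<in> {0..n}"
      then show "F $ i * G $ (n - i) = F' $ i * G' $ (n - i)"
        using less.IH[of i] less.prems G(1) G(2)[of 0] G(2)[of "n - i"] by (cases "i = n") auto
    qed
    also have "\<dots> = of_nat n * F' $ n"
      using assms(2) by (simp add: logder_iff fps_mult_nth)
    finally show ?thesis using False by simp
  qed (use assms in simp)
qed

text \<open>The generating series of \<open>a\<close> in the variable t^j.\<close>

definition fps_spread :: "nat \<Rightarrow> (nat \<Rightarrow> 'a::zero) \<Rightarrow> 'a fps" where
  "fps_spread j a = Abs_fps (\<lambda>n. if j dvd n then a (n div j) else 0)"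

lemma fps_spread_nth: "fps_spread j a $ n = (if j dvd n then a (n div j) else 0)"
  by (simp add: fps_spread_def)

text \<open>Newton's recursion in degrees divisible by \<open>j\<close>; the factor \<open>j\<close>
  comes from differentiating t^j.\<close>

lemma logder_hpol:
  assumes j: "0 < j"
  shows "logder (fps_spread j (hpol Q)) (fps_spread j (\<lambda>i. if i = 0 then 0 else of_nat j * Q i))"
  unfolding logder_iff
proof
  fix n
  let ?G = "\<lambda>i. if i = 0 then 0 else of_nat j * Q i"
  show "of_nat n * fps_spread j (hpol Q) $ n = (fps_spread j (hpol Q) * fps_spread j ?G) $ n"
  proof (cases "j dvd n")
    case False
    have "(\<Sum>i=0..n. fps_spread j (hpol Q) $ i * fps_spread j ?G $ (n - i)) = 0"
    proof (rule sum.neutral, rule ballI)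
      fix i assume i: "i \<in> {0..n}"
      have "\<not> (j dvd i \<and> j dvd n - i)"
        using False i by (metis atLeastAtMost_iff dvd_add le_add_diff_inverse)
      then show "fps_spread j (hpol Q) $ i * fps_spread j ?G $ (n - i) = 0"
        by (auto simp: fps_spread_def)
    qed
    then show ?thesis using False by (simp add: fps_mult_nth) (simp add: fps_spread_def)
  next
    case True
    then obtain m where n: "n = j * m" by auto
    have "(fps_spread j (hpol Q) * fps_spread j ?G) $ n =
        (\<Sum>i=0..n. fps_spread j (hpol Q) $ i * fps_spread j ?G $ (n - i))"
      by (simp add: fps_mult_nth)
    also have "\<dots> = (\<Sum>i\<in>(*) j ` {..m}. fps_spread j (hpol Q) $ i * fps_spread j ?G $ (n - i))"
      by (rule sum.mono_neutral_right) (use j in \<open>auto simp: n fps_spread_def elim!: dvdE\<close>)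
    also have "\<dots> = (\<Sum>a\<le>m. hpol Q a * ?G (m - a))"
      using j by (subst sum.reindex)
        (auto intro!: inj_onI sum.cong simp: n fps_spread_def diff_mult_distrib2[symmetric])
    also have "\<dots> = of_nat n * hpol Q m"
    proof (cases m)
      case (Suc k)
      have "(\<Sum>a\<le>m. hpol Q a * ?G (m - a)) = (\<Sum>a\<le>k. hpol Q a * ?G (m - a))"
        using Suc by simp
      also have "\<dots> = (\<Sum>i\<le>k. of_nat j * (Q (Suc i) * hpol Q (k - i)))"
        by (rule sum.reindex_bij_witness[of _ "\<lambda>i. k - i" "\<lambda>i. k - i"])
           (auto simp: Suc Suc_diff_le)
      also have "\<dots> = of_nat j * (of_nat m * hpol Q m)"
        by (simp only: sum_distrib_left[symmetric] hpol_Newton[symmetric] Suc)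
      finally show ?thesis by (simp only: n of_nat_mult mult.assoc)
    qed (simp add: n)
    finally show ?thesis using j by (simp add: n) (simp add: fps_spread_def)
  qed
qed

text \<open>Choosing the term t^(j m_j) from each factor means choosing multiplicities. Finiteness
  is part of the claim because the sums in the induction step rely on it.\<close>

lemma fps_prod_spread_nth:
  fixes a :: "nat \<Rightarrow> nat \<Rightarrow> 'a::comm_ring_1"
  assumes "finite A" "0 \<notin> A"
  shows "finite {m. (\<forall>j. m j \<noteq> 0 \<longrightarrow> j \<in> A) \<and> (\<Sum>j\<in>A. j * m j) = n} \<and>
    (\<Prod>j\<in>A. fps_spread j (a j)) $ n =
      (\<Sum>m | (\<forall>j. m j \<noteq> 0 \<longrightarrow> j \<in> A) \<and> (\<Sum>j\<in>A. j * m j) = n. \<Prod>j\<in>A. a j (m j))"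
  using assms
proof (induction A arbitrary: n rule: finite_induct)
  case empty
  have "{m. (\<forall>j. m j \<noteq> 0 \<longrightarrow> j \<in> {}) \<and> (\<Sum>j\<in>{}. j * m j) = n} = (if n = 0 then {\<lambda>_. 0 :: nat} else {})"
    by auto
  then show ?case by simp
next
  case (insert j A)
  let ?S = "\<lambda>A n. {m. (\<forall>j. m j \<noteq> 0 \<longrightarrow> j \<in> A) \<and> (\<Sum>j\<in>A. j * m j) = (n::nat)}"
  have j: "0 < j" using insert by auto
  have IH: "finite (?S A n)"
      "(\<Prod>j\<in>A. fps_spread j (a j)) $ n = (\<Sum>m\<in>?S A n. \<Prod>j\<in>A. a j (m j))" for n
    using insert by auto
  let ?X = "SIGMA k:{k. j * k \<le> n}. ?S A (n - j * k)"
  have sum_upd: "(\<Sum>i\<in>A. i * (m(j := k)) i) = (\<Sum>i\<in>A. i * m i)" for m k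
    using insert by (intro sum.cong) auto
  have prod_upd: "(\<Prod>i\<in>A. a i ((m(j := k)) i)) = (\<Prod>i\<in>A. a i (m i))" for m k
    using insert by (intro prod.cong) auto
  have fin: "finite {k. j * k \<le> n}"
  proof (rule finite_subset)
    show "{k. j * k \<le> n} \<subseteq> {..n}"
    proof
      fix k assume "k \<in> {k. j * k \<le> n}"
      then show "k \<in> {..n}" using j le_trans[of k "j * k" n] by simp
    qed
  qed simp
  \<comment> \<open>The multiplicity of the new part \<open>j\<close> is split off and reset to 0,
    the value required outside the index set.\<close>
  have bij: "bij_betw (\<lambda>(k, m). m(j := k)) ?X (?S (insert j A) n)"
  proof (rule bij_betw_byWitness[where f' = "\<lambda>m. (m j, m(j := 0))"])
    show "\<forall>x\<in>?X. (\<lambda>m. (m j, m(j := 0))) (case x of (k, m) \<Rightarrow> m(j := k)) = x"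
    proof
      fix x assume "x \<in> ?X"
      then obtain k m where x: "x = (k, m)" and m: "\<forall>i. m i \<noteq> 0 \<longrightarrow> i \<in> A" by auto
      have "m j = 0" using m insert.hyps by auto
      then show "(\<lambda>m. (m j, m(j := 0))) (case x of (k, m) \<Rightarrow> m(j := k)) = x"
        by (simp add: x fun_upd_idem)
    qed
    show "(\<lambda>(k, m). m(j := k)) ` ?X \<subseteq> ?S (insert j A) n"
    proof (clarify, intro CollectI conjI allI impI)
      fix k m i
      assume m: "\<forall>j. m j \<noteq> 0 \<longrightarrow> j \<in> A" "j * k \<le> n" "(\<Sum>j\<in>A. j * m j) = n - j * k"
      show "i \<in> insert j A" if "(m(j := k)) i \<noteq> 0" using that m(1) by (cases "i = j") auto
      show "(\<Sum>i\<in>insert j A. i * (m(j := k)) i) = n"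
        using insert.hyps m(2,3) sum_upd[of m k] by (simp only: sum.insert) simp
    qed
    show "(\<lambda>m. (m j, m(j := 0))) ` ?S (insert j A) n \<subseteq> ?X"
    proof
      fix x assume "x \<in> (\<lambda>m. (m j, m(j := 0))) ` ?S (insert j A) n"
      then obtain m where x: "x = (m j, m(j := 0))"
        and m: "\<forall>i. m i \<noteq> 0 \<longrightarrow> i \<in> insert j A" "(\<Sum>i\<in>insert j A. i * m i) = n" by auto
      then have "n = j * m j + (\<Sum>i\<in>A. i * m i)" using insert.hyps by simp
      then have "j * m j \<le> n" "(\<Sum>i\<in>A. i * (m(j := 0)) i) = n - j * m j"
        using sum_upd[of m 0] by simp_all
      moreover have "\<forall>i. (m(j := 0)) i \<noteq> 0 \<longrightarrow> i \<in> A" using m(1) by auto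
      ultimately show "x \<in> ?X" unfolding x by blast
    qed
  qed auto
  have "finite ?X" using fin IH by auto
  then have f: "finite (?S (insert j A) n)" using bij bij_betw_finite by blast
  have "(\<Prod>j\<in>insert j A. fps_spread j (a j)) $ n =
      (\<Sum>i=0..n. fps_spread j (a j) $ i * (\<Prod>j\<in>A. fps_spread j (a j)) $ (n - i))"
    using insert by (simp add: fps_mult_nth)
  also have "\<dots> = (\<Sum>i\<in>(*) j ` {k. j * k \<le> n}. fps_spread j (a j) $ i * (\<Prod>j\<in>A. fps_spread j (a j)) $ (n - i))"
  proof (rule sum.mono_neutral_right)
    show "(*) j ` {k. j * k \<le> n} \<subseteq> {0..n}" by auto
    show "\<forall>i\<in>{0..n} - (*) j ` {k. j * k \<le> n}.
        fps_spread j (a j) $ i * (\<Prod>j\<in>A. fps_spread j (a j)) $ (n - i) = 0"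
    proof
      fix i assume "i \<in> {0..n} - (*) j ` {k. j * k \<le> n}"
      then have "\<not> j dvd i" by (auto elim!: dvdE)
      then show "fps_spread j (a j) $ i * (\<Prod>j\<in>A. fps_spread j (a j)) $ (n - i) = 0"
        by (simp add: fps_spread_nth)
    qed
  qed simp
  also have "\<dots> = (\<Sum>k | j * k \<le> n. a j k * (\<Prod>j\<in>A. fps_spread j (a j)) $ (n - j * k))"
    using j by (subst sum.reindex) (auto intro!: inj_onI sum.cong simp: fps_spread_nth)
  also have "\<dots> = (\<Sum>k | j * k \<le> n. \<Sum>m\<in>?S A (n - j * k). a j k * (\<Prod>j\<in>A. a j (m j)))"
    by (simp only: IH sum_distrib_left)
  also have "\<dots> = (\<Sum>(k, m)\<in>?X. a j k * (\<Prod>j\<in>A. a j (m j)))"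
    using fin IH by (intro sum.Sigma) auto
  also have "\<dots> = (\<Sum>m\<in>?S (insert j A) n. \<Prod>j\<in>insert j A. a j (m j))"
    by (subst sum.reindex_bij_betw[OF bij, symmetric], rule sum.cong[OF refl])
       (use insert prod_upd in auto)
  finally show ?case using f by blast
qed

lemma logder_one_minus:
  "logder (1 - fps_const c * fps_X) (Abs_fps (\<lambda>i. if i = 0 then 0 else - (c ^ i)))"
proof -
  let ?G = "Abs_fps (\<lambda>i. if i = 0 then 0 else - (c ^ i))"
  have "((1 - fps_const c * fps_X) * ?G) $ n = of_nat n * (1 - fps_const c * fps_X) $ n" for n
  proof -
    have "((1 - fps_const c * fps_X) * ?G) $ n = ?G $ n - c * (if n = 0 then 0 else ?G $ (n - 1))"
      by (simp add: left_diff_distrib mult.assoc)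
    then show ?thesis by (cases n) (auto simp: fps_X_def)
  qed
  then show ?thesis by (simp add: logder_iff)
qed

lemma logder_geometric:
  "logder (Abs_fps (\<lambda>i. c ^ i)) (Abs_fps (\<lambda>i. if i = 0 then 0 else c ^ i))"
proof -
  have "(\<Sum>i=0..n. c ^ i * (if n - i = 0 then 0 else c ^ (n - i))) = of_nat n * c ^ n" for n
  proof -
    have "(\<Sum>i=0..n. c ^ i * (if n - i = 0 then 0 else c ^ (n - i))) = (\<Sum>i<n. c ^ n)"
      by (rule sum.mono_neutral_cong_right) (auto simp: power_add[symmetric])
    then show ?thesis by simp
  qed
  then show ?thesis by (simp add: logder_iff fps_mult_nth)
qed

lemma logder_one_plus_square:
  "logder (1 + fps_const c * fps_X ^ 2)
    (Abs_fps (\<lambda>i. if i = 0 \<or> odd i then 0 else 2 * (-1) ^ (i div 2 + 1) * c ^ (i div 2)))"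
proof -
  let ?G = "Abs_fps (\<lambda>i. if i = 0 \<or> odd i then 0 else 2 * (-1) ^ (i div 2 + 1) * c ^ (i div 2))"
  have "((1 + fps_const c * fps_X ^ 2) * ?G) $ n = of_nat n * (1 + fps_const c * fps_X ^ 2) $ n" for n
  proof -
    have 1: "((1 + fps_const c * fps_X ^ 2) * ?G) $ n = ?G $ n + c * (if n < 2 then 0 else ?G $ (n - 2))"
      by (simp add: distrib_right mult.assoc fps_X_power_mult_nth)
    consider "n = 0" | "n = 1" | k where "n = Suc (Suc k)" by (metis One_nat_def not0_implies_Suc)
    then show ?thesis
      by cases (unfold 1, auto simp: fps_X_power_iff elim!: evenE)
  qed
  then show ?thesis by (simp add: logder_iff)
qed

section \<open>Specialisation to N variables\<close>

definition psum :: "nat \<Rightarrow> nat \<Rightarrow> cpoly" where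
  "psum N k = (\<Sum>i<N. var i ^ k)"

lemma spec_eq: "spec N f = subst (psum N) f"
  by (simp add: spec_def psum_def[abs_def])

text \<open>The series of the (-1)^m e_m in \<open>N\<close> variables, i.e. the inverse of the
  series of the h_m.\<close>

definition elem_fps :: "nat \<Rightarrow> cpoly fps" where
  "elem_fps N = (\<Prod>i<N. 1 - fps_const (var i) * fps_X)"

lemma logder_elem_fps:
  "logder (elem_fps N) (Abs_fps (\<lambda>i. if i = 0 then 0 else - psum N i))"
proof -
  have "(\<Sum>i<N. Abs_fps (\<lambda>k. if k = 0 then 0 else - (var i ^ k))) =
      Abs_fps (\<lambda>k. if k = 0 then 0 else - psum N k)"
    by (simp add: fps_eq_iff fps_sum_nth psum_def sum_negf)
  moreover have "logder (elem_fps N) (\<Sum>i<N. Abs_fps (\<lambda>k. if k = 0 then 0 else - (var i ^ k)))"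
    unfolding elem_fps_def by (intro logder_prod logder_one_minus)
  ultimately show ?thesis by simp
qed

lemma elem_fps_0: "elem_fps N $ 0 = 1"
  by (induction N) (simp_all add: elem_fps_def)

lemma elem_fps_Suc: "elem_fps (Suc N) $ m = elem_fps N $ m - (if m = 0 then 0 else var N * elem_fps N $ (m - 1))"
proof -
  have "elem_fps (Suc N) = elem_fps N - fps_const (var N) * (fps_X * elem_fps N)"
    by (simp add: elem_fps_def algebra_simps)
  then show ?thesis by simp
qed

lemma prim_root_sum_1: "const (prim_root_sum 1) = 1"
  using sum_prim_root_sum[of 1] by simp

lemma subst_ell_1: "subst R (ell 1) = R 1"
  using subst_ell[of 1 R] prim_root_sum_1 by simp

lemma subst_plethysm:
  "subst P (plethysm f g) = subst (\<lambda>k. subst (\<lambda>i. P (i * k)) g) f"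
  by (simp add: plethysm_def adams_def subst_subst)

lemma subst_minus_one_power: "subst R ((-1) ^ n) = (-1) ^ n"
  by (simp add: subst_power subst_uminus)

lemma subst_pi_sym: "subst R (pi_sym j) = subst (\<lambda>k. (-1) ^ (k + 1) * R k) (ell j)"
  unfolding pi_sym_def omega_def subst_subst subst_mult subst_minus_one_power subst_var ..

text \<open>Logarithmic differentiation turns the sum over partitions, a coefficient of the product of
  the series \<open>H[Q\<^sub>j](t^j)\<close>, into a divisor sum.\<close>

lemma sum_parts_no1:
  fixes Q :: "nat \<Rightarrow> nat \<Rightarrow> cpoly"
  assumes T: "logder T G" "T $ 0 = 1" "G $ 0 = 0"
    and G: "\<And>i. 0 < i \<Longrightarrow> (\<Sum>j | j dvd i. of_nat j * Q j (i div j)) = Q 1 i + G $ i"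
  shows "(\<Sum>m\<in>parts_no1 n. \<Prod>j\<in>{2..n}. hpol (Q j) (m j)) = T $ n"
proof -
  let ?F = "\<Prod>j\<in>{2..n}. fps_spread j (hpol (Q j))"
  let ?G = "\<lambda>j. fps_spread j (\<lambda>i. if i = 0 then 0 else of_nat j * Q j i)"
  have parts: "parts_no1 n = {m. (\<forall>j. m j \<noteq> 0 \<longrightarrow> j \<in> {2..n}) \<and> (\<Sum>j\<in>{2..n}. j * m j) = n}"
    by (simp add: parts_no1_def)
  have "(\<Sum>m\<in>parts_no1 n. \<Prod>j\<in>{2..n}. hpol (Q j) (m j)) = ?F $ n"
    unfolding parts by (rule fps_prod_spread_nth[THEN conjunct2, symmetric]) auto
  also have "\<dots> = T $ n"
  proof (rule logder_unique[OF _ T(1)])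
    show "logder ?F (\<Sum>j\<in>{2..n}. ?G j)"
      by (intro logder_prod logder_hpol) auto
    have "(\<Prod>j\<in>A. fps_spread j (hpol (Q j))) $ 0 = 1" for A
      by (induction A rule: infinite_finite_induct) (simp_all add: fps_spread_nth)
    then show "?F $ 0 = T $ 0" by (simp add: T(2))
    show z: "(\<Sum>j\<in>{2..n}. ?G j) $ 0 = 0"
      by (simp add: fps_sum_nth fps_spread_nth)
    fix i assume i: "i \<le> n"
    show "(\<Sum>j\<in>{2..n}. ?G j) $ i = G $ i"
    proof (cases "i = 0")
      case False
      then have fin: "finite {j. j dvd i}" by simp
      have "(\<Sum>j\<in>{2..n}. ?G j) $ i = (\<Sum>j\<in>{2..n}. if j dvd i then of_nat j * Q j (i div j) else 0)"
        unfolding fps_sum_nth using False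
        by (intro sum.cong refl) (auto simp: fps_spread_nth elim!: dvdE)
      also have "\<dots> = (\<Sum>j\<in>{j\<in>{2..n}. j dvd i}. of_nat j * Q j (i div j))"
        by (rule sum.inter_filter[symmetric]) simp
      \<comment> \<open>Divisors of \<open>i\<close> are at most \<open>n\<close>, so only
        \<open>j = 1\<close> is missing. Its term is the \<open>Q 1 i\<close> set apart in the
        hypothesis on \<open>G\<close>.\<close>
      also have "{j\<in>{2..n}. j dvd i} = {j. j dvd i} - {1}"
      proof -
        have "1 \<le> j \<and> j \<le> n" if "j dvd i" for j
          using that False i dvd_imp_le[of j i] by (auto intro: Suc_leI Nat.gr0I)
        then show ?thesis by force
      qed
      also have "(\<Sum>j\<in>{j. j dvd i} - {1}. of_nat j * Q j (i div j)) = G $ i"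
        using G[of i] False fin by (simp add: sum_diff1)
      finally show ?thesis .
    qed (simp only: z T(3))
  qed simp
  finally show ?thesis .
qed

lemma spec_ch_lie_hat:
  "spec N (ch_lie_hat n) = (Abs_fps (\<lambda>i. psum N 1 ^ i) * elem_fps N) $ n"
proof -
  let ?Q = "\<lambda>j k. subst (\<lambda>i. psum N (i * k)) (ell j)"
  have "spec N (ch_lie_hat n) = (\<Sum>m\<in>parts_no1 n. \<Prod>j\<in>{2..n}. hpol (?Q j) (m j))"
    by (simp add: spec_eq ch_lie_hat_def subst_sum subst_prod subst_plethysm subst_h_sym)
  also have "\<dots> = (Abs_fps (\<lambda>i. psum N 1 ^ i) * elem_fps N) $ n"
  proof (rule sum_parts_no1[OF logder_mult[OF logder_geometric logder_elem_fps]])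
    fix i :: nat assume "0 < i"
    \<comment> \<open>Since \<open>ell 1\<close> is p_1, the excluded term \<open>?Q 1 i\<close>
      equals \<open>psum N i\<close>, which cancels the negative power sum contributed by
      \<open>elem_fps\<close>.\<close>
    from sum_ell[OF this, of "psum N"] subst_ell_1[of "\<lambda>k. psum N (k * i)"] \<open>0 < i\<close>
    show "(\<Sum>j | j dvd i. of_nat j * ?Q j (i div j)) =
       ?Q 1 i + (Abs_fps (\<lambda>i. if i = 0 then 0 else psum N 1 ^ i) +
         Abs_fps (\<lambda>i. if i = 0 then 0 else - psum N i)) $ i"
      by simp
  qed (simp_all add: elem_fps_0)
  finally show ?thesis .
qed

lemma spec_ch_W_hat:
  "spec N (ch_W_hat n) =
    ((1 + fps_const (psum N 2) * fps_X ^ 2) * (Abs_fps (\<lambda>i. psum N 1 ^ i) * elem_fps N)) $ n"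
proof -
  let ?s = "\<lambda>j k. (if even j then (-1) ^ (k + 1) else 1) :: cpoly"
  \<comment> \<open>The sign depends on \<open>i\<close> and not on \<open>i * k\<close>, because
    omega is applied before the Adams operation.\<close>
  let ?R = "\<lambda>j k. subst (\<lambda>i. (-1) ^ (i + 1) * psum N (i * k)) (ell j)"
  let ?Q = "\<lambda>j k. ?s j k * ?R j k"
  let ?G2 = "\<lambda>c. Abs_fps (\<lambda>i. if i = 0 \<or> odd i then 0 else 2 * (-1) ^ (i div 2 + 1) * c ^ (i div 2))"
  \<comment> \<open>The e of an even part is an h with an additional sign, so both cases become one
    family \<open>?Q\<close> and the general result on partitions applies.\<close>
  have "subst (psum N) (if odd j then plethysm (h_sym m) (pi_sym j) else plethysm (e_sym m) (pi_sym j))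
    = hpol (?Q j) m" for j m
    unfolding subst_plethysm subst_h_sym subst_e_sym subst_pi_sym if_distrib[of "subst (psum N)"]
    by (cases "even j") simp_all
  then have "spec N (ch_W_hat n) = (\<Sum>m\<in>parts_no1 n. \<Prod>j\<in>{2..n}. hpol (?Q j) (m j))"
    by (simp only: spec_eq ch_W_hat_def subst_sum subst_prod)
  also have "\<dots> = ((1 + fps_const (psum N 2) * fps_X ^ 2) * (Abs_fps (\<lambda>i. psum N 1 ^ i) * elem_fps N)) $ n"
  proof (rule sum_parts_no1[OF logder_mult[OF logder_one_plus_square logder_mult[OF logder_geometric logder_elem_fps]]])
    fix i :: nat assume i: "0 < i"
    have "(\<Sum>j | j dvd i. of_nat j * ?Q j (i div j)) =
        (\<Sum>j | j dvd i. ?s j (i div j) * (of_nat j * ?R j (i div j)))"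
      by (simp only: mult.left_commute)
    also have "\<dots> = psum N 1 ^ i +
        (if even i then 2 * (-1) ^ (i div 2 + 1) * psum N 2 ^ (i div 2) else 0)"
      by (rule sum_pi[OF i])
    also have "\<dots> = ?Q 1 i + (?G2 (psum N 2) + (Abs_fps (\<lambda>i. if i = 0 then 0 else psum N 1 ^ i) +
         Abs_fps (\<lambda>i. if i = 0 then 0 else - psum N i))) $ i"
      using i subst_ell_1[of "\<lambda>k. (-1) ^ (k + 1) * psum N (k * i)"] by simp
    finally show "(\<Sum>j | j dvd i. of_nat j * ?Q j (i div j)) = \<dots>" .
  qed (simp_all add: elem_fps_0)
  finally show ?thesis .
qed

section \<open>Schur polynomials\<close>

text \<open>Shapes are row-length functions, so that adding a box is a function update and
  interlacing is a rowwise condition, without cases on the number of rows.\<close>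

definition cells :: "(nat \<Rightarrow> nat) \<Rightarrow> (nat \<times> nat) set" where
  "cells f = {(i, j). j < f i}"

definition ssyt_fun :: "(nat \<Rightarrow> nat) \<Rightarrow> nat \<Rightarrow> ((nat \<times> nat) \<Rightarrow> nat) set" where
  "ssyt_fun f N = {T. (\<forall>c. c \<notin> cells f \<longrightarrow> T c = 0) \<and> (\<forall>c\<in>cells f. T c < N)
      \<and> (\<forall>i j. (i, Suc j) \<in> cells f \<longrightarrow> T (i, j) \<le> T (i, Suc j))
      \<and> (\<forall>i j. (Suc i, j) \<in> cells f \<longrightarrow> T (i, j) < T (Suc i, j))}"

definition schur_fun :: "nat \<Rightarrow> (nat \<Rightarrow> nat) \<Rightarrow> cpoly" where
  "schur_fun N f = (\<Sum>T\<in>ssyt_fun f N. \<Prod>c\<in>cells f. var (T c))"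

definition row_len :: "nat list \<Rightarrow> nat \<Rightarrow> nat" where
  "row_len lam i = (if i < length lam then lam ! i else 0)"

lemma schur_eq_schur_fun: "schur N lam = schur_fun N (row_len lam)"
proof -
  have "diagram lam = cells (row_len lam)"
    by (auto simp: diagram_def cells_def row_len_def split: if_splits)
  then show ?thesis
    by (simp add: schur_def schur_fun_def ssyt_def ssyt_fun_def)
qed

definition partition_fun :: "(nat \<Rightarrow> nat) \<Rightarrow> bool" where
  "partition_fun f \<longleftrightarrow> (\<forall>i. f (Suc i) \<le> f i) \<and> finite {i. f i \<noteq> 0}"

text \<open>The shapes \<open>g\<close> for which f/g is a horizontal strip.\<close>

definition interlacing :: "(nat \<Rightarrow> nat) \<Rightarrow> (nat \<Rightarrow> nat) set" where
  "interlacing f = {g. \<forall>i. f (Suc i) \<le> g i \<and> g i \<le> f i}"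

lemma finite_cells:
  assumes "partition_fun f" shows "finite (cells f)"
proof -
  have "cells f = (SIGMA i:{i. f i \<noteq> 0}. {..<f i})" by (auto simp: cells_def)
  then show ?thesis using assms by (simp add: partition_fun_def)
qed

lemma partition_fun_antimono:
  assumes "partition_fun f" "i \<le> j" shows "f j \<le> f i"
  using lift_Suc_antimono_le[of f i j] assms by (auto simp: partition_fun_def)

lemma partition_fun_interlacing:
  assumes "partition_fun f" "g \<in> interlacing f" shows "partition_fun g"
proof -
  have "g (Suc i) \<le> g i" for i
    using assms(2) le_trans[of "g (Suc i)" "f (Suc i)" "g i"] by (auto simp: interlacing_def)
  moreover have "finite {i. g i \<noteq> 0}"
  proof (rule finite_subset)
    show "{i. g i \<noteq> 0} \<subseteq> {i. f i \<noteq> 0}"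
      using assms(2) by (auto simp: interlacing_def intro: less_le_trans)
  qed (use assms(1) in \<open>simp add: partition_fun_def\<close>)
  ultimately show ?thesis by (simp add: partition_fun_def)
qed

lemma cells_interlacing: "g \<in> interlacing f \<Longrightarrow> cells g \<subseteq> cells f"
  by (auto simp: cells_def interlacing_def intro: less_le_trans)

lemma finite_interlacing:
  assumes "partition_fun f" shows "finite (interlacing f)"
proof (rule finite_subset)
  let ?S = "{i. f i \<noteq> 0}"
  show "interlacing f \<subseteq> {g. \<forall>i. (i \<in> ?S \<longrightarrow> g i \<in> {..f 0}) \<and> (i \<notin> ?S \<longrightarrow> g i = 0)}"
  proof
    fix g assume g: "g \<in> interlacing f"
    have "g i \<le> f 0" "f i = 0 \<longrightarrow> g i = 0" for i
      using g partition_fun_antimono[OF assms, of 0 i] le_trans[of "g i" "f i" "f 0"]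
      by (auto simp: interlacing_def) (metis le_zero_eq)
    then show "g \<in> {g. \<forall>i. (i \<in> ?S \<longrightarrow> g i \<in> {..f 0}) \<and> (i \<notin> ?S \<longrightarrow> g i = 0)}" by simp
  qed
  show "finite {g. \<forall>i. (i \<in> ?S \<longrightarrow> g i \<in> {..f 0}) \<and> (i \<notin> ?S \<longrightarrow> g i = 0)}"
    using assms by (intro finite_set_of_finite_funs) (simp_all add: partition_fun_def)
qed

lemma finite_ssyt_fun:
  assumes "partition_fun f" shows "finite (ssyt_fun f N)"
proof (rule finite_subset)
  show "ssyt_fun f N \<subseteq> {T. \<forall>c. (c \<in> cells f \<longrightarrow> T c \<in> {..<N}) \<and> (c \<notin> cells f \<longrightarrow> T c = 0)}"
    by (auto simp: ssyt_fun_def)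
  show "finite {T. \<forall>c. (c \<in> cells f \<longrightarrow> T c \<in> {..<N}) \<and> (c \<notin> cells f \<longrightarrow> T c = (0::nat))}"
    using finite_cells[OF assms] by (intro finite_set_of_finite_funs) simp_all
qed

lemma downward_closed_eq_lessThan:
  assumes "finite (A :: nat set)" "\<And>j k. j \<in> A \<Longrightarrow> k < j \<Longrightarrow> k \<in> A"
  shows "A = {..<card A}"
proof (cases "A = {}")
  case False
  then have "Max A \<in> A" using assms(1) by simp
  then have "k \<in> A" if "k \<le> Max A" for k
    using assms(2)[of "Max A" k] that by (cases "k = Max A") auto
  then have "A = {..Max A}" using assms(1) by auto
  then show ?thesis by (metis card_atMost lessThan_Suc_atMost)
qed simp

definition strip_add :: "nat \<Rightarrow> (nat \<Rightarrow> nat) \<Rightarrow> (nat \<Rightarrow> nat) \<Rightarrow> (nat \<times> nat \<Rightarrow> nat) \<Rightarrow> nat \<times> nat \<Rightarrow> nat" where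
  "strip_add N f g U c = (if c \<in> cells g then U c else if c \<in> cells f then N else 0)"

definition strip_shape :: "nat \<Rightarrow> (nat \<Rightarrow> nat) \<Rightarrow> (nat \<times> nat \<Rightarrow> nat) \<Rightarrow> nat \<Rightarrow> nat" where
  "strip_shape N f T i = card {j. j < f i \<and> T (i, j) < N}"

text \<open>Rows increase weakly, so the entries below \<open>N\<close> form an initial segment and
  counting them gives its length.\<close>

lemma strip_shape_iff:
  assumes "T \<in> ssyt_fun f M"
  shows "j < strip_shape N f T i \<longleftrightarrow> j < f i \<and> T (i, j) < N"
proof -
  let ?A = "{j. j < f i \<and> T (i, j) < N}"
  have row: "T (i, j) \<le> T (i, Suc j)" if "Suc j < f i" for j
    using assms that by (auto simp: ssyt_fun_def cells_def)
  have mono: "T (i, j) \<le> T (i, j + d)" if "j + d < f i" for j d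
    using that by (induction d) (auto intro: le_trans[OF _ row])
  have "?A = {..<card ?A}"
  proof (rule downward_closed_eq_lessThan)
    show "finite ?A" by simp
    fix j k assume "j \<in> ?A" "k < j"
    then show "k \<in> ?A" using mono[of k "j - k"] by auto
  qed
  then show ?thesis by (auto simp: strip_shape_def)
qed

text \<open>Removing the largest entry \<open>N\<close> from a semistandard tableau leaves a smaller one whose
  shape interlaces with the original shape.\<close>

lemma schur_fun_Suc:
  assumes f: "partition_fun f"
  shows "schur_fun (Suc N) f =
    (\<Sum>g\<in>interlacing f. schur_fun N g * var N ^ (card (cells f) - card (cells g)))"
proof -
  let ?X = "SIGMA g:interlacing f. ssyt_fun g N"
  let ?w = "\<lambda>g U. (\<Prod>c\<in>cells g. var (U c)) * var N ^ (card (cells f) - card (cells g))"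
  have "(\<Sum>g\<in>interlacing f. schur_fun N g * var N ^ (card (cells f) - card (cells g))) =
      (\<Sum>g\<in>interlacing f. \<Sum>U\<in>ssyt_fun g N. ?w g U)"
    by (simp add: schur_fun_def sum_distrib_right)
  also have "\<dots> = (\<Sum>(g, U)\<in>?X. ?w g U)"
    using finite_interlacing[OF f] finite_ssyt_fun[OF partition_fun_interlacing[OF f]]
    by (intro sum.Sigma) auto
  also have "\<dots> = (\<Sum>T\<in>ssyt_fun f (Suc N). \<Prod>c\<in>cells f. var (T c))"
  proof (rule sum.reindex_bij_witness[of _
      "\<lambda>T. (strip_shape N f T, \<lambda>c. if c \<in> cells (strip_shape N f T) then T c else 0)"
      "\<lambda>(g, U). strip_add N f g U"])
    fix x assume "x \<in> ?X"
    then obtain g U where x: "x = (g, U)" and g: "g \<in> interlacing f" and U: "U \<in> ssyt_fun g N" by auto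
    have gf: "f (Suc i) \<le> g i" "g i \<le> f i" for i using g by (auto simp: interlacing_def)
    have U0: "U c = 0" if "c \<notin> cells g" for c using U that unfolding ssyt_fun_def by blast
    have UN: "U (i, j) < N" if "j < g i" for i j using U that by (auto simp: ssyt_fun_def cells_def)
    have Urow: "U (i, j) \<le> U (i, Suc j)" if "Suc j < g i" for i j
      using U that by (auto simp: ssyt_fun_def cells_def)
    have Ucol: "U (i, j) < U (Suc i, j)" if "j < g (Suc i)" for i j
      using U that by (auto simp: ssyt_fun_def cells_def)
    let ?T = "strip_add N f g U"
    have Tg: "?T (i, j) = U (i, j)" if "j < g i" for i j
      using that by (simp add: strip_add_def cells_def)
    have TN: "?T (i, j) = N" if "\<not> j < g i" "j < f i" for i j
      using that by (simp add: strip_add_def cells_def)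
    have "?T \<in> ssyt_fun f (Suc N)"
      unfolding ssyt_fun_def
    proof (intro CollectI conjI allI impI ballI)
      show "?T c = 0" if "c \<notin> cells f" for c
        using that cells_interlacing[OF g] by (auto simp: strip_add_def)
      show "?T c < Suc N" if "c \<in> cells f" for c
        using UN by (cases c) (auto simp: strip_add_def cells_def less_Suc_eq)
      fix i j
      show "?T (i, j) \<le> ?T (i, Suc j)" if "(i, Suc j) \<in> cells f"
      proof (cases "Suc j < g i")
        case True
        then show ?thesis using Urow by (simp add: Tg)
      next
        case False
        with that have "?T (i, Suc j) = N" by (simp add: TN cells_def)
        moreover have "?T (i, j) \<le> N" using that UN[of j i]
          by (cases "j < g i") (auto simp: Tg TN cells_def)
        ultimately show ?thesis by simp
      qed
      \<comment> \<open>Interlacing puts every cell that has a cell of \<open>f\<close> beneath it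
        inside \<open>g\<close>, so no two new entries \<open>N\<close> meet in a column.\<close>
      show "?T (i, j) < ?T (Suc i, j)" if "(Suc i, j) \<in> cells f"
      proof -
        have jf: "j < f (Suc i)" using that by (simp add: cells_def)
        then have "j < g i" using gf(1)[of i] by simp
        then have "?T (i, j) = U (i, j)" "U (i, j) < N" by (simp_all add: Tg UN)
        then show ?thesis using Ucol[of j i] jf by (cases "j < g (Suc i)") (auto simp: Tg TN)
      qed
    qed
    moreover have sh: "strip_shape N f ?T = g"
    proof
      fix i
      have "{j. j < f i \<and> ?T (i, j) < N} = {..<g i}"
      proof -
        have "j < f i \<and> ?T (i, j) < N \<longleftrightarrow> j < g i" for j
          using Tg[of j i] TN[of j i] UN[of j i] gf(2)[of i] by (cases "j < g i") auto
        then show ?thesis by auto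
      qed
      then show "strip_shape N f ?T i = g i" by (simp add: strip_shape_def)
    qed
    moreover have "(\<lambda>c. if c \<in> cells g then ?T c else 0) = U"
      using U0 by (auto simp: strip_add_def fun_eq_iff)
    moreover have "(\<Prod>c\<in>cells f. var (?T c)) = ?w g U"
    proof -
      have fin: "finite (cells f)" by (rule finite_cells[OF f])
      have sub: "cells g \<subseteq> cells f" by (rule cells_interlacing[OF g])
      have "(\<Prod>c\<in>cells f. var (?T c)) = (\<Prod>c\<in>cells f - cells g. var (?T c)) * (\<Prod>c\<in>cells g. var (?T c))"
        by (rule prod.subset_diff[OF sub fin])
      also have "(\<Prod>c\<in>cells f - cells g. var (?T c)) = (\<Prod>c\<in>cells f - cells g. var N)"
        by (intro prod.cong refl) (auto simp: strip_add_def)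
      also have "(\<Prod>c\<in>cells g. var (?T c)) = (\<Prod>c\<in>cells g. var (U c))"
        by (intro prod.cong refl) (auto simp: strip_add_def)
      finally show ?thesis
        using card_Diff_subset[OF finite_subset[OF sub fin] sub] by (simp add: mult.commute)
    qed
    ultimately show "(\<lambda>T. (strip_shape N f T, \<lambda>c. if c \<in> cells (strip_shape N f T) then T c else 0))
        (case x of (g, U) \<Rightarrow> strip_add N f g U) = x"
      "(case x of (g, U) \<Rightarrow> strip_add N f g U) \<in> ssyt_fun f (Suc N)"
      "(\<Prod>c\<in>cells f. var ((case x of (g, U) \<Rightarrow> strip_add N f g U) c)) = (case x of (g, U) \<Rightarrow> ?w g U)"
      unfolding x prod.case by simp_all
  next
    fix T assume T: "T \<in> ssyt_fun f (Suc N)"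
    let ?g = "strip_shape N f T"
    let ?U = "\<lambda>c. if c \<in> cells ?g then T c else 0"
    note iff = strip_shape_iff[OF T, of _ N]
    have T0: "T c = 0" if "c \<notin> cells f" for c using T that unfolding ssyt_fun_def by blast
    have TN: "T (i, j) < Suc N" if "j < f i" for i j using T that by (auto simp: ssyt_fun_def cells_def)
    have Trow: "T (i, j) \<le> T (i, Suc j)" if "Suc j < f i" for i j
      using T that by (auto simp: ssyt_fun_def cells_def)
    have Tcol: "T (i, j) < T (Suc i, j)" if "j < f (Suc i)" for i j
      using T that by (auto simp: ssyt_fun_def cells_def)
    have fmono: "f (Suc i) \<le> f i" for i using f by (simp add: partition_fun_def)
    have "?g \<in> interlacing f"
      unfolding interlacing_def
    proof (intro CollectI allI conjI)
      fix i
      show "?g i \<le> f i" using iff[of "f i" i] by (meson less_irrefl not_le)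
      \<comment> \<open>A cell with another one beneath it holds less than the largest letter, since
        columns increase strictly.\<close>
      have "j < ?g i" if "j < f (Suc i)" for j
        using iff[of j i] Tcol[OF that] TN[OF that] fmono[of i] that by auto
      then show "f (Suc i) \<le> ?g i" by (meson less_irrefl not_le)
    qed
    moreover have "?U \<in> ssyt_fun ?g N"
      unfolding ssyt_fun_def
    proof (intro CollectI conjI allI impI ballI)
      show "?U c < N" if "c \<in> cells ?g" for c
        using that iff by (cases c) (auto simp: cells_def)
      fix i j
      show "?U (i, j) \<le> ?U (i, Suc j)" if "(i, Suc j) \<in> cells ?g"
        using that iff[of "Suc j" i] Trow[of j i] by (auto simp: cells_def)
      show "?U (i, j) < ?U (Suc i, j)" if "(Suc i, j) \<in> cells ?g"
        using that iff[of j i] iff[of j "Suc i"] Tcol[of j i] fmono[of i] by (auto simp: cells_def)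
    qed simp
    moreover have "strip_add N f ?g ?U = T"
    proof
      fix c :: "nat \<times> nat"
      obtain i j where c: "c = (i, j)" by (cases c)
      show "strip_add N f ?g ?U c = T c"
        using T0[of c] TN[of j i] iff[of j i] by (auto simp: strip_add_def c cells_def less_Suc_eq)
    qed
    ultimately show "(case (?g, ?U) of (g, U) \<Rightarrow> strip_add N f g U) = T" "(?g, ?U) \<in> ?X" by simp_all
  qed
  also have "\<dots> = schur_fun (Suc N) f" by (simp add: schur_fun_def)
  finally show ?thesis by simp
qed

lemma schur_fun_0: "schur_fun 0 f = (if cells f = {} then 1 else 0)"
proof (cases "cells f = {}")
  case True
  then have "ssyt_fun f 0 = {\<lambda>_. 0}" by (auto simp: ssyt_fun_def)
  then show ?thesis using True by (simp add: schur_fun_def)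
next
  case False
  then have "ssyt_fun f 0 = {}" by (auto simp: ssyt_fun_def)
  then show ?thesis using False by (simp add: schur_fun_def)
qed

section \<open>Pieri's rule for a single box\<close>

definition addable :: "(nat \<Rightarrow> nat) \<Rightarrow> nat set" where
  "addable f = {i. i = 0 \<or> f i < f (i - 1)}"

definition add_box :: "(nat \<Rightarrow> nat) \<Rightarrow> nat \<Rightarrow> nat \<Rightarrow> nat" where
  "add_box f i = f(i := Suc (f i))"

definition remove_box :: "(nat \<Rightarrow> nat) \<Rightarrow> nat \<Rightarrow> nat \<Rightarrow> nat" where
  "remove_box f i = f(i := f i - 1)"

lemma add_box_apply: "add_box f i j = (if j = i then Suc (f j) else f j)"
  by (simp add: add_box_def)

lemma remove_add_box [simp]: "remove_box (add_box f i) i = f"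
  by (simp add: remove_box_def add_box_def)

lemma add_remove_box: "0 < f i \<Longrightarrow> add_box (remove_box f i) i = f"
  by (simp add: remove_box_def add_box_def)

lemma finite_addable:
  assumes "partition_fun f" shows "finite (addable f)"
proof (rule finite_subset)
  show "addable f \<subseteq> insert 0 (Suc ` {i. f i \<noteq> 0})"
  proof
    fix i assume "i \<in> addable f"
    then show "i \<in> insert 0 (Suc ` {i. f i \<noteq> 0})"
      by (cases i) (auto simp: addable_def)
  qed
qed (use assms in \<open>simp add: partition_fun_def\<close>)

lemma partition_fun_add_box:
  assumes "partition_fun f" "i \<in> addable f" shows "partition_fun (add_box f i)"
proof -
  have mono: "f (Suc j) \<le> f j" for j using assms by (simp add: partition_fun_def)
  have "add_box f i (Suc j) \<le> add_box f i j" for j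
    using assms(2) mono[of j] by (cases "i = Suc j") (auto simp: add_box_apply addable_def)
  moreover have "{j. add_box f i j \<noteq> 0} \<subseteq> insert i {j. f j \<noteq> 0}" by (auto simp: add_box_apply)
  then have "finite {j. add_box f i j \<noteq> 0}"
    by (rule finite_subset) (use assms(1) in \<open>simp add: partition_fun_def\<close>)
  ultimately show ?thesis by (simp add: partition_fun_def)
qed

lemma card_cells_add_box:
  assumes "partition_fun f" shows "card (cells (add_box f i)) = Suc (card (cells f))"
proof -
  have "cells (add_box f i) = insert (i, f i) (cells f)"
    by (auto simp: cells_def add_box_apply split: if_splits)
  moreover have "(i, f i) \<notin> cells f" by (simp add: cells_def)
  ultimately show ?thesis using finite_cells[OF assms] by simp
qed

context
  fixes f :: "nat \<Rightarrow> nat"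
  assumes f: "partition_fun f"
begin

lemma partition_fun_Suc_le: "f (Suc i) \<le> f i"
  using f by (simp add: partition_fun_def)

lemma interlacing_add_box_0: "interlacing f \<subseteq> interlacing (add_box f 0)"
  by (auto simp: interlacing_def add_box_apply intro: le_SucI)

text \<open>If the enlarged \<open>g\<close> still interlaces with \<open>f\<close>, then f has a
  strict drop after row \<open>i\<close>, and the box is charged to row \<open>Suc i\<close> of
  \<open>f\<close>. Otherwise \<open>g i = f i\<close>, and \<open>f\<close> has to grow in row
  \<open>i\<close> itself.\<close>

lemma add_then_interlace:
  assumes g: "g \<in> interlacing f" "i \<in> addable g"
  defines "h \<equiv> add_box g i"
  shows "h \<in> interlacing f \<Longrightarrow> Suc i \<in> addable f \<and> h \<in> interlacing (add_box f (Suc i))"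
    and "h \<notin> interlacing f \<Longrightarrow> i \<in> addable f \<and> h \<in> interlacing (add_box f i)"
proof -
  have gf: "f (Suc j) \<le> g j" "g j \<le> f j" for j using g(1) by (auto simp: interlacing_def)
  show "Suc i \<in> addable f \<and> h \<in> interlacing (add_box f (Suc i))" if "h \<in> interlacing f"
  proof -
    have "Suc (g i) \<le> f i"
      using that unfolding interlacing_def h_def add_box_def by (auto dest: spec[of _ i])
    then have "f (Suc i) < f i" using gf(1)[of i] by simp
    moreover have "h \<in> interlacing (add_box f (Suc i))"
      unfolding interlacing_def
    proof (intro CollectI allI conjI)
      fix j
      show "add_box f (Suc i) (Suc j) \<le> h j" "h j \<le> add_box f (Suc i) j"
        using gf[of j] \<open>Suc (g i) \<le> f i\<close> by (auto simp: h_def add_box_apply)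
    qed
    ultimately show ?thesis by (simp add: addable_def)
  qed
  show "i \<in> addable f \<and> h \<in> interlacing (add_box f i)" if h: "h \<notin> interlacing f"
  proof -
    have gi: "g i = f i"
    proof (rule ccontr)
      assume "g i \<noteq> f i"
      then have "Suc (g i) \<le> f i" using gf(2)[of i] by simp
      then have "h \<in> interlacing f"
        using gf by (auto simp: interlacing_def h_def add_box_apply intro: le_SucI)
      with h show False by simp
    qed
    have less: "f (Suc k) < g k" if "i = Suc k" for k
      using g(2) gi that by (auto simp: addable_def)
    then have "i \<in> addable f"
      using gf(2) by (cases i) (auto simp: addable_def intro: less_le_trans)
    moreover have "h \<in> interlacing (add_box f i)"
      unfolding interlacing_def
    proof (intro CollectI allI conjI)
      fix j
      show "add_box f i (Suc j) \<le> h j" "h j \<le> add_box f i j"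
        using gf[of j] less[of j] by (auto simp: h_def add_box_apply intro: le_SucI)
    qed
    ultimately show ?thesis by simp
  qed
qed

text \<open>The inverse of \<open>add_then_interlace\<close>. If \<open>h\<close> interlaces with
  \<open>f\<close> already, the larger row \<open>Suc k\<close> forces row \<open>k\<close> of
  \<open>h\<close> beyond its old lower bound, so a box can come off there. Otherwise
  \<open>h\<close> exceeds \<open>f\<close> exactly in row \<open>i\<close>.\<close>

lemma interlace_then_remove:
  assumes h: "h \<in> interlacing (add_box f i)" and i: "i \<in> addable f"
  shows "h \<in> interlacing f \<Longrightarrow> i = Suc k \<Longrightarrow>
      0 < h k \<and> remove_box h k \<in> interlacing f \<and> k \<in> addable (remove_box h k)"
    and "h \<notin> interlacing f \<Longrightarrow>
      0 < h i \<and> remove_box h i \<in> interlacing f \<and> i \<in> addable (remove_box h i)"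
proof -
  have hf: "add_box f i (Suc j) \<le> h j" "h j \<le> add_box f i j" for j
    using h by (auto simp: interlacing_def)
  show "0 < h k \<and> remove_box h k \<in> interlacing f \<and> k \<in> addable (remove_box h k)"
    if hh: "h \<in> interlacing f" and k: "i = Suc k"
  proof -
    have hf': "f (Suc j) \<le> h j" "h j \<le> f j" for j using hh by (auto simp: interlacing_def)
    have hk: "Suc (f (Suc k)) \<le> h k" using hf(1)[of k] k by (simp add: add_box_apply)
    have "remove_box h k \<in> interlacing f"
      unfolding interlacing_def
    proof (intro CollectI allI conjI)
      fix j
      show "f (Suc j) \<le> remove_box h k j" "remove_box h k j \<le> f j"
        using hf'[of j] hk by (auto simp: remove_box_def)
    qed
    moreover have "k \<in> addable (remove_box h k)"
    proof (cases k)
      case (Suc l)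
      have "h k \<le> h l" using hf'(2)[of k] hf'(1)[of l] Suc by simp
      then show ?thesis using hk Suc by (auto simp: addable_def remove_box_def)
    qed (simp add: addable_def)
    ultimately show ?thesis using hk by simp
  qed
  show "0 < h i \<and> remove_box h i \<in> interlacing f \<and> i \<in> addable (remove_box h i)"
    if hh: "h \<notin> interlacing f"
  proof -
    have low: "f (Suc j) \<le> h j" for j
      using hf(1)[of j] by (cases "Suc j = i") (auto simp: add_box_apply)
    have up: "h j \<le> f j" if "j \<noteq> i" for j
      using hf(2)[of j] that by (simp add: add_box_apply)
    have hi: "h i = Suc (f i)"
    proof (rule ccontr)
      assume "h i \<noteq> Suc (f i)"
      then have "h i \<le> f i" using hf(2)[of i] by (simp add: add_box_apply)
      then have "h j \<le> f j" for j using up by (cases "j = i") auto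
      then have "h \<in> interlacing f" using low by (simp add: interlacing_def)
      with hh show False by simp
    qed
    have "remove_box h i \<in> interlacing f"
      unfolding interlacing_def
    proof (intro CollectI allI conjI)
      fix j
      show "f (Suc j) \<le> remove_box h i j" "remove_box h i j \<le> f j"
        using low[of j] up[of j] hi partition_fun_Suc_le[of j] by (auto simp: remove_box_def)
    qed
    moreover have "i \<in> addable (remove_box h i)"
    proof (cases i)
      case (Suc l)
      have "Suc (f i) \<le> h l" using hf(1)[of l] Suc by (simp add: add_box_apply)
      then show ?thesis using hi Suc by (auto simp: addable_def remove_box_def)
    qed (simp add: addable_def)
    ultimately show ?thesis using hi by simp
  qed
qed

text \<open>Adding a box and passing to an interlacing partition commute, except that adding a box
  to the first row has no counterpart in the other order.\<close>

lemma sum_add_interlace: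
  fixes w :: "(nat \<Rightarrow> nat) \<Rightarrow> cpoly"
  shows "(\<Sum>i\<in>addable f. \<Sum>h\<in>interlacing (add_box f i). w h) =
    (\<Sum>g\<in>interlacing f. w g) + (\<Sum>g\<in>interlacing f. \<Sum>i\<in>addable g. w (add_box g i))"
proof -
  let ?X = "SIGMA i:addable f. interlacing (add_box f i)"
  let ?Z = "{0 :: nat} \<times> interlacing f"
  let ?Y = "SIGMA g:interlacing f. addable g"
  have finX: "finite ?X"
    using finite_addable[OF f] finite_interlacing[OF partition_fun_add_box[OF f]]
    by (intro finite_SigmaI)
  have sub: "?Z \<subseteq> ?X" using interlacing_add_box_0 by (auto simp: addable_def)
  have "(\<Sum>i\<in>addable f. \<Sum>h\<in>interlacing (add_box f i). w h) = (\<Sum>(i, h)\<in>?X. w h)"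
    using finite_addable[OF f] finite_interlacing[OF partition_fun_add_box[OF f]]
    by (intro sum.Sigma) auto
  also have "\<dots> = (\<Sum>(i, h)\<in>?X - ?Z. w h) + (\<Sum>(i, h)\<in>?Z. w h)"
    by (rule sum.subset_diff[OF sub finX])
  also have "(\<Sum>(i, h)\<in>?Z. w h) = (\<Sum>g\<in>interlacing f. w g)"
    by (simp add: sum.cartesian_product[symmetric])
  also have "(\<Sum>(i, h)\<in>?X - ?Z. w h) = (\<Sum>(g, i)\<in>?Y. w (add_box g i))"
  proof (rule sum.reindex_bij_witness[of _
      "\<lambda>(g, i). (if add_box g i \<in> interlacing f then Suc i else i, add_box g i)"
      "\<lambda>(i, h). if h \<in> interlacing f then (remove_box h (i - 1), i - 1) else (remove_box h i, i)"])
    fix x assume xX: "x \<in> ?X - ?Z"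
    obtain i h where x: "x = (i, h)" by (cases x)
    have i: "i \<in> addable f" and h: "h \<in> interlacing (add_box f i)"
      and n0: "\<not> (i = 0 \<and> h \<in> interlacing f)"
      using xX unfolding x by blast+
    let ?g = "\<lambda>(i, h). if h \<in> interlacing f then (remove_box h (i - 1), i - 1) else (remove_box h i, i)"
    let ?f = "\<lambda>(g, i). (if add_box g i \<in> interlacing f then Suc i else i, add_box g i)"
    show "?f (?g x) = x" "?g x \<in> ?Y" "(case ?g x of (g, i) \<Rightarrow> w (add_box g i)) = (case x of (i, h) \<Rightarrow> w h)"
    proof -
      have "?f (?g x) = x \<and> ?g x \<in> ?Y \<and> (case ?g x of (g, i) \<Rightarrow> w (add_box g i)) = (case x of (i, h) \<Rightarrow> w h)"
      proof (cases "h \<in> interlacing f")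
        case True
        then obtain k where k: "i = Suc k" using n0 by (cases i) auto
        from interlace_then_remove(1)[OF h i True k] k True show ?thesis
          by (simp add: x add_remove_box)
      next
        case False
        from interlace_then_remove(2)[OF h i False] False show ?thesis
          by (simp add: x add_remove_box)
      qed
      then show "?f (?g x) = x" "?g x \<in> ?Y" "(case ?g x of (g, i) \<Rightarrow> w (add_box g i)) = (case x of (i, h) \<Rightarrow> w h)"
        by blast+
    qed
  next
    fix y assume "y \<in> ?Y"
    then obtain g i where y: "y = (g, i)" and g: "g \<in> interlacing f" "i \<in> addable g" by auto
    let ?g = "\<lambda>(i, h). if h \<in> interlacing f then (remove_box h (i - 1), i - 1) else (remove_box h i, i)"
    let ?f = "\<lambda>(g, i). (if add_box g i \<in> interlacing f then Suc i else i, add_box g i)"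
    show "?g (?f y) = y" by (simp add: y)
    show "?f y \<in> ?X - ?Z"
      using add_then_interlace[OF g] by (cases "add_box g i \<in> interlacing f") (simp_all add: y)
  qed
  also have "\<dots> = (\<Sum>g\<in>interlacing f. \<Sum>i\<in>addable g. w (add_box g i))"
    using finite_interlacing[OF f] finite_addable[OF partition_fun_interlacing[OF f]]
    by (intro sum.Sigma[symmetric]) auto
  finally show ?thesis by (simp add: add.commute)
qed

end

text \<open>Induction on the number of variables, splitting off the newest one. The uncompensated
  term of \<open>sum_add_interlace\<close> supplies that variable times the Schur polynomial, and
  the remaining sum is the rule in \<open>N\<close> variables for each interlacing shape.\<close>

theorem schur_fun_Pieri:
  "partition_fun f \<Longrightarrow> psum N 1 * schur_fun N f = (\<Sum>i\<in>addable f. schur_fun N (add_box f i))"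
proof (induction N arbitrary: f)
  case 0
  have "cells (add_box f i) \<noteq> {}" for i by (auto simp: cells_def add_box_apply)
  then show ?case by (simp add: schur_fun_0 psum_def)
next
  case (Suc N)
  note f = Suc.prems
  let ?x = "var N" and ?c = "\<lambda>g. card (cells g)"
  \<comment> \<open>All shapes \<open>add_box f i\<close> have one cell more than \<open>f\<close>,
    so one weight serves every \<open>i\<close>.\<close>
  define w where "w h = schur_fun N h * ?x ^ (Suc (?c f) - ?c h)" for h
  have le: "?c g \<le> ?c f" if "g \<in> interlacing f" for g
    by (rule card_mono[OF finite_cells[OF f] cells_interlacing[OF that]])
  have "(\<Sum>i\<in>addable f. schur_fun (Suc N) (add_box f i)) =
      (\<Sum>i\<in>addable f. \<Sum>h\<in>interlacing (add_box f i). w h)"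
    using f by (intro sum.cong refl) (simp add: schur_fun_Suc partition_fun_add_box card_cells_add_box w_def)
  also have "\<dots> = (\<Sum>g\<in>interlacing f. w g) + (\<Sum>g\<in>interlacing f. \<Sum>i\<in>addable g. w (add_box g i))"
    by (rule sum_add_interlace[OF f])
  also have "(\<Sum>g\<in>interlacing f. w g) = ?x * schur_fun (Suc N) f"
    using le by (simp add: schur_fun_Suc[OF f] sum_distrib_left w_def Suc_diff_le mult.left_commute)
  also have "(\<Sum>g\<in>interlacing f. \<Sum>i\<in>addable g. w (add_box g i)) = psum N 1 * schur_fun (Suc N) f"
    unfolding schur_fun_Suc[OF f] sum_distrib_left
  proof (rule sum.cong[OF refl])
    fix g assume "g \<in> interlacing f"
    then have g: "partition_fun g" by (rule partition_fun_interlacing[OF f])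
    have "(\<Sum>i\<in>addable g. w (add_box g i)) = (\<Sum>i\<in>addable g. schur_fun N (add_box g i)) * ?x ^ (?c f - ?c g)"
      by (simp add: w_def card_cells_add_box[OF g] sum_distrib_right)
    then show "(\<Sum>i\<in>addable g. w (add_box g i)) = psum N 1 * (schur_fun N g * ?x ^ (?c f - ?c g))"
      by (simp only: Suc.IH[OF g, symmetric] mult.assoc)
  qed
  finally show ?case by (simp add: psum_def distrib_right)
qed

section \<open>Columns, hooks and the product of p_2 with e_m\<close>

definition hook :: "nat \<Rightarrow> nat \<Rightarrow> nat \<Rightarrow> nat" where
  "hook a k = (\<lambda>i. if i = 0 then a else if i \<le> k then 1 else 0)"

text \<open>The shape (2, b, 1^k). The case \<open>b = 2\<close> is the one of interest;
  \<open>b = 1\<close>, and \<open>b = 0\<close> with \<open>k = 0\<close>, arise as interlacing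
  shapes and are hooks again.\<close>

definition fat_hook :: "nat \<Rightarrow> nat \<Rightarrow> nat \<Rightarrow> nat" where
  "fat_hook b k = (\<lambda>i. if i = 0 then 2 else if i = 1 then b else if i < k + 2 then 1 else 0)"

definition column :: "nat \<Rightarrow> nat \<Rightarrow> nat" where
  "column m = (\<lambda>i. if i < m then 1 else 0)"

lemma card_cells:
  assumes "\<And>i. L \<le> i \<Longrightarrow> f i = 0"
  shows "card (cells f) = (\<Sum>i<L. f i)"
proof -
  have "i < L" if "0 < f i" for i using assms[of i] that by (cases "i < L") auto
  then have "cells f = (SIGMA i:{..<L}. {..<f i})" by (auto simp: cells_def)
  then show ?thesis by simp
qed

lemma card_cells_hook: "card (cells (hook a k)) = a + k"
  by (subst card_cells[of "Suc k"]) (simp_all add: hook_def sum.lessThan_Suc_shift del: sum.lessThan_Suc)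

lemma card_cells_fat_hook: "card (cells (fat_hook b k)) = 2 + b + k"
  by (subst card_cells[of "Suc (Suc k)"]) (simp_all add: fat_hook_def sum.lessThan_Suc_shift del: sum.lessThan_Suc)

lemma card_cells_column: "card (cells (column m)) = m"
  by (subst card_cells[of m]) (simp_all add: column_def)

lemma finite_support:
  fixes f :: "nat \<Rightarrow> nat"
  assumes "\<And>i. L \<le> i \<Longrightarrow> f i = 0"
  shows "finite {i. f i \<noteq> 0}"
proof (rule finite_subset)
  have "i < L" if "f i \<noteq> 0" for i using assms[of i] that by (cases "i < L") auto
  then show "{i. f i \<noteq> 0} \<subseteq> {..<L}" by blast
qed simp

lemma partition_fun_hook: "0 < a \<Longrightarrow> partition_fun (hook a k)"
  unfolding partition_fun_def
  by (intro conjI finite_support[of "Suc k"]) (auto simp: hook_def)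

lemma partition_fun_fat_hook: "b \<in> {1, 2} \<Longrightarrow> partition_fun (fat_hook b k)"
  unfolding partition_fun_def
  by (intro conjI finite_support[of "Suc (Suc k)"]) (auto simp: fat_hook_def)

lemma partition_fun_column: "partition_fun (column m)"
  unfolding partition_fun_def
  by (intro conjI finite_support[of m]) (auto simp: column_def)

lemma hook_1: "hook 1 k = column (Suc k)"
  by (auto simp: hook_def column_def fun_eq_iff)

lemma hook_0: "hook 0 0 = column 0"
  by (auto simp: hook_def column_def fun_eq_iff)

lemma fat_hook_1: "fat_hook 1 k = hook 2 (Suc k)"
  by (auto simp: hook_def fat_hook_def fun_eq_iff)

lemma fat_hook_0: "fat_hook 0 0 = hook 2 0"
  by (auto simp: hook_def fat_hook_def fun_eq_iff)

lemma schur_fun_column_0: "schur_fun N (column 0) = 1"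
proof -
  have "cells (column 0) = {}" by (simp add: cells_def column_def)
  moreover from this have "ssyt_fun (column 0) N = {\<lambda>_. 0}" by (auto simp: ssyt_fun_def)
  ultimately show ?thesis by (simp add: schur_fun_def)
qed

lemma interlacing_column: "interlacing (column (Suc m)) = {column (Suc m), column m}"
proof (intro equalityI subsetI)
  fix g assume g: "g \<in> interlacing (column (Suc m))"
  have g': "column (Suc m) (Suc i) \<le> g i" "g i \<le> column (Suc m) i" for i
    using g by (auto simp: interlacing_def)
  have "g = (if g m = 0 then column m else column (Suc m))"
  proof
    fix i
    show "g i = (if g m = 0 then column m else column (Suc m)) i"
      using g'[of i] by (cases "i < m"; cases "i = m") (auto simp: column_def)
  qed
  then show "g \<in> {column (Suc m), column m}" by (metis insertCI)
next
  have "column l \<in> interlacing (column (Suc m))" if "l = m \<or> l = Suc m" for l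
  proof -
    have "column (Suc m) (Suc i) \<le> column l i \<and> column l i \<le> column (Suc m) i" for i
      using that by (auto simp: column_def)
    then show ?thesis unfolding interlacing_def by blast
  qed
  then show "g \<in> interlacing (column (Suc m))" if "g \<in> {column (Suc m), column m}" for g
    using that by auto
qed

lemma interlacing_hook_0: "interlacing (hook a 0) = (\<lambda>b. hook b 0) ` {0..a}"
proof (intro equalityI subsetI)
  fix g assume g: "g \<in> interlacing (hook a 0)"
  have g': "g i \<le> hook a 0 i" for i using g by (auto simp: interlacing_def)
  have "g i = hook (g 0) 0 i" for i using g'[of i] by (cases i) (auto simp: hook_def)
  then have "g = hook (g 0) 0" by blast
  moreover have "g 0 \<le> a" using g'[of 0] by (simp add: hook_def)
  ultimately show "g \<in> (\<lambda>b. hook b 0) ` {0..a}" by auto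
next
  have "hook b 0 \<in> interlacing (hook a 0)" if "b \<in> {0..a}" for b
  proof -
    have "hook a 0 (Suc i) \<le> hook b 0 i \<and> hook b 0 i \<le> hook a 0 i" for i
      using that by (auto simp: hook_def)
    then show ?thesis unfolding interlacing_def by blast
  qed
  then show "g \<in> interlacing (hook a 0)" if "g \<in> (\<lambda>b. hook b 0) ` {0..a}" for g
    using that by auto
qed

text \<open>The second row has length 1, so the first row may shrink only down to 1; independently,
  the lowest box of the leg may be lost.\<close>

lemma interlacing_hook:
  "interlacing (hook a (Suc k)) = (\<lambda>b. hook b (Suc k)) ` {1..a} \<union> (\<lambda>b. hook b k) ` {1..a}"
proof (intro equalityI subsetI)
  fix g assume g: "g \<in> interlacing (hook a (Suc k))"
  have g': "hook a (Suc k) (Suc i) \<le> g i" "g i \<le> hook a (Suc k) i" for i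
    using g by (auto simp: interlacing_def)
  have "g = (if g (Suc k) = 0 then hook (g 0) k else hook (g 0) (Suc k))"
  proof
    fix i
    show "g i = (if g (Suc k) = 0 then hook (g 0) k else hook (g 0) (Suc k)) i"
      using g'[of i] by (cases "i = 0"; cases "i \<le> k"; cases "i = Suc k") (auto simp: hook_def)
  qed
  then have "g = hook (g 0) k \<or> g = hook (g 0) (Suc k)" by metis
  moreover have "g 0 \<in> {1..a}" using g'[of 0] by (simp add: hook_def)
  ultimately show "g \<in> (\<lambda>b. hook b (Suc k)) ` {1..a} \<union> (\<lambda>b. hook b k) ` {1..a}"
    using image_eqI[of g "\<lambda>b. hook b k" "g 0"] image_eqI[of g "\<lambda>b. hook b (Suc k)" "g 0"] by (metis UnI1 UnI2)
next
  have *: "hook b l \<in> interlacing (hook a (Suc k))" if "b \<in> {1..a}" "l = k \<or> l = Suc k" for b l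
  proof -
    have "hook a (Suc k) (Suc i) \<le> hook b l i \<and> hook b l i \<le> hook a (Suc k) i" for i
      using that by (cases "i = 0"; cases "i \<le> k"; cases "i = Suc k") (auto simp: hook_def)
    then show ?thesis unfolding interlacing_def by blast
  qed
  show "g \<in> interlacing (hook a (Suc k))"
    if "g \<in> (\<lambda>b. hook b (Suc k)) ` {1..a} \<union> (\<lambda>b. hook b k) ` {1..a}" for g
    using that by (auto intro!: *)
qed

lemma interlacing_fat_hook_0: "interlacing (fat_hook 2 0) = (\<lambda>b. fat_hook b 0) ` {0..2}"
proof (intro equalityI subsetI)
  fix g assume g: "g \<in> interlacing (fat_hook 2 0)"
  have g': "fat_hook 2 0 (Suc i) \<le> g i" "g i \<le> fat_hook 2 0 i" for i
    using g by (auto simp: interlacing_def)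
  have "g i = fat_hook (g 1) 0 i" for i
    using g'[of i] by (cases "i = 0"; cases "i = 1") (auto simp: fat_hook_def)
  then have "g = fat_hook (g 1) 0" by blast
  moreover have "g 1 \<le> 2" using g'[of 1] by (simp add: fat_hook_def)
  ultimately show "g \<in> (\<lambda>b. fat_hook b 0) ` {0..2}" by auto
next
  have "fat_hook b 0 \<in> interlacing (fat_hook 2 0)" if "b \<le> 2" for b
    using that by (simp add: interlacing_def fat_hook_def)
  then show "g \<in> interlacing (fat_hook 2 0)" if "g \<in> (\<lambda>b. fat_hook b 0) ` {0..2}" for g
    using that by fastforce
qed

text \<open>The first row is locked at 2 by the second, which in turn can shrink only to 1 because a
  third row exists; with no third row it can shrink to 0.\<close>

lemma interlacing_fat_hook:
  "interlacing (fat_hook 2 (Suc k)) = (\<lambda>b. fat_hook b (Suc k)) ` {1..2} \<union> (\<lambda>b. fat_hook b k) ` {1..2}"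
proof (intro equalityI subsetI)
  fix g assume g: "g \<in> interlacing (fat_hook 2 (Suc k))"
  have g': "fat_hook 2 (Suc k) (Suc i) \<le> g i" "g i \<le> fat_hook 2 (Suc k) i" for i
    using g by (auto simp: interlacing_def)
  have "g = (if g (k + 2) = 0 then fat_hook (g 1) k else fat_hook (g 1) (Suc k))"
  proof
    fix i
    show "g i = (if g (k + 2) = 0 then fat_hook (g 1) k else fat_hook (g 1) (Suc k)) i"
      using g'[of i] by (cases "i = 0"; cases "i = 1"; cases "i < k + 2"; cases "i = k + 2") (auto simp: fat_hook_def)
  qed
  then have "g = fat_hook (g 1) k \<or> g = fat_hook (g 1) (Suc k)" by metis
  moreover have "g 1 \<in> {1..2}" using g'[of 1] by (simp add: fat_hook_def)
  ultimately show "g \<in> (\<lambda>b. fat_hook b (Suc k)) ` {1..2} \<union> (\<lambda>b. fat_hook b k) ` {1..2}"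
    using image_eqI[of g "\<lambda>b. fat_hook b k" "g 1"] image_eqI[of g "\<lambda>b. fat_hook b (Suc k)" "g 1"] by (metis UnI1 UnI2)
next
  have *: "fat_hook b l \<in> interlacing (fat_hook 2 (Suc k))" if "b \<in> {1..2}" "l = k \<or> l = Suc k" for b l
  proof -
    have "fat_hook 2 (Suc k) (Suc i) \<le> fat_hook b l i \<and> fat_hook b l i \<le> fat_hook 2 (Suc k) i" for i
      using that by (cases "i = 0"; cases "i = 1"; cases "i < k + 2"; cases "i = k + 2") (auto simp: fat_hook_def)
    then show ?thesis unfolding interlacing_def by blast
  qed
  show "g \<in> interlacing (fat_hook 2 (Suc k))"
    if "g \<in> (\<lambda>b. fat_hook b (Suc k)) ` {1..2} \<union> (\<lambda>b. fat_hook b k) ` {1..2}" for g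
    using that by (auto intro!: *)
qed

lemma schur_fun_Suc_column:
  "schur_fun (Suc N) (column (Suc m)) = schur_fun N (column (Suc m)) + var N * schur_fun N (column m)"
proof -
  have "column (Suc m) m \<noteq> column m m" by (simp add: column_def)
  then have "column (Suc m) \<noteq> column m" by metis
  then show ?thesis
    by (simp add: schur_fun_Suc partition_fun_column interlacing_column card_cells_column mult.commute)
qed

lemma schur_fun_Suc_hook_0:
  assumes "0 < a"
  shows "schur_fun (Suc N) (hook a 0) = (\<Sum>b=0..a. schur_fun N (hook b 0) * var N ^ (a - b))"
proof -
  have "inj_on (\<lambda>b. hook b 0) {0..a}"
    by (rule inj_onI) (auto simp: hook_def fun_eq_iff split: if_splits)
  then show ?thesis
    using assms by (simp add: schur_fun_Suc partition_fun_hook interlacing_hook_0 card_cells_hook sum.reindex)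
qed

lemma schur_fun_Suc_hook:
  assumes "0 < a"
  shows "schur_fun (Suc N) (hook a (Suc k)) =
    (\<Sum>b=1..a. schur_fun N (hook b (Suc k)) * var N ^ (a - b)) +
    (\<Sum>b=1..a. schur_fun N (hook b k) * var N ^ (Suc a - b))"
proof -
  have inj: "inj_on (\<lambda>b. hook b k) A" for k A
  proof (rule inj_onI)
    fix b c assume "hook b k = hook c k"
    then have "hook b k 0 = hook c k 0" by (rule fun_cong)
    then show "b = c" by (simp add: hook_def)
  qed
  have "hook b (Suc k) \<noteq> hook c k" for b c
  proof
    assume "hook b (Suc k) = hook c k"
    then have "hook b (Suc k) (Suc k) = hook c k (Suc k)" by (rule fun_cong)
    then show False by (simp add: hook_def)
  qed
  then have "(\<lambda>b. hook b (Suc k)) ` {1..a} \<inter> (\<lambda>b. hook b k) ` {1..a} = {}" by auto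
  then show ?thesis
    using assms by (simp add: schur_fun_Suc partition_fun_hook interlacing_hook card_cells_hook
        sum.union_disjoint sum.reindex[OF inj])
qed

lemma schur_fun_Suc_fat_hook_0:
  "schur_fun (Suc N) (fat_hook 2 0) = (\<Sum>b=0..2. schur_fun N (fat_hook b 0) * var N ^ (2 - b))"
proof -
  have "inj_on (\<lambda>b. fat_hook b 0) {0..2}"
  proof (rule inj_onI)
    fix b c assume "fat_hook b 0 = fat_hook c 0"
    then have "fat_hook b 0 1 = fat_hook c 0 1" by (rule fun_cong)
    then show "b = c" by (simp add: fat_hook_def)
  qed
  then show ?thesis
    by (simp add: schur_fun_Suc partition_fun_fat_hook interlacing_fat_hook_0 card_cells_fat_hook sum.reindex)
qed

lemma schur_fun_Suc_fat_hook:
  "schur_fun (Suc N) (fat_hook 2 (Suc k)) =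
    (\<Sum>b=1..2. schur_fun N (fat_hook b (Suc k)) * var N ^ (2 - b)) +
    (\<Sum>b=1..2. schur_fun N (fat_hook b k) * var N ^ (3 - b))"
proof -
  have inj: "inj_on (\<lambda>b. fat_hook b k) A" for k A
  proof (rule inj_onI)
    fix b c assume "fat_hook b k = fat_hook c k"
    then have "fat_hook b k 1 = fat_hook c k 1" by (rule fun_cong)
    then show "b = c" by (simp add: fat_hook_def)
  qed
  have "fat_hook b (Suc k) \<noteq> fat_hook c k" for b c
  proof
    assume "fat_hook b (Suc k) = fat_hook c k"
    then have "fat_hook b (Suc k) (k + 2) = fat_hook c k (k + 2)" by (rule fun_cong)
    then show False by (simp add: fat_hook_def)
  qed
  then have "(\<lambda>b. fat_hook b (Suc k)) ` {1..2} \<inter> (\<lambda>b. fat_hook b k) ` {1..2} = {}" by auto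
  then show ?thesis
    by (simp add: schur_fun_Suc partition_fun_fat_hook interlacing_fat_hook card_cells_fat_hook
        sum.union_disjoint sum.reindex[OF inj])
qed

text \<open>Both sides obey the same recursion in \<open>N\<close>: the newest variable occurs at
  most once in a column, necessarily at its foot.\<close>

lemma elem_fps_eq_column: "elem_fps N $ m = (-1) ^ m * schur_fun N (column m)"
proof (induction N arbitrary: m)
  case 0
  have "cells (column (Suc k)) \<noteq> {}" for k by (auto simp: cells_def column_def)
  then show ?case
    by (cases m) (simp_all add: elem_fps_def schur_fun_column_0 schur_fun_0)
next
  case (Suc N)
  show ?case
    by (cases m) (simp_all add: elem_fps_Suc Suc schur_fun_column_0 schur_fun_Suc_column algebra_simps)
qed

text \<open>The Murnaghan-Nakayama rule for adding a domino to a column: horizontally in the first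
  row, vertically in the second column (sign -1), or vertically at the foot (sign -1, moved to the
  left side). For \<open>m = 0\<close> and \<open>m = 1\<close> the second column has no room. The
  proof compares the branching rules under a new variable.\<close>

lemma psum_2_column:
  "psum N 2 * schur_fun N (column m) + schur_fun N (column (Suc (Suc m))) =
    (if m = 0 then schur_fun N (hook 2 0) else if m = 1 then schur_fun N (hook 3 0)
     else schur_fun N (hook 3 (m - 1)) - schur_fun N (fat_hook 2 (m - 2)))"
proof (induction N arbitrary: m)
  case 0
  have "(0, 0) \<in> cells (column (Suc k))" "(0, 0) \<in> cells (hook 2 k)" "(0, 0) \<in> cells (hook 3 k)"
    "(0, 0) \<in> cells (fat_hook b k)" for b k
    by (auto simp: cells_def column_def hook_def fat_hook_def)
  then have "cells (column (Suc k)) \<noteq> {}" "cells (hook 2 k) \<noteq> {}" "cells (hook 3 k) \<noteq> {}"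
    "cells (fat_hook b k) \<noteq> {}" for b k
    by blast+
  then show ?case by (simp add: schur_fun_0 psum_def)
next
  case (Suc N)
  let ?x = "var N" and ?e = "\<lambda>m. schur_fun N (column m)" and ?h = "\<lambda>a k. schur_fun N (hook a k)"
    and ?b = "\<lambda>k. schur_fun N (fat_hook 2 k)"
  have p: "psum (Suc N) 2 = psum N 2 + ?x ^ 2" by (simp add: psum_def)
  have r: "{0..3} = {0,1,2,3::nat}" "{Suc 0..3} = {Suc 0,2,3}" "{0..2} = {0,1,2::nat}" "{Suc 0..2} = {Suc 0,2}"
    by auto
  have e: "schur_fun (Suc N) (column (Suc k)) = ?e (Suc k) + ?x * ?e k" for k
    by (rule schur_fun_Suc_column)
  have h20: "schur_fun (Suc N) (hook 2 0) = ?h 2 0 + ?x * ?e 1 + ?x ^ 2"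
    by (simp add: schur_fun_Suc_hook_0 r hook_0 hook_1[unfolded One_nat_def] schur_fun_column_0 algebra_simps)
  have h30: "schur_fun (Suc N) (hook 3 0) = ?h 3 0 + ?x * ?h 2 0 + ?x ^ 2 * ?e 1 + ?x ^ 3"
    by (simp add: schur_fun_Suc_hook_0 r hook_0 hook_1[unfolded One_nat_def] schur_fun_column_0 algebra_simps)
  have h3: "schur_fun (Suc N) (hook 3 (Suc k)) = ?h 3 (Suc k) + ?x * ?h 2 (Suc k) + ?x ^ 2 * ?e (Suc (Suc k)) +
      ?x * ?h 3 k + ?x ^ 2 * ?h 2 k + ?x ^ 3 * ?e (Suc k)" for k
    by (simp add: schur_fun_Suc_hook r hook_1[unfolded One_nat_def] algebra_simps)
  have b0: "schur_fun (Suc N) (fat_hook 2 0) = ?b 0 + ?x * ?h 2 1 + ?x ^ 2 * ?h 2 0"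
    by (simp add: schur_fun_Suc_fat_hook_0 r fat_hook_0 fat_hook_1[unfolded One_nat_def] algebra_simps)
  have b: "schur_fun (Suc N) (fat_hook 2 (Suc k)) =
      ?b (Suc k) + ?x * ?h 2 (Suc (Suc k)) + ?x * ?b k + ?x ^ 2 * ?h 2 (Suc k)" for k
    by (simp add: schur_fun_Suc_fat_hook r fat_hook_1[unfolded One_nat_def] algebra_simps)
  have e0: "schur_fun M (column 0) = 1" for M by (rule schur_fun_column_0)
  have I0: "psum N 2 + ?e (Suc (Suc 0)) = ?h 2 0"
    using Suc.IH[of 0] by (simp add: e0)
  have I1: "psum N 2 * ?e (Suc 0) + ?e (Suc (Suc (Suc 0))) = ?h 3 0"
    using Suc.IH[of "Suc 0"] by simp
  have I2: "psum N 2 * ?e (Suc (Suc k)) + ?e (Suc (Suc (Suc (Suc k)))) = ?h 3 (Suc k) - ?b k" for k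
    using Suc.IH[of "Suc (Suc k)"] by simp
  let ?L = "psum (Suc N) 2 * schur_fun (Suc N) (column m) + schur_fun (Suc N) (column (Suc (Suc m)))"
  \<comment> \<open>A new variable brings in the claim for \<open>m - 1\<close>, so
    \<open>m = 2\<close> stands apart as well: its predecessor still has the short form.\<close>
  consider "m = 0" | "m = Suc 0" | "m = Suc (Suc 0)" | k where "m = Suc (Suc (Suc k))"
    by (metis old.nat.exhaust)
  then show ?case
  proof cases
    case 1
    have "?L = (psum N 2 + ?e (Suc (Suc 0))) + ?x * ?e (Suc 0) + ?x ^ 2"
      by (simp add: 1 e p e0 algebra_simps)
    then show ?thesis using 1 by (simp add: h20 I0)
  next
    case 2
    have "?L = (psum N 2 * ?e (Suc 0) + ?e (Suc (Suc (Suc 0)))) + ?x * (psum N 2 + ?e (Suc (Suc 0))) +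
        ?x ^ 2 * ?e (Suc 0) + ?x ^ 3"
      unfolding 2 e p by (simp add: e0 algebra_simps power2_eq_square power3_eq_cube)
    then show ?thesis using 2 by (simp add: h30 I0 I1)
  next
    case 3
    have "?L = (psum N 2 * ?e (Suc (Suc 0)) + ?e (Suc (Suc (Suc (Suc 0))))) +
        ?x * (psum N 2 * ?e (Suc 0) + ?e (Suc (Suc (Suc 0)))) + ?x ^ 2 * ?e (Suc (Suc 0)) + ?x ^ 3 * ?e (Suc 0)"
      unfolding 3 e p by (simp add: algebra_simps power2_eq_square power3_eq_cube)
    also have "\<dots> = schur_fun (Suc N) (hook 3 (Suc 0)) - schur_fun (Suc N) (fat_hook 2 0)"
      unfolding I2 I1 h3 b0 by (simp add: algebra_simps)
    finally show ?thesis using 3 by simp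
  next
    case (4 k)
    have "?L = (psum N 2 * ?e (Suc (Suc (Suc k))) + ?e (Suc (Suc (Suc (Suc (Suc k)))))) +
        ?x * (psum N 2 * ?e (Suc (Suc k)) + ?e (Suc (Suc (Suc (Suc k))))) +
        ?x ^ 2 * ?e (Suc (Suc (Suc k))) + ?x ^ 3 * ?e (Suc (Suc k))"
      unfolding 4 e p by (simp add: algebra_simps power2_eq_square power3_eq_cube)
    also have "\<dots> = schur_fun (Suc N) (hook 3 (Suc (Suc k))) - schur_fun (Suc N) (fat_hook 2 (Suc k))"
      unfolding I2 h3 b by (simp add: algebra_simps)
    finally show ?thesis using 4 by simp
  qed
qed

section \<open>Growing standard tableaux\<close>

text \<open>Rows beyond the last are empty, which removes the index bounds from the shape
  conditions.\<close>

definition row :: "'a list list \<Rightarrow> nat \<Rightarrow> 'a list" where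
  "row Q i = (if i < length Q then Q ! i else [])"

definition append_box :: "'a list list \<Rightarrow> nat \<Rightarrow> 'a \<Rightarrow> 'a list list" where
  "append_box Q r x = (if r < length Q then Q[r := Q ! r @ [x]] else Q @ [[x]])"

lemma row_append_box:
  "r \<le> length Q \<Longrightarrow> row (append_box Q r x) i = (if i = r then row Q i @ [x] else row Q i)"
  by (auto simp: row_def append_box_def nth_append)

lemma row_len_shape: "row_len (shape Q) i = length (row Q i)"
  by (simp add: row_len_def shape_def row_def)

lemma std_tableau_iff:
  "std_tableau n Q \<longleftrightarrow> (\<forall>i<length Q. row Q i \<noteq> []) \<and>
     (\<forall>i. length (row Q (Suc i)) \<le> length (row Q i)) \<and>
     (\<forall>i. sorted_wrt (<) (row Q i)) \<and>
     (\<forall>i j. j < length (row Q (Suc i)) \<longrightarrow> row Q i ! j < row Q (Suc i) ! j) \<and>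
     mset (concat Q) = mset [1..<Suc n]"
proof -
  have "(\<forall>r\<in>set Q. r \<noteq> []) \<longleftrightarrow> (\<forall>i<length Q. row Q i \<noteq> [])"
    by (auto simp: row_def all_set_conv_all_nth)
  moreover have "(\<forall>i. Suc i < length Q \<longrightarrow> length (Q ! Suc i) \<le> length (Q ! i)) \<longleftrightarrow>
      (\<forall>i. length (row Q (Suc i)) \<le> length (row Q i))"
    by (auto simp: row_def)
  moreover have "(\<forall>r\<in>set Q. sorted_wrt (<) r) \<longleftrightarrow> (\<forall>i. sorted_wrt (<) (row Q i))"
    by (auto simp: row_def all_set_conv_all_nth)
  moreover have "(\<forall>i j. Suc i < length Q \<and> j < length (Q ! Suc i) \<longrightarrow> Q ! i ! j < Q ! Suc i ! j) \<longleftrightarrow>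
      (\<forall>i j. j < length (row Q (Suc i)) \<longrightarrow> row Q i ! j < row Q (Suc i) ! j)"
    by (auto simp: row_def)
  ultimately show ?thesis unfolding std_tableau_def by simp
qed

context
  fixes n Q
  assumes std: "std_tableau n Q"
begin

lemma row_nonempty: "i < length Q \<Longrightarrow> row Q i \<noteq> []"
  using std by (simp add: std_tableau_iff)

lemma length_row_mono: "length (row Q (Suc i)) \<le> length (row Q i)"
  using std by (simp add: std_tableau_iff)

lemma sorted_row: "sorted_wrt (<) (row Q i)"
  using std by (simp add: std_tableau_iff)

lemma column_less: "j < length (row Q (Suc i)) \<Longrightarrow> row Q i ! j < row Q (Suc i) ! j"
  using std by (simp add: std_tableau_iff)

lemma mset_entries: "mset (concat Q) = mset [1..<Suc n]"
  using std by (simp add: std_tableau_iff)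

lemma set_concat_std: "set (concat Q) = {1..n}"
proof -
  have "set (concat Q) = set [1..<Suc n]"
    using mset_entries by (metis set_mset_mset)
  then show ?thesis by auto
qed

lemma row_entries: "x \<in> set (row Q i) \<Longrightarrow> 1 \<le> x \<and> x \<le> n"
  using set_concat_std by (force simp: row_def split: if_splits)

lemma partition_fun_shape: "partition_fun (row_len (shape Q))"
proof -
  have "{i. row_len (shape Q) i \<noteq> 0} \<subseteq> {..<length Q}"
    by (auto simp: row_len_shape row_def split: if_splits)
  then have "finite {i. row_len (shape Q) i \<noteq> 0}" by (rule finite_subset) simp
  then show ?thesis using length_row_mono by (simp add: partition_fun_def row_len_shape)
qed

lemma addable_le_length:
  assumes "r \<in> addable (row_len (shape Q))" shows "r \<le> length Q"
proof (rule ccontr)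
  assume "\<not> r \<le> length Q"
  then show False using assms by (auto simp: addable_def row_len_shape row_def split: if_splits)
qed

end

lemma mset_concat_append_box: "mset (concat (append_box Q r x)) = add_mset x (mset (concat Q))"
proof (cases "r < length Q")
  case True
  have "mset (concat Q) = mset (concat (take r Q @ Q ! r # drop (Suc r) Q))"
    using id_take_nth_drop[OF True] by simp
  then show ?thesis using True by (simp add: append_box_def upd_conv_take_nth_drop)
qed (simp add: append_box_def)

lemma row_len_append_box:
  assumes "r \<le> length Q"
  shows "row_len (shape (append_box Q r x)) = add_box (row_len (shape Q)) r"
  using assms by (simp add: fun_eq_iff row_len_shape row_append_box add_box_apply)

lemma std_tableau_append_box:
  assumes std: "std_tableau n Q" and r: "r \<in> addable (row_len (shape Q))"
  shows "std_tableau (Suc n) (append_box Q r (Suc n))"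
proof -
  have rl: "r \<le> length Q" by (rule addable_le_length[OF std r])
  note row = row_append_box[OF rl, of "Suc n"]
  let ?Q = "append_box Q r (Suc n)"
  have add: "length (row Q r) < length (row Q i)" if "r = Suc i" for i
    using r that by (auto simp: addable_def row_len_shape)
  have "row ?Q i \<noteq> []" if "i < length ?Q" for i
    using row_nonempty[OF std, of i] that rl unfolding row
    by (cases "r < length Q") (auto simp: append_box_def split: if_splits)
  moreover have "length (row ?Q (Suc i)) \<le> length (row ?Q i)" for i
    unfolding row using length_row_mono[OF std, of i] add[of i] by auto
  moreover have "sorted_wrt (<) (row ?Q i)" for i
    unfolding row using sorted_row[OF std, of i] row_entries[OF std, of _ i]
    by (auto simp: sorted_wrt_append less_Suc_eq_le)
  moreover have "row ?Q i ! j < row ?Q (Suc i) ! j" if j: "j < length (row ?Q (Suc i))" for i j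
  proof (cases "Suc i = r \<and> j = length (row Q r)")
    case True
    then have "j < length (row Q i)" using add[of i] by auto
    then have "row Q i ! j \<le> n" using row_entries[OF std, of "row Q i ! j" i] by simp
    then show ?thesis using True \<open>j < length (row Q i)\<close> unfolding row by (auto simp: nth_append)
  next
    case False
    then have "j < length (row Q (Suc i))" using j unfolding row by (auto split: if_splits)
    moreover from this have "j < length (row Q i)" using length_row_mono[OF std, of i] by simp
    ultimately show ?thesis
      using column_less[OF std, of j i] unfolding row by (auto simp: nth_append)
  qed
  moreover have "mset (concat ?Q) = mset [1..<Suc (Suc n)]"
    using mset_entries[OF std] by (simp add: mset_concat_append_box)
  ultimately show ?thesis unfolding std_tableau_iff by blast
qed

section \<open>Removing the largest entry\<close>

definition delete_entry :: "'a \<Rightarrow> 'a list list \<Rightarrow> 'a list list" where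
  "delete_entry x Q = filter (\<lambda>r. r \<noteq> []) (map (filter (\<lambda>y. y \<noteq> x)) Q)"

text \<open>Stated for any filter because it serves both \<open>delete_entry\<close> and
  \<open>restrict4\<close>.\<close>

lemma filter_rows_append_box:
  "\<not> p x \<Longrightarrow> filter (\<lambda>r. r \<noteq> []) (map (filter p) (append_box Q r x)) =
    filter (\<lambda>r. r \<noteq> []) (map (filter p) Q)"
proof (cases "r < length Q")
  case True
  assume p: "\<not> p x"
  have "filter (\<lambda>r. r \<noteq> []) (map (filter p) Q) =
      filter (\<lambda>r. r \<noteq> []) (map (filter p) (take r Q @ Q ! r # drop (Suc r) Q))"
    using id_take_nth_drop[OF True] by simp
  then show ?thesis using True p by (simp add: append_box_def upd_conv_take_nth_drop)
qed (simp add: append_box_def)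

lemma filter_rows_id:
  assumes std: "std_tableau n Q" and "\<And>y. 1 \<le> y \<Longrightarrow> y \<le> n \<Longrightarrow> p y"
  shows "filter (\<lambda>r. r \<noteq> []) (map (filter p) Q) = Q"
proof -
  have "filter p r = r" if "r \<in> set Q" for r
  proof (intro filter_True ballI)
    fix y assume "y \<in> set r"
    then have "y \<in> set (concat Q)" using that by auto
    then have "y \<in> {1..n}" by (simp only: set_concat_std[OF std])
    then show "p y" using assms(2) by simp
  qed
  then have "map (filter p) Q = Q" by (simp add: map_idI)
  moreover have "filter (\<lambda>r. r \<noteq> []) Q = Q"
    using std by (intro filter_True) (simp add: std_tableau_def)
  ultimately show ?thesis by simp
qed

lemma delete_append_box:
  assumes "std_tableau n Q"
  shows "delete_entry (Suc n) (append_box Q r (Suc n)) = Q"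
  unfolding delete_entry_def
  by (subst filter_rows_append_box) (auto intro!: filter_rows_id[OF assms])

lemma row_of_eq: "row_of Q i = (LEAST r. i \<in> set (row Q r))"
proof -
  have "r < length Q \<and> i \<in> set (Q ! r) \<longleftrightarrow> i \<in> set (row Q r)" for r
    by (auto simp: row_def)
  then show ?thesis by (simp add: row_of_def)
qed

lemma row_of_append_box_new:
  assumes "std_tableau n Q" "r \<le> length Q"
  shows "row_of (append_box Q r (Suc n)) (Suc n) = r"
proof -
  have "Suc n \<in> set (row (append_box Q r (Suc n)) s) \<longleftrightarrow> s = r" for s
    using row_entries[OF assms(1), of "Suc n" s] by (auto simp: row_append_box[OF assms(2)])
  then show ?thesis by (auto simp: row_of_eq intro!: Least_equality)
qed

lemma row_of_append_box_old:
  assumes "i \<noteq> x" "r \<le> length Q"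
  shows "row_of (append_box Q r x) i = row_of Q i"
proof -
  have "i \<in> set (row (append_box Q r x) s) \<longleftrightarrow> i \<in> set (row Q s)" for s
    using assms by (auto simp: row_append_box)
  then show ?thesis by (simp add: row_of_eq)
qed

text \<open>The largest entry ends its row, and the row beneath is strictly shorter since nothing
  larger could stand below it; so it occupies a removable corner.\<close>

lemma std_tableau_Suc_cases:
  assumes std: "std_tableau (Suc n) Q"
  obtains Q' r where "std_tableau n Q'" "r \<in> addable (row_len (shape Q'))" "Q = append_box Q' r (Suc n)"
proof -
  let ?x = "Suc n"
  have "?x \<in> set (concat Q)" using set_concat_std[OF std] by simp
  then obtain R where "R \<in> set Q" "?x \<in> set R" by auto
  then obtain r where r: "r < length Q" "?x \<in> set (row Q r)"
    by (metis in_set_conv_nth row_def)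
  let ?R = "row Q r"
  obtain j where j: "j < length ?R" "?R ! j = ?x" using r(2) by (auto simp: in_set_conv_nth)
  have last: "Suc j = length ?R"
  proof (rule ccontr)
    assume "Suc j \<noteq> length ?R"
    then have "Suc j < length ?R" using j by simp
    then have "?R ! j < ?R ! Suc j" "?R ! Suc j \<le> ?x"
      using sorted_row[OF std, of r] row_entries[OF std, of "?R ! Suc j" r]
      by (auto simp: sorted_wrt_iff_nth_less)
    then show False using j by simp
  qed
  have R: "?R = butlast ?R @ [?x]"
    using j last by (metis append_butlast_last_id last_conv_nth diff_Suc_1 length_0_conv less_nat_zero_code)
  have below: "length (row Q (Suc r)) < length ?R"
  proof (rule ccontr)
    assume "\<not> length (row Q (Suc r)) < length ?R"
    then have jl: "j < length (row Q (Suc r))" using j by simp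
    from column_less[OF std jl] row_entries[OF std nth_mem[OF jl]] j show False by simp
  qed
  \<comment> \<open>Empty rows are not allowed, so a row that held only the largest entry is
    dropped; such a row is the last one.\<close>
  define Q' where "Q' = (if butlast ?R = [] then butlast Q else Q[r := butlast ?R])"
  have end_row: "Suc r = length Q" "Q = butlast Q @ [[?x]]" if e: "butlast ?R = []"
  proof -
    have R1: "?R = [?x]" using R e by simp
    then have "row Q (Suc r) = []" using below by simp
    then show l: "Suc r = length Q" using row_nonempty[OF std, of "Suc r"] r(1) by linarith
    then show "Q = butlast Q @ [[?x]]"
      using R1 r(1) by (metis append_butlast_last_id diff_Suc_1 last_conv_nth length_0_conv less_nat_zero_code row_def)
  qed
  have len: "length Q' = (if butlast ?R = [] then r else length Q)"
    using end_row by (auto simp: Q'_def)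
  then have rl: "r \<le> length Q'" using r by auto
  have row': "row Q' i = (if i = r then butlast ?R else row Q i)" for i
  proof (cases "butlast ?R = []")
    case True
    then show ?thesis using end_row(1)[OF True] by (auto simp: Q'_def row_def nth_butlast)
  next
    case False
    then show ?thesis using r by (auto simp: Q'_def row_def)
  qed
  have Q: "Q = append_box Q' r ?x"
  proof (cases "butlast ?R = []")
    case True
    then show ?thesis using end_row[OF True] len by (simp add: append_box_def Q'_def)
  next
    case False
    then show ?thesis using r R len by (simp add: append_box_def Q'_def row_def)
  qed
  have "row Q' i \<noteq> []" if "i < length Q'" for i
    using that len row_nonempty[OF std, of i] r(1) unfolding row' by (auto split: if_splits)
  moreover have "length (row Q' (Suc i)) \<le> length (row Q' i)" for i
    unfolding row' using length_row_mono[OF std, of i] below by auto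
  moreover have "sorted_wrt (<) (row Q' i)" for i
  proof -
    have "sorted_wrt (<) (butlast ?R @ [?x])" using sorted_row[OF std, of r] R by simp
    then have "sorted_wrt (<) (butlast ?R)" by (simp add: sorted_wrt_append)
    then show ?thesis unfolding row' using sorted_row[OF std, of i] by simp
  qed
  moreover have "row Q' i ! j < row Q' (Suc i) ! j" if "j < length (row Q' (Suc i))" for i j
  proof -
    have "j < length (row Q (Suc i))" "j < length (row Q' i)"
      using that \<open>length (row Q' (Suc i)) \<le> length (row Q' i)\<close> by (auto simp: row' split: if_splits)
    then show ?thesis
      using column_less[OF std, of j i] that by (auto simp: row' nth_butlast split: if_splits)
  qed
  moreover have "mset (concat Q') = mset [1..<Suc n]"
    using mset_entries[OF std] by (subst (asm) Q) (simp add: mset_concat_append_box)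
  ultimately have "std_tableau n Q'" unfolding std_tableau_iff by blast
  moreover have "r \<in> addable (row_len (shape Q'))"
  proof (cases r)
    case (Suc i)
    have "0 < length ?R" using j(1) by (rule le_less_trans[OF le0])
    moreover have "length ?R \<le> length (row Q i)" using length_row_mono[OF std, of i] Suc by simp
    ultimately have "length ?R - 1 < length (row Q i)" by linarith
    then show ?thesis using Suc by (simp add: addable_def row_len_shape row')
  qed (simp add: addable_def)
  ultimately show thesis using that Q by blast
qed

definition std_tableaux :: "nat \<Rightarrow> nat list list set" where
  "std_tableaux n = {Q. std_tableau n Q}"

lemma std_tableaux_0: "std_tableaux 0 = {[]}"
proof -
  have "std_tableau 0 Q \<longleftrightarrow> Q = []" for Q
    by (cases Q) (auto simp: std_tableau_def)
  then show ?thesis by (simp add: std_tableaux_def)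
qed

text \<open>Injective because deleting the largest entry recovers the tableau and the row of that
  entry recovers \<open>r\<close>.\<close>

lemma bij_betw_append_box:
  "bij_betw (\<lambda>(Q, r). append_box Q r (Suc n))
     (SIGMA Q:std_tableaux n. addable (row_len (shape Q))) (std_tableaux (Suc n))"
proof (rule bij_betwI')
  fix p q
  assume p: "p \<in> (SIGMA Q:std_tableaux n. addable (row_len (shape Q)))"
    and q: "q \<in> (SIGMA Q:std_tableaux n. addable (row_len (shape Q)))"
  obtain Q r Q' r' where pq: "p = (Q, r)" "q = (Q', r')" by (cases p, cases q)
  have *: "std_tableau n Q" "r \<in> addable (row_len (shape Q))"
      "std_tableau n Q'" "r' \<in> addable (row_len (shape Q'))"
    using p q pq by (auto simp: std_tableaux_def)
  show "((case p of (Q, r) \<Rightarrow> append_box Q r (Suc n)) = (case q of (Q, r) \<Rightarrow> append_box Q r (Suc n))) = (p = q)"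
    using delete_append_box[OF *(1), of r] delete_append_box[OF *(3), of r']
      row_of_append_box_new[OF *(1) addable_le_length[OF *(1,2)]]
      row_of_append_box_new[OF *(3) addable_le_length[OF *(3,4)]] pq by auto
next
  fix p assume "p \<in> (SIGMA Q:std_tableaux n. addable (row_len (shape Q)))"
  then show "(case p of (Q, r) \<Rightarrow> append_box Q r (Suc n)) \<in> std_tableaux (Suc n)"
    by (auto simp: std_tableaux_def std_tableau_append_box)
next
  fix Q assume "Q \<in> std_tableaux (Suc n)"
  then have "std_tableau (Suc n) Q" by (simp add: std_tableaux_def)
  then obtain Q' r where "std_tableau n Q'" "r \<in> addable (row_len (shape Q'))" "Q = append_box Q' r (Suc n)"
    by (rule std_tableau_Suc_cases)
  then show "\<exists>p\<in>(SIGMA Q:std_tableaux n. addable (row_len (shape Q))). Q = (case p of (Q, r) \<Rightarrow> append_box Q r (Suc n))"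
    by (intro bexI[of _ "(Q', r)"]) (auto simp: std_tableaux_def)
qed

lemma finite_addable_shape: "Q \<in> std_tableaux n \<Longrightarrow> finite (addable (row_len (shape Q)))"
  by (auto simp: std_tableaux_def intro: finite_addable partition_fun_shape)

lemma finite_std_tableaux: "finite (std_tableaux n)"
proof (induction n)
  case (Suc n)
  then have "finite (SIGMA Q:std_tableaux n. addable (row_len (shape Q)))"
    by (intro finite_SigmaI finite_addable_shape)
  then show ?case using bij_betw_append_box bij_betw_finite by blast
qed (simp add: std_tableaux_0)

lemma sum_std_tableaux_Suc:
  "(\<Sum>Q\<in>std_tableaux (Suc n). w Q) =
    (\<Sum>Q\<in>std_tableaux n. \<Sum>r\<in>addable (row_len (shape Q)). w (append_box Q r (Suc n)))"
proof -
  have "(\<Sum>Q\<in>std_tableaux n. \<Sum>r\<in>addable (row_len (shape Q)). w (append_box Q r (Suc n))) =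
      (\<Sum>(Q, r)\<in>(SIGMA Q:std_tableaux n. addable (row_len (shape Q))). w (append_box Q r (Suc n)))"
    using finite_std_tableaux finite_addable_shape by (intro sum.Sigma) auto
  also have "\<dots> = (\<Sum>p\<in>(SIGMA Q:std_tableaux n. addable (row_len (shape Q))).
      w (case p of (Q, r) \<Rightarrow> append_box Q r (Suc n)))"
    by (intro sum.cong) auto
  also have "\<dots> = (\<Sum>Q\<in>std_tableaux (Suc n). w Q)"
    by (rule sum.reindex_bij_betw[OF bij_betw_append_box])
  finally show ?thesis by simp
qed

section \<open>First ascents under growth\<close>

definition first_ascent :: "nat \<Rightarrow> nat \<Rightarrow> nat list list \<Rightarrow> nat" where
  "first_ascent k n Q = (LEAST i. k \<le> i \<and> is_ascent n Q i)"

text \<open>The case in which the first ascent is \<open>n\<close> only by the convention that the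
  last entry is an ascent.\<close>

definition descends_from :: "nat \<Rightarrow> nat \<Rightarrow> nat list list \<Rightarrow> bool" where
  "descends_from k n Q \<longleftrightarrow> (\<forall>i. k \<le> i \<and> i < n \<longrightarrow> \<not> is_ascent n Q i)"

lemma is_ascent_last: "1 \<le> n \<Longrightarrow> is_ascent n Q n"
  by (simp add: is_ascent_def)

lemma first_ascent_descends:
  assumes "1 \<le> k" "k \<le> n" "descends_from k n Q"
  shows "first_ascent k n Q = n"
  unfolding first_ascent_def
proof (rule Least_equality)
  show "k \<le> n \<and> is_ascent n Q n" using assms is_ascent_last by simp
  fix i assume "k \<le> i \<and> is_ascent n Q i"
  then show "n \<le> i" using assms(3) unfolding descends_from_def by (meson not_le)
qed

context
  fixes n Q r
  assumes std: "std_tableau n Q" and r: "r \<in> addable (row_len (shape Q))"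
begin

lemma is_ascent_append_box:
  assumes "i < n"
  shows "is_ascent (Suc n) (append_box Q r (Suc n)) i \<longleftrightarrow> is_ascent n Q i"
  using assms addable_le_length[OF std r] by (auto simp: is_ascent_def row_of_append_box_old)

lemma is_ascent_append_box_n:
  assumes "1 \<le> n"
  shows "is_ascent (Suc n) (append_box Q r (Suc n)) n \<longleftrightarrow> r \<le> row_of Q n"
  using assms addable_le_length[OF std r]
  by (auto simp: is_ascent_def row_of_append_box_old row_of_append_box_new[OF std])

lemma descends_from_append_box:
  assumes "1 \<le> k" "k \<le> n"
  shows "descends_from k (Suc n) (append_box Q r (Suc n)) \<longleftrightarrow> descends_from k n Q \<and> row_of Q n < r"
proof -
  let ?A = "is_ascent (Suc n) (append_box Q r (Suc n))"
  have "descends_from k (Suc n) (append_box Q r (Suc n)) \<longleftrightarrow>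
      (\<forall>i. k \<le> i \<and> i < n \<longrightarrow> \<not> ?A i) \<and> \<not> ?A n"
    unfolding descends_from_def using assms(2) less_Suc_eq by blast
  also have "(\<forall>i. k \<le> i \<and> i < n \<longrightarrow> \<not> ?A i) \<longleftrightarrow> descends_from k n Q"
    unfolding descends_from_def using is_ascent_append_box by blast
  also have "\<not> ?A n \<longleftrightarrow> row_of Q n < r"
    using is_ascent_append_box_n assms by (simp add: not_le)
  finally show ?thesis .
qed

text \<open>Ascents below \<open>n\<close> are unaffected, but \<open>n\<close> loses its
  conventional status once \<open>Suc n\<close> is present and then counts only if the new entry is
  not placed lower.\<close>

lemma first_ascent_append_box:
  assumes k: "1 \<le> k" "k \<le> n"
  shows "first_ascent k (Suc n) (append_box Q r (Suc n)) =
    (if descends_from k n Q \<and> row_of Q n < r then Suc n else first_ascent k n Q)"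
proof -
  let ?Q = "append_box Q r (Suc n)"
  consider "descends_from k n Q" "row_of Q n < r" | "descends_from k n Q" "\<not> row_of Q n < r"
    | "\<not> descends_from k n Q" by blast
  then show ?thesis
  proof cases
    case 1
    then have "descends_from k (Suc n) ?Q" using descends_from_append_box[OF k] by simp
    then show ?thesis using 1 k first_ascent_descends[of k "Suc n" ?Q] by simp
  next
    case 2
    have "first_ascent k (Suc n) ?Q = n"
      unfolding first_ascent_def
    proof (rule Least_equality)
      show "k \<le> n \<and> is_ascent (Suc n) ?Q n" using 2 k is_ascent_append_box_n by simp
      fix i assume i: "k \<le> i \<and> is_ascent (Suc n) ?Q i"
      show "n \<le> i"
      proof (rule ccontr)
        assume "\<not> n \<le> i"
        then show False using i 2 is_ascent_append_box[of i] unfolding descends_from_def by auto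
      qed
    qed
    then show ?thesis using 2 first_ascent_descends[OF k] by simp
  next
    case 3
    then obtain i where i: "k \<le> i" "i < n" "is_ascent n Q i" by (auto simp: descends_from_def)
    let ?m = "first_ascent k n Q"
    have m: "k \<le> ?m \<and> is_ascent n Q ?m"
      unfolding first_ascent_def by (rule LeastI[of _ i]) (use i in simp)
    have "?m \<le> i" unfolding first_ascent_def by (rule Least_le) (use i in simp)
    have "first_ascent k (Suc n) ?Q = ?m"
      unfolding first_ascent_def[of k "Suc n"]
    proof (rule Least_equality)
      show "k \<le> ?m \<and> is_ascent (Suc n) ?Q ?m"
        using m is_ascent_append_box[of ?m] \<open>?m \<le> i\<close> i by simp
      fix y assume y: "k \<le> y \<and> is_ascent (Suc n) ?Q y"
      show "?m \<le> y"
      proof (rule ccontr)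
        assume "\<not> ?m \<le> y"
        moreover from this have "y < n" using \<open>?m \<le> i\<close> i by simp
        then have "is_ascent n Q y" using y is_ascent_append_box by simp
        then have "?m \<le> y" unfolding first_ascent_def by (intro Least_le) (use y in simp)
        ultimately show False by simp
      qed
    qed
    then show ?thesis using 3 by simp
  qed
qed

end

section \<open>Schur-weighted sums over tableaux\<close>

definition tab_sum :: "nat \<Rightarrow> nat \<Rightarrow> (nat list list \<Rightarrow> bool) \<Rightarrow> cpoly" where
  "tab_sum N n c = (\<Sum>Q\<in>std_tableaux n. if c Q then schur N (shape Q) else 0)"

lemma tab_sum_eq: "tab_sum N n c = (\<Sum>Q\<in>{Q. std_tableau n Q \<and> c Q}. schur N (shape Q))"
proof -
  have "{Q. std_tableau n Q \<and> c Q} = {Q\<in>std_tableaux n. c Q}" by (simp add: std_tableaux_def)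
  then show ?thesis unfolding tab_sum_def using finite_std_tableaux by (simp only: sum.inter_filter)
qed

lemma schur_append_box:
  assumes "std_tableau n Q" "r \<in> addable (row_len (shape Q))"
  shows "schur N (shape (append_box Q r x)) = schur_fun N (add_box (row_len (shape Q)) r)"
  using addable_le_length[OF assms] by (simp add: schur_eq_schur_fun row_len_append_box)

lemma psum_mult_schur_shape:
  assumes "std_tableau n Q"
  shows "psum N 1 * schur N (shape Q) =
    (\<Sum>r\<in>addable (row_len (shape Q)). schur N (shape (append_box Q r (Suc n))))"
proof -
  have "psum N 1 * schur N (shape Q) =
      (\<Sum>r\<in>addable (row_len (shape Q)). schur_fun N (add_box (row_len (shape Q)) r))"
    unfolding schur_eq_schur_fun by (rule schur_fun_Pieri[OF partition_fun_shape[OF assms]])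
  then show ?thesis by (simp add: schur_append_box[OF assms] cong: sum.cong)
qed

lemma psum_mult_tab_sum:
  "psum N 1 * tab_sum N n c = (\<Sum>Q\<in>std_tableaux n. \<Sum>r\<in>addable (row_len (shape Q)).
     if c Q then schur N (shape (append_box Q r (Suc n))) else 0)"
  unfolding tab_sum_def sum_distrib_left
proof (rule sum.cong[OF refl])
  fix Q assume "Q \<in> std_tableaux n"
  then have "std_tableau n Q" by (simp add: std_tableaux_def)
  then show "psum N 1 * (if c Q then schur N (shape Q) else 0) =
     (\<Sum>r\<in>addable (row_len (shape Q)). if c Q then schur N (shape (append_box Q r (Suc n))) else 0)"
    by (cases "c Q") (simp_all add: psum_mult_schur_shape[unfolded One_nat_def])
qed

text \<open>Meant for conditions read off from the entries up to \<open>k\<close>, which are frozen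
  as the tableau grows further.\<close>

definition append_stable :: "nat \<Rightarrow> (nat list list \<Rightarrow> bool) \<Rightarrow> bool" where
  "append_stable k R \<longleftrightarrow> (\<forall>n\<ge>k. \<forall>Q r. R (append_box Q r (Suc n)) = R Q)"

lemma tab_sum_Suc:
  assumes "append_stable k R" "k \<le> n"
  shows "tab_sum N (Suc n) R = psum N 1 * tab_sum N n R"
proof -
  have "R (append_box Q r (Suc n)) = R Q" for Q r
    using assms by (simp add: append_stable_def)
  then show ?thesis
    unfolding psum_mult_tab_sum unfolding tab_sum_def sum_std_tableaux_Suc by (simp only:)
qed

text \<open>The first ascent from \<open>k\<close> on is unaffected by a new entry \<open>n + 1\<close>, unless that entry
  prolongs a descending run \<open>k, \<dots>, n\<close>; then it moves from \<open>n\<close> to \<open>n + 1\<close> and changes parity.\<close>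

lemma tab_sum_parity_Suc:
  assumes R: "append_stable k R" and k: "1 \<le> k" "k \<le> n"
  shows "tab_sum N (Suc n) (\<lambda>Q. R Q \<and> even (first_ascent k (Suc n) Q) = b) =
    psum N 1 * tab_sum N n (\<lambda>Q. R Q \<and> even (first_ascent k n Q) = b) +
    (if even (Suc n) = b then 1 else - 1) * tab_sum N (Suc n) (\<lambda>Q. R Q \<and> descends_from k (Suc n) Q)"
  unfolding psum_mult_tab_sum unfolding tab_sum_def sum_std_tableaux_Suc sum_distrib_left sum.distrib[symmetric]
proof (intro sum.cong refl)
  fix Q r assume "Q \<in> std_tableaux n" and r: "r \<in> addable (row_len (shape Q))"
  then have std: "std_tableau n Q" by (simp add: std_tableaux_def)
  note fa = first_ascent_append_box[OF std r k] descends_from_append_box[OF std r k]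
  have RQ: "R (append_box Q r (Suc n)) = R Q" using R k by (simp add: append_stable_def)
  show "(if R (append_box Q r (Suc n)) \<and> even (first_ascent k (Suc n) (append_box Q r (Suc n))) = b
      then schur N (shape (append_box Q r (Suc n))) else 0) =
    (if R Q \<and> even (first_ascent k n Q) = b then schur N (shape (append_box Q r (Suc n))) else 0) +
    (if even (Suc n) = b then 1 else - 1) *
    (if R (append_box Q r (Suc n)) \<and> descends_from k (Suc n) (append_box Q r (Suc n))
      then schur N (shape (append_box Q r (Suc n))) else 0)"
    \<comment> \<open>Only along a descending run do the two parities differ: the first ascent is
      \<open>n\<close> before and \<open>Suc n\<close> after, so exactly one of the two conditions
      holds and the correction is 1 or -1.\<close>
    unfolding fa RQ using first_ascent_descends[OF k, of Q]
    by (cases "descends_from k n Q \<and> row_of Q n < r") auto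
qed

text \<open>\<open>F\<close> and \<open>\<rho>\<close> prescribe the shape and the row of the newest
  entry. That row is the last nonempty one, so the only admissible place strictly below it is a
  fresh row, and each step of the run is forced.\<close>

lemma descending_tableau_unique:
  assumes R: "append_stable k R" and k: "1 \<le> k" and n: "k \<le> n"
    and T: "{Q\<in>std_tableaux k. R Q} = {T}" "row_len (shape T) = F k" "row_of T k = \<rho> k"
    and F: "\<And>n. k \<le> n \<Longrightarrow> F (Suc n) = add_box (F n) (Suc (\<rho> n))"
      "\<And>n. k \<le> n \<Longrightarrow> \<rho> (Suc n) = Suc (\<rho> n)"
      "\<And>n i. k \<le> n \<Longrightarrow> F n i = 0 \<longleftrightarrow> \<rho> n < i"
  shows "\<exists>C. {Q\<in>std_tableaux n. R Q \<and> descends_from k n Q} = {C} \<and>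
    row_len (shape C) = F n \<and> row_of C n = \<rho> n"
  using n
proof (induction n rule: dec_induct)
  case base
  have "{Q\<in>std_tableaux k. R Q \<and> descends_from k k Q} = {Q\<in>std_tableaux k. R Q}"
    by (auto simp: descends_from_def)
  then show ?case using T by auto
next
  case (step n)
  then obtain C where C: "{Q\<in>std_tableaux n. R Q \<and> descends_from k n Q} = {C}"
    "row_len (shape C) = F n" "row_of C n = \<rho> n" by blast
  have kn: "k \<le> n" using step by simp
  have C': "std_tableau n C" "R C" "descends_from k n C" using C(1) by (auto simp: std_tableaux_def)
  have add: "i \<in> addable (F n) \<and> \<rho> n < i \<longleftrightarrow> i = Suc (\<rho> n)" for i
    using F(3)[OF kn, of i] F(3)[OF kn, of "i - 1"] by (cases i) (auto simp: addable_def)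
  let ?C = "append_box C (Suc (\<rho> n)) (Suc n)"
  have r: "Suc (\<rho> n) \<in> addable (row_len (shape C))" using add[of "Suc (\<rho> n)"] C(2) by simp
  have RR: "R (append_box Q r (Suc n)) = R Q" for Q r
    using R kn by (simp add: append_stable_def)
  have "std_tableau (Suc n) ?C" "R ?C" "descends_from k (Suc n) ?C"
    using std_tableau_append_box[OF C'(1) r] RR C' descends_from_append_box[OF C'(1) r k kn] C(3) by simp_all
  moreover have "Q = ?C" if Q: "std_tableau (Suc n) Q" "R Q" "descends_from k (Suc n) Q" for Q
  proof -
    obtain Q' r' where Q': "std_tableau n Q'" "r' \<in> addable (row_len (shape Q'))" "Q = append_box Q' r' (Suc n)"
      using Q(1) by (rule std_tableau_Suc_cases)
    have d: "descends_from k n Q'" "row_of Q' n < r'"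
      using Q(3) descends_from_append_box[OF Q'(1,2) k kn] Q'(3) by simp_all
    then have "Q' \<in> {Q\<in>std_tableaux n. R Q \<and> descends_from k n Q}"
      using Q'(1,3) RR Q(2) by (simp add: std_tableaux_def)
    then have "Q' = C" using C(1) by simp
    then show ?thesis using Q' d add C by metis
  qed
  ultimately have "{Q\<in>std_tableaux (Suc n). R Q \<and> descends_from k (Suc n) Q} = {?C}"
    unfolding std_tableaux_def by blast
  moreover have "row_len (shape ?C) = F (Suc n)"
    using addable_le_length[OF C'(1) r] by (simp add: row_len_append_box C(2) F(1)[OF kn])
  moreover have "row_of ?C (Suc n) = \<rho> (Suc n)"
    using row_of_append_box_new[OF C'(1) addable_le_length[OF C'(1) r]] F(2)[OF kn] by simp
  ultimately show ?case by blast
qed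

lemma tab_sum_descending:
  assumes "append_stable k R" "1 \<le> k" "k \<le> n"
    and "{Q\<in>std_tableaux k. R Q} = {T}" "row_len (shape T) = F k" "row_of T k = \<rho> k"
    and "\<And>n. k \<le> n \<Longrightarrow> F (Suc n) = add_box (F n) (Suc (\<rho> n))"
      "\<And>n. k \<le> n \<Longrightarrow> \<rho> (Suc n) = Suc (\<rho> n)"
      "\<And>n i. k \<le> n \<Longrightarrow> F n i = 0 \<longleftrightarrow> \<rho> n < i"
  shows "tab_sum N n (\<lambda>Q. R Q \<and> descends_from k n Q) = schur_fun N (F n)"
proof -
  obtain C where C: "{Q\<in>std_tableaux n. R Q \<and> descends_from k n Q} = {C}" "row_len (shape C) = F n"
    using descending_tableau_unique[OF assms] by blast
  have "tab_sum N n (\<lambda>Q. R Q \<and> descends_from k n Q) =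
      (\<Sum>Q\<in>{Q\<in>std_tableaux n. R Q \<and> descends_from k n Q}. schur N (shape Q))"
    by (simp add: tab_sum_eq std_tableaux_def)
  then show ?thesis unfolding C(1) by (simp add: schur_eq_schur_fun C(2))
qed

section \<open>Seeds and the column of a full descending run\<close>

lemma std_tableaux_1: "std_tableaux 1 = {[[1]]}"
proof -
  have e: "std_tableau 0 []" using std_tableaux_0 by (auto simp: std_tableaux_def)
  have "std_tableau 1 [[1]]"
    using std_tableau_append_box[OF e, of 0] by (simp add: addable_def append_box_def)
  moreover have "Q = [[1]]" if "std_tableau 1 Q" for Q
  proof -
    have "std_tableau (Suc 0) Q" using that by simp
    then obtain Q' r where Q': "std_tableau 0 Q'" "r \<in> addable (row_len (shape Q'))" "Q = append_box Q' r (Suc 0)"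
      by (rule std_tableau_Suc_cases)
    then have "Q' = []" using std_tableaux_0 by (auto simp: std_tableaux_def)
    then show ?thesis using Q' by (simp add: append_box_def)
  qed
  ultimately show ?thesis unfolding std_tableaux_def by blast
qed

lemma tab_sum_descending_1:
  assumes "1 \<le> n"
  shows "tab_sum N n (\<lambda>Q. descends_from 1 n Q) = schur_fun N (column n)"
proof -
  have "tab_sum N n (\<lambda>Q. True \<and> descends_from 1 n Q) = schur_fun N (column n)"
  \<comment> \<open>Rows count from 0, so in a single column the entry \<open>n\<close> lies in row
    \<open>n - 1\<close>.\<close>
  proof (rule tab_sum_descending[where \<rho> = "\<lambda>n. n - 1" and T = "[[1]]"])
    show "row_len (shape [[1]]) = column 1"
      by (auto simp: row_len_def shape_def column_def)
    show "row_of [[1]] 1 = 1 - 1"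
      unfolding row_of_eq by (rule Least_equality) (simp_all add: row_def)
    show "{Q\<in>std_tableaux 1. True} = {[[1]]}" using std_tableaux_1 by simp
    fix m :: nat assume m: "1 \<le> m"
    show "column (Suc m) = add_box (column m) (Suc (m - 1))"
      using m by (intro ext) (auto simp: column_def add_box_apply)
    show "Suc m - 1 = Suc (m - 1)" using m by simp
    show "column m i = 0 \<longleftrightarrow> m - 1 < i" for i using m by (auto simp: column_def)
  qed (use assms in \<open>simp_all add: append_stable_def\<close>)
  then show ?thesis by simp
qed

lemma append_stable_restrict4: "append_stable 4 (\<lambda>Q. restrict4 Q = T)"
  unfolding append_stable_def
proof (intro allI impI)
  fix n Q r assume "4 \<le> (n::nat)"
  then have "restrict4 (append_box Q r (Suc n)) = restrict4 Q"
    unfolding restrict4_def by (intro filter_rows_append_box) simp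
  then show "(restrict4 (append_box Q r (Suc n)) = T) = (restrict4 Q = T)" by (simp only:)
qed

lemma restrict4_std_tableaux_4:
  assumes "std_tableau 4 T"
  shows "{Q\<in>std_tableaux 4. restrict4 Q = T} = {T}"
proof -
  have "restrict4 Q = Q" if "std_tableau 4 Q" for Q
    unfolding restrict4_def by (rule filter_rows_id[OF that]) simp
  then show ?thesis using assms by (auto simp: std_tableaux_def)
qed

lemma whitney_seeds:
  "std_tableau 2 [[1, 2]]" "std_tableau 3 [[1, 2], [3]]" "std_tableau 4 [[1, 2], [3], [4]]"
  "std_tableau 4 [[1, 2, 4], [3]]" "std_tableau 4 [[1, 2], [3, 4]]" "std_tableau 4 [[1, 2, 3], [4]]"
proof -
  note defs = addable_def append_box_def row_len_def shape_def
  have 1: "std_tableau 1 [[1]]" using std_tableaux_1 by (auto simp: std_tableaux_def)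
  have 2: "std_tableau 2 [[1, 2]]"
    using std_tableau_append_box[OF 1, of 0] by (simp add: defs numeral_2_eq_2)
  have 3: "std_tableau 3 [[1, 2], [3]]" "std_tableau 3 [[1, 2, 3]]"
    using std_tableau_append_box[OF 2, of 1] std_tableau_append_box[OF 2, of 0]
    by (simp_all add: defs)
  show "std_tableau 2 [[1, 2]]" "std_tableau 3 [[1, 2], [3]]" by (fact 2, fact 3(1))
  show "std_tableau 4 [[1, 2], [3], [4]]"
    using std_tableau_append_box[OF 3(1), of 2] by (simp add: defs)
  show "std_tableau 4 [[1, 2, 4], [3]]"
    using std_tableau_append_box[OF 3(1), of 0] by (simp add: defs)
  show "std_tableau 4 [[1, 2], [3, 4]]"
    using std_tableau_append_box[OF 3(1), of 1] by (simp add: defs)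
  show "std_tableau 4 [[1, 2, 3], [4]]"
    using std_tableau_append_box[OF 3(2), of 1] by (simp add: defs)
qed

section \<open>The recurrence for desarrangement tableaux\<close>

lemma psum_1_eq_column: "psum N 1 = schur_fun N (column 1)"
proof -
  have "addable (column 0) = {0}" by (auto simp: addable_def column_def)
  moreover have "add_box (column 0) 0 = column 1" by (auto simp: add_box_apply column_def)
  ultimately show ?thesis
    using schur_fun_Pieri[OF partition_fun_column, of N 0] by (simp add: schur_fun_column_0)
qed

text \<open>The equation (1 - c t) G = F read off in coefficients, where G is the product with the
  geometric series.\<close>

lemma geometric_mult_nth_Suc:
  fixes F :: "cpoly fps"
  shows "(Abs_fps (\<lambda>i. c ^ i) * F) $ Suc n = c * (Abs_fps (\<lambda>i. c ^ i) * F) $ n + F $ Suc n"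
  by (simp add: fps_mult_nth sum.atLeast0_atMost_Suc_shift sum_distrib_left mult.assoc del: sum.cl_ivl_Suc)

lemma spec_ch_lie_hat_0: "spec N (ch_lie_hat 0) = 1"
  by (simp add: spec_ch_lie_hat elem_fps_0)

lemma spec_ch_lie_hat_Suc:
  "spec N (ch_lie_hat (Suc n)) = psum N 1 * spec N (ch_lie_hat n) + (-1) ^ Suc n * schur_fun N (column (Suc n))"
  unfolding spec_ch_lie_hat geometric_mult_nth_Suc elem_fps_eq_column ..

lemma spec_ch_lie_hat_1: "spec N (ch_lie_hat 1) = 0"
  using spec_ch_lie_hat_Suc[of N 0] by (simp add: spec_ch_lie_hat_0 psum_1_eq_column[unfolded One_nat_def])

text \<open>The induction starts at size 1, where the first ascent is 1 and no tableau counts. The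
  empty tableau counts by convention and is treated apart.\<close>

lemma spec_ch_lie_hat_eq_tab_sum:
  "1 \<le> n \<Longrightarrow> spec N (ch_lie_hat n) = tab_sum N n (\<lambda>Q. even (first_ascent 1 n Q))"
proof (induction n rule: dec_induct)
  case base
  have "first_ascent 1 1 Q = 1" for Q
    by (rule first_ascent_descends) (auto simp: descends_from_def)
  then show ?case by (simp add: tab_sum_def spec_ch_lie_hat_1[unfolded One_nat_def])
next
  case (step n)
  have "append_stable 1 (\<lambda>Q. True)" by (simp add: append_stable_def)
  from tab_sum_parity_Suc[OF this order_refl, of n N True] step.hyps
  have "tab_sum N (Suc n) (\<lambda>Q. even (first_ascent 1 (Suc n) Q)) =
      psum N 1 * tab_sum N n (\<lambda>Q. even (first_ascent 1 n Q)) +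
      (if even (Suc n) then 1 else - 1) * tab_sum N (Suc n) (\<lambda>Q. descends_from 1 (Suc n) Q)"
    by simp
  also have "tab_sum N (Suc n) (\<lambda>Q. descends_from 1 (Suc n) Q) = schur_fun N (column (Suc n))"
    by (rule tab_sum_descending_1) simp
  also have "(if even (Suc n) then 1 else - 1 :: cpoly) = (-1) ^ Suc n" by simp
  finally show ?case by (simp only: spec_ch_lie_hat_Suc step.IH)
qed

lemma desarr_tableau_iff:
  "1 \<le> n \<Longrightarrow> desarr_tableau n Q \<longleftrightarrow> std_tableau n Q \<and> even (first_ascent 1 n Q)"
proof -
  have "1 \<le> i \<and> is_ascent n Q i \<longleftrightarrow> is_ascent n Q i" for i by (auto simp: is_ascent_def)
  then have "first_ascent 1 n Q = (LEAST i. is_ascent n Q i)" unfolding first_ascent_def by (simp only:)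
  then show "1 \<le> n \<Longrightarrow> desarr_tableau n Q \<longleftrightarrow> std_tableau n Q \<and> even (first_ascent 1 n Q)"
    by (simp add: desarr_tableau_def)
qed

lemma schur_Nil: "schur N [] = 1"
proof -
  have "row_len [] = column 0" by (auto simp: row_len_def column_def)
  then show ?thesis by (simp add: schur_eq_schur_fun schur_fun_column_0)
qed

lemma desarrangement_sum:
  "spec N (ch_lie_hat n) = (\<Sum>Q\<in>{Q. desarr_tableau n Q}. schur N (shape Q))"
proof (cases "n = 0")
  case True
  have "{Q. desarr_tableau 0 Q} = {[]}"
    using std_tableaux_0 by (simp add: desarr_tableau_def std_tableaux_def)
  then show ?thesis using True by (simp add: spec_ch_lie_hat_0 shape_def schur_Nil)
next
  case False
  then have "1 \<le> n" by simp
  then show ?thesis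
    by (simp only: spec_ch_lie_hat_eq_tab_sum tab_sum_eq desarr_tableau_iff)
qed

section \<open>The recurrence for Whitney-generating tableaux\<close>

definition W_fps :: "nat \<Rightarrow> cpoly fps" where
  "W_fps N = (1 + fps_const (psum N 2) * fps_X ^ 2) * elem_fps N"

lemma W_fps_nth:
  "W_fps N $ n = elem_fps N $ n + (if n < 2 then 0 else psum N 2 * elem_fps N $ (n - 2))"
  by (simp add: W_fps_def distrib_right mult.assoc fps_X_power_mult_nth)

text \<open>The indices of the two column terms differ by 2, so they share a sign; the bracket is
  the left side of \<open>psum_2_column\<close>.\<close>

lemma W_fps_Suc_Suc:
  "W_fps N $ Suc (Suc n) =
    (-1) ^ n * (psum N 2 * schur_fun N (column n) + schur_fun N (column (Suc (Suc n))))"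
  by (simp add: W_fps_nth elem_fps_eq_column algebra_simps)

lemma spec_ch_W_hat_0: "spec N (ch_W_hat 0) = 1"
  by (simp add: spec_ch_W_hat elem_fps_0 fps_mult_nth)

lemma spec_ch_W_hat_Suc:
  "spec N (ch_W_hat (Suc n)) = psum N 1 * spec N (ch_W_hat n) + W_fps N $ Suc n"
proof -
  have "(1 + fps_const (psum N 2) * fps_X ^ 2) * (Abs_fps (\<lambda>i. psum N 1 ^ i) * elem_fps N) =
      Abs_fps (\<lambda>i. psum N 1 ^ i) * W_fps N"
    by (simp only: W_fps_def mult.left_commute)
  then show ?thesis unfolding spec_ch_W_hat by (simp only: geometric_mult_nth_Suc)
qed

lemma spec_ch_W_hat_1: "spec N (ch_W_hat 1) = 0"
  using spec_ch_W_hat_Suc[of N 0]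
  by (simp add: spec_ch_W_hat_0 W_fps_nth elem_fps_eq_column psum_1_eq_column[unfolded One_nat_def])

lemma spec_ch_W_hat_2: "spec N (ch_W_hat 2) = schur_fun N (hook 2 0)"
  using spec_ch_W_hat_Suc[of N 1] spec_ch_W_hat_1[of N] W_fps_Suc_Suc[of N 0] psum_2_column[of N 0]
  by (simp add: numeral_2_eq_2[symmetric])

lemma Pieri_hook_2_0:
  "psum N 1 * schur_fun N (hook 2 0) = schur_fun N (hook 3 0) + schur_fun N (hook 2 1)"
proof -
  have "addable (hook 2 0) = {0, 1}" by (auto simp: addable_def hook_def split: if_splits)
  moreover have "add_box (hook 2 0) 0 = hook 3 0" "add_box (hook 2 0) 1 = hook 2 1"
    by (auto simp: add_box_apply hook_def)
  ultimately show ?thesis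
    using schur_fun_Pieri[OF partition_fun_hook, of 2 N 0] by simp
qed

lemma spec_ch_W_hat_3: "spec N (ch_W_hat 3) = schur_fun N (hook 2 1)"
proof -
  have "W_fps N $ Suc 2 = - schur_fun N (hook 3 0)"
    using W_fps_Suc_Suc[of N 1, unfolded psum_2_column] by (simp add: numeral_2_eq_2)
  then have "spec N (ch_W_hat (Suc 2)) = schur_fun N (hook 2 1)"
    unfolding spec_ch_W_hat_Suc spec_ch_W_hat_2 Pieri_hook_2_0 by simp
  then show ?thesis by simp
qed

lemma Pieri_hook_2_1:
  "psum N 1 * schur_fun N (hook 2 1) =
    schur_fun N (hook 3 1) + schur_fun N (fat_hook 2 0) + schur_fun N (hook 2 2)"
proof -
  have "i \<in> addable (hook 2 1) \<longleftrightarrow> i \<in> {0, 1, 2}" for i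
    by (cases "i = 0"; cases "i = 1"; cases "i = 2") (auto simp: addable_def hook_def)
  then have "addable (hook 2 1) = {0, 1, 2}" by blast
  moreover have "add_box (hook 2 1) 0 = hook 3 1" "add_box (hook 2 1) 1 = fat_hook 2 0"
    "add_box (hook 2 1) 2 = hook 2 2"
    by (auto simp: add_box_apply hook_def fat_hook_def fun_eq_iff)
  ultimately show ?thesis
    using schur_fun_Pieri[OF partition_fun_hook, of 2 N 1] by (simp add: add.assoc)
qed

lemma W_fps_large:
  assumes "4 \<le> n"
  shows "W_fps N $ n = (-1) ^ n * (schur_fun N (hook 3 (n - 3)) - schur_fun N (fat_hook 2 (n - 4)))"
proof -
  define k where "k = n - 2"
  have k: "n = Suc (Suc k)" "2 \<le> k" using assms by (auto simp: k_def)
  then have "n - 3 = k - 1" "n - 4 = k - 2" "k \<noteq> 0" "k \<noteq> 1" by simp_all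
  then show ?thesis
    using W_fps_Suc_Suc[of N k, unfolded psum_2_column] k(1) by simp
qed

text \<open>The s(2,2) from Pieri's rule cancels against the inhomogeneous term. This matches
  \<open>T3\<close> not counting at size 4, where its first ascent from 4 on is 4 and thus
  even.\<close>

lemma spec_ch_W_hat_4:
  "spec N (ch_W_hat 4) = schur_fun N (hook 2 2) + 2 * schur_fun N (hook 3 1)"
proof -
  have "spec N (ch_W_hat (Suc 3)) = psum N 1 * spec N (ch_W_hat 3) + W_fps N $ Suc 3"
    by (rule spec_ch_W_hat_Suc)
  also have "W_fps N $ Suc 3 = schur_fun N (hook 3 1) - schur_fun N (fat_hook 2 0)"
    using W_fps_large[of 4 N] by simp
  finally show ?thesis
    unfolding spec_ch_W_hat_3 Pieri_hook_2_1 by simp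
qed

abbreviation "T1 \<equiv> [[1, 2], [3], [4]] :: nat list list"
abbreviation "T2 \<equiv> [[1, 2, 4], [3]] :: nat list list"
abbreviation "T3 \<equiv> [[1, 2], [3, 4]] :: nat list list"
abbreviation "T4 \<equiv> [[1, 2, 3], [4]] :: nat list list"

text \<open>In \<open>T3\<close> the entry 4 lies in row 1, counted from 0, and each later entry of
  the run opens a row. So the entry \<open>n\<close> is in row \<open>n - 3\<close>, and
  \<open>n - 4\<close> single boxes hang below the square.\<close>

lemma tab_sum_descending_T3:
  assumes "4 \<le> n"
  shows "tab_sum N n (\<lambda>Q. restrict4 Q = T3 \<and> descends_from 4 n Q) = schur_fun N (fat_hook 2 (n - 4))"
proof (rule tab_sum_descending[OF append_stable_restrict4 _ assms restrict4_std_tableaux_4[OF whitney_seeds(5)],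
    where F = "\<lambda>n. fat_hook 2 (n - 4)" and \<rho> = "\<lambda>n. n - 3"])
  show "row_len (shape T3) = fat_hook 2 (4 - 4)"
    by (auto simp: row_len_def shape_def fat_hook_def fun_eq_iff less_Suc_eq nth_Cons' )
  show "row_of T3 4 = 4 - 3"
    unfolding row_of_eq by (rule Least_equality) (auto simp: row_def nth_Cons' split: if_splits)
  fix m :: nat assume m: "4 \<le> m"
  show "fat_hook 2 (Suc m - 4) = add_box (fat_hook 2 (m - 4)) (Suc (m - 3))"
    using m by (intro ext) (auto simp: fat_hook_def add_box_apply)
  show "Suc m - 3 = Suc (m - 3)" using m by simp
  show "fat_hook 2 (m - 4) i = 0 \<longleftrightarrow> m - 3 < i" for i using m by (auto simp: fat_hook_def)
qed simp

text \<open>As for \<open>T3\<close>, but the entry 4 is itself the first box of the leg, which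
  therefore has \<open>n - 3\<close> boxes.\<close>

lemma tab_sum_descending_T4:
  assumes "4 \<le> n"
  shows "tab_sum N n (\<lambda>Q. restrict4 Q = T4 \<and> descends_from 4 n Q) = schur_fun N (hook 3 (n - 3))"
proof (rule tab_sum_descending[OF append_stable_restrict4 _ assms restrict4_std_tableaux_4[OF whitney_seeds(6)],
    where F = "\<lambda>n. hook 3 (n - 3)" and \<rho> = "\<lambda>n. n - 3"])
  show "row_len (shape T4) = hook 3 (4 - 3)"
    by (auto simp: row_len_def shape_def hook_def fun_eq_iff less_Suc_eq nth_Cons')
  show "row_of T4 4 = 4 - 3"
    unfolding row_of_eq by (rule Least_equality) (auto simp: row_def nth_Cons' split: if_splits)
  fix m :: nat assume m: "4 \<le> m"
  show "hook 3 (Suc m - 3) = add_box (hook 3 (m - 3)) (Suc (m - 3))"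
    using m by (intro ext) (auto simp: hook_def add_box_apply)
  show "Suc m - 3 = Suc (m - 3)" using m by simp
  show "hook 3 (m - 3) i = 0 \<longleftrightarrow> m - 3 < i" for i using m by (auto simp: hook_def)
qed simp

text \<open>The parity conditions are comparisons with a truth value in order to match
  \<open>tab_sum_parity_Suc\<close>, which treats both parities at once.\<close>

definition whitney_sum :: "nat \<Rightarrow> nat \<Rightarrow> cpoly" where
  "whitney_sum N n =
    tab_sum N n (\<lambda>Q. restrict4 Q = T1) + tab_sum N n (\<lambda>Q. restrict4 Q = T2) +
    tab_sum N n (\<lambda>Q. restrict4 Q = T3 \<and> even (first_ascent 4 n Q) = False) +
    tab_sum N n (\<lambda>Q. restrict4 Q = T4 \<and> even (first_ascent 4 n Q) = True)"

lemma tab_sum_seed: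
  assumes "std_tableau 4 T"
  shows "tab_sum N 4 (\<lambda>Q. restrict4 Q = T) = schur N (shape T)"
proof -
  have "{Q. std_tableau 4 Q \<and> restrict4 Q = T} = {T}"
    using restrict4_std_tableaux_4[OF assms] by (simp add: std_tableaux_def)
  then show ?thesis unfolding tab_sum_eq by simp
qed

lemma whitney_sum_4: "whitney_sum N 4 = schur_fun N (hook 2 2) + 2 * schur_fun N (hook 3 1)"
proof -
  have "first_ascent 4 4 Q = 4" for Q
    by (rule first_ascent_descends) (auto simp: descends_from_def)
  then have "whitney_sum N 4 = schur N (shape T1) + schur N (shape T2) + schur N (shape T4)"
    using tab_sum_seed[OF whitney_seeds(3)] tab_sum_seed[OF whitney_seeds(4)] tab_sum_seed[OF whitney_seeds(6)]
    by (simp add: whitney_sum_def) (simp add: tab_sum_def)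
  moreover have "row_len (shape T1) = hook 2 2" "row_len (shape T2) = hook 3 1" "row_len (shape T4) = hook 3 1"
    by (auto simp: row_len_def shape_def hook_def fun_eq_iff less_Suc_eq nth_Cons')
  ultimately show ?thesis by (simp add: schur_eq_schur_fun)
qed

text \<open>Prolonging the descending run gains a tableau over one of \<open>T3\<close>,
  \<open>T4\<close> and loses one over the other, according to the parity of the new size. The net
  change is the inhomogeneous term of the recurrence.\<close>

lemma spec_ch_W_hat_eq_whitney_sum:
  "4 \<le> n \<Longrightarrow> spec N (ch_W_hat n) = whitney_sum N n"
proof (induction n rule: dec_induct)
  case base
  show ?case by (simp only: spec_ch_W_hat_4 whitney_sum_4)
next
  case (step n)
  have n: "4 \<le> n" using step by simp
  have k: "(1::nat) \<le> 4" by simp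
  have "whitney_sum N (Suc n) = psum N 1 * whitney_sum N n +
      ((if even (Suc n) = False then 1 else - 1) * schur_fun N (fat_hook 2 (Suc n - 4)) +
       (if even (Suc n) = True then 1 else - 1) * schur_fun N (hook 3 (Suc n - 3)))"
    unfolding whitney_sum_def tab_sum_Suc[OF append_stable_restrict4 n]
      tab_sum_parity_Suc[OF append_stable_restrict4 k n]
      tab_sum_descending_T3[OF le_SucI[OF n]] tab_sum_descending_T4[OF le_SucI[OF n]]
    by (simp only: distrib_left ac_simps)
  also have "\<dots> = psum N 1 * whitney_sum N n + W_fps N $ Suc n"
    by (subst W_fps_large) (use n in \<open>auto simp: algebra_simps\<close>)
  finally show ?case by (simp only: spec_ch_W_hat_Suc step.IH)
qed

lemma tab_sum_disj:
  assumes "\<And>Q. \<not> (c Q \<and> d Q)"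
  shows "tab_sum N n (\<lambda>Q. c Q \<or> d Q) = tab_sum N n c + tab_sum N n d"
  unfolding tab_sum_def sum.distrib[symmetric] using assms by (intro sum.cong refl) auto

lemma length_concat_std_tableau:
  assumes "std_tableau n Q" shows "length (concat Q) = n"
proof -
  have "size (mset (concat Q)) = size (mset [1..<Suc n])"
    using assms by (simp only: std_tableau_def)
  then show ?thesis by (simp only: size_mset length_upt)
qed

lemma whitney_sum_large:
  assumes "4 \<le> n"
  shows "whitney_sum N n = (\<Sum>Q\<in>{Q. whitney_tableau n Q}. schur N (shape Q))"
proof -
  \<comment> \<open>The sporadic tableaux have at most three entries, so from size 4 on only the
    four restrictions remain; being distinct, they split the sum.\<close>
  have small: "\<not> std_tableau n []" "\<not> std_tableau n [[1, 2]]" "\<not> std_tableau n [[1, 2], [3]]"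
    using assms length_concat_std_tableau[of n "[]"] length_concat_std_tableau[of n "[[1, 2]]"]
      length_concat_std_tableau[of n "[[1, 2], [3]]"] by auto
  have "(\<Sum>Q\<in>{Q. whitney_tableau n Q}. schur N (shape Q)) =
      tab_sum N n (\<lambda>Q. ((restrict4 Q = T1 \<or> restrict4 Q = T2) \<or>
        (restrict4 Q = T3 \<and> even (first_ascent 4 n Q) = False)) \<or>
        (restrict4 Q = T4 \<and> even (first_ascent 4 n Q) = True))"
    unfolding tab_sum_eq first_ascent_def
  proof (rule sum.cong[OF _ refl], rule Collect_cong)
    fix Q
    show "whitney_tableau n Q \<longleftrightarrow> std_tableau n Q \<and> (((restrict4 Q = T1 \<or> restrict4 Q = T2) \<or>
        (restrict4 Q = T3 \<and> even (LEAST i. 4 \<le> i \<and> is_ascent n Q i) = False)) \<or>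
        (restrict4 Q = T4 \<and> even (LEAST i. 4 \<le> i \<and> is_ascent n Q i) = True))"
      using small assms unfolding whitney_tableau_def by blast
  qed
  also have "\<dots> = whitney_sum N n"
    unfolding whitney_sum_def by (subst tab_sum_disj, simp)+ simp
  finally show ?thesis by simp
qed

lemma whitney_sum_small:
  assumes "n < 4"
  shows "spec N (ch_W_hat n) = (\<Sum>Q\<in>{Q. whitney_tableau n Q}. schur N (shape Q))"
proof -
  have small: "whitney_tableau n Q \<longleftrightarrow> std_tableau n Q \<and> (Q = [] \<or> Q = [[1, 2]] \<or> Q = [[1, 2], [3]])" for Q
    using assms by (simp add: whitney_tableau_def)
  have s0: "std_tableau 0 []" by (simp add: std_tableau_def)
  consider "n = 0" | "n = 1" | "n = 2" | "n = 3" using assms by linarith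
  then show ?thesis
  proof cases
    case 1
    then have "{Q. whitney_tableau n Q} = {[]}"
      unfolding small using s0 by (auto dest: length_concat_std_tableau)
    then show ?thesis using 1 by (simp add: spec_ch_W_hat_0 shape_def schur_Nil)
  next
    case 2
    then have "{Q. whitney_tableau n Q} = {}"
      unfolding small by (auto dest: length_concat_std_tableau)
    then show ?thesis using 2 by (simp add: spec_ch_W_hat_1[unfolded One_nat_def])
  next
    case 3
    then have "{Q. whitney_tableau n Q} = {[[1, 2]]}"
      unfolding small using whitney_seeds(1) by (auto dest: length_concat_std_tableau)
    moreover have "row_len (shape [[1, 2 :: nat]]) = hook 2 0"
      by (auto simp: row_len_def shape_def hook_def)
    ultimately show ?thesis using 3 by (simp add: spec_ch_W_hat_2 schur_eq_schur_fun)
  next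
    case 4
    then have "{Q. whitney_tableau n Q} = {[[1, 2], [3]]}"
      unfolding small using whitney_seeds(2) by (auto dest: length_concat_std_tableau)
    moreover have "row_len (shape [[1, 2], [3 :: nat]]) = hook 2 1"
      by (auto simp: row_len_def shape_def hook_def less_Suc_eq nth_Cons')
    ultimately show ?thesis using 4 by (simp add: spec_ch_W_hat_3 schur_eq_schur_fun)
  qed
qed

theorem theorem1p3:
  fixes n N :: nat
  shows "spec N (ch_lie_hat n) = (\<Sum>Q\<in>{Q. desarr_tableau n Q}. schur N (shape Q))
       \<and> spec N (ch_W_hat n) = (\<Sum>Q\<in>{Q. whitney_tableau n Q}. schur N (shape Q))"
proof
  show "spec N (ch_lie_hat n) = (\<Sum>Q\<in>{Q. desarr_tableau n Q}. schur N (shape Q))"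
    by (rule desarrangement_sum)
  show "spec N (ch_W_hat n) = (\<Sum>Q\<in>{Q. whitney_tableau n Q}. schur N (shape Q))"
    using whitney_sum_small whitney_sum_large spec_ch_W_hat_eq_whitney_sum by (cases "n < 4") simp_all
qed

end
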